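(* Let $(X,d)$ be a complete doubling metric space and let $\mathcal N$ be a counting function on $X$ satisfying (C1)–(C6), with constant $G\ge0$ in (C5). Let $\mathrm T=(\mathcal T,\{x_I\},\{r_I\})$ satisfy (T1), (T2), (T'3), (T4), (T5) and (M1)–(M7) with respect to $G$, with exponent $s$, and let $K$ be its generated set. Then there exists $0<\theta<\infty$ such that $\lim_{\varepsilon\to0+}\varepsilon^s\mathcal N(\varepsilon,K)=\theta$.
   Context: Counting functions: $\mathcal N$ assigns to every compact $K\subseteq X$ and $\varepsilon>0$ a number $\mathcal N(\varepsilon,K)\in[0,\infty)$. $\mathcal S(\varepsilon,K)$ is the maximal cardinality of a subset of $K$ whose distinct points have distance $>\varepsilon$. Conditions: (C1) $\mathcal N(\varepsilon,K)\le\mathcal N(\delta,K)$ for $\delta\le\varepsilon$; (C2) $\mathcal N(\varepsilon,H)\le\mathcal N(\varepsilon,K)$ for $H\subseteq K$; (C3) $\mathcal N(\varepsilon,\bigcup_{i=1}^nK_i)\le\sum_{i=1}^n\mathcal N(\varepsilon,K_i)$; (C4) there is $A>0$ with $\mathcal N(\varepsilon,K\cup Q)=\mathcal N(\varepsilon,K)+\mathcal N(\varepsilon,Q)$ whenever $\operatorname{dist}(K,Q)>A\varepsilon$; (C5) there is $G\ge0$ such that for all $\tau,L>0$: $\mathcal N(\varepsilon,K)\ge\mathcal N(L\varepsilon,\phi(K))$ whenever $\phi:X\to X$ is $L$-Lipschitz on $K_{G\tau}$ and $\varepsilon\le\tau$; (C6) there is $B>0$ with $\frac1B\mathcal S(B\varepsilon,K)\le\mathcal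 N(\varepsilon,K)\le B\mathcal S(\varepsilon/B,K)$. (Examples: packing number, covering number, $\mathcal S$.) Words: $A_N=\{0,\dots,N-1\}$ ($N\ge2$), $\Sigma_N=A_N^{\mathbb N}$, shift $\sigma(\omega_1\omega_2\dots)=\omega_2\omega_3\dots$; for a finite word $I$, $\sigma^n(I)=I_{n+1}\cdots I_{|I|}$. For $\mathcal T\subseteq\Sigma_N$, $\mathcal T^*$ is the set of finite prefixes $\omega|_k$ ($k\ge0$) of elements of $\mathcal T$, $\mathcal T_k$ those of length $k$; $\prec$ prefix relation; $IJ$ concatenation; incomparable words differ at some position $\le$ the shorter length. $\mathcal T\cup\mathcal T^*\subseteq\Sigma_{N+1}$ via $I\mapsto I\,N\,N\cdots$, metric $2^{-(\text{common prefix length})}$; $\operatorname{var}_ng=\sup\{|g(\omega)-g(\tau)|:\omega|_n=\tau|_n\}$; $g$ Hölder if $\sup_n\operatorname{var}_n(g)/a^n<\infty$ for some $a\in(0,1)$. $f,g$ on $\mathcal T$ cohomologous if $f-g=h\circ\sigma-h$, $h$ continuous; $f$ lattice if cohomologous to a function valued in a proper closed subgroup of $\mathbb R$, non-lattice otherwise. Tree conditions for $x_I\in X$, $0<r_I<\infty$ (constants $\rho,C,D,E>0$): (T1) $d(x_I,x_J)\ge C(r_I+r_J)$ for incomparable $I,J\in\mathcal T^*$; (T2) $\operatorname{diam}\{x_{IJ}:IJ\in\mathcal T^*\}\le Dr_I$; (T'3) for all $I$, $n\ge0$ and every $\mathcal I\subseteq\bigcup_{k\ge n}\mathcal T_k$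 such that each $\omega\in\mathcal T$ has exactly one prefix in $\mathcal I$ and some element of $\mathcal I$ extends $I$: $\frac1Er_I^s\le\sum_{IJ\in\mathcal I}r_{IJ}^s\le Er_I^s$; (T4) $r_I\to0$ as $|I|\to\infty$; (T5) $r_{Ij}\ge\rho r_I$. Generated set $K=\{x_\omega:\omega\in\mathcal T\}$, $x_\omega=\lim_nx_{\omega|_n}$; $K_I=\{x_\omega\in K:I\prec\omega\}$; $A_r=\{x:\operatorname{dist}(x,A)\le r\}$. (M1)–(M7) w.r.t. $G\ge0$ (all words in $\mathcal T^*$): (M1) $\mathcal T=\{\omega:A_{\omega_n\omega_{n+1}}=1\ \forall n\}$ for an irreducible aperiodic $A\in\{0,1\}^{N\times N}$. (M2) $\{x_I\}\subseteq K$. (M3) $r_{Ii}\le Rr_I$ for some $0<R<1$. (M4) bi-Lipschitz $\varphi_i:X\to X$ and $W,\delta_0>0$ with $\varphi_I=\varphi_{I_1}\circ\dots\circ\varphi_{I_{|I|}}$, $\varphi_\varnothing=\mathrm{id}$, $\varphi_I(K_J)=K_{IJ}$ and $(K_I)_{r_IWG\delta}\subseteq\varphi_I(K_{G\delta})$ for $\delta\le\delta_0$. (M5) for fixed $\xi\in(0,\delta_0)$, $\kappa^\mp_{i,J}$ are the optimal constants with $\kappa^-_{i,J}\frac{r_{iJ}}{r_J}d(x,y)\le d(\varphi_ix,\varphi_iy)\le\kappa^+_{i,J}\frac{r_{iJ}}{r_J}d(x,y)$ for $x,y\in\varphi_J(K_{G\xi})$, $\kappa^\pm_{I,J}=\prod_{n=1}^{|I|}\kappa^\pm_{I_n,\sigma^n(I)J}$,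 and $\kappa^\pm_{I,J}\to1$ as $|J|\to\infty$ uniformly in $I$. (M6) with $f_1(iJ)=\log\frac{r_J}{r_{iJ}\kappa^+_{i,J}}$, $f_2(iJ)=\log\frac{r_J}{r_{iJ}\kappa^-_{i,J}}$, $f_1(\varnothing)=f_2(\varnothing)=0$: $r_{i\omega|_n}/r_{\omega|_n}\to\rho_{i\omega}\in(0,1)$, $\omega\mapsto\rho_\omega$ continuous on $\mathcal T$, and Hölder extensions $\tilde f_1,\tilde f_2$ of $f_1,f_2$ to $\mathcal T\cup\mathcal T^*$ exist with $\tilde f_1=\tilde f_2=\log(1/\rho_\omega)=:f(\omega)$ on $\mathcal T$. (M7) $f$ is non-lattice. *)

theory Defs
  imports "HOL-Analysis.Analysis" "HOL-Library.Sublist"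
begin

text \<open>Closed r-neighbourhood A_r = {x. dist(x,A) <= r}; empty for empty A (dist(x,{}) = infinity).\<close>
definition nbhd :: "'a::metric_space set \<Rightarrow> real \<Rightarrow> 'a set" where
  "nbhd A r = (if A = {} then {} else {x. infdist x A \<le> r})"

definition doubling_space :: "'a::metric_space itself \<Rightarrow> bool" where
  "doubling_space _ \<longleftrightarrow> (\<exists>M::nat. \<forall>(x::'a) r. 0 < r \<longrightarrow>
      (\<exists>F. finite F \<and> card F \<le> M \<and> ball x (2 * r) \<subseteq> (\<Union>y\<in>F. ball y r)))"

definition bi_lipschitz :: "('a::metric_space \<Rightarrow> 'a) \<Rightarrow> bool" where
  "bi_lipschitz g \<longleftrightarrow> (\<exists>L>0. \<forall>x y. dist x y \<le> L * dist (g x) (g y) \<and> dist (g x) (g y) \<le> L * dist x y)"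

definition sep_number :: "real \<Rightarrow> 'a::metric_space set \<Rightarrow> real" where
  "sep_number eps K = Sup {real (card F) | F. finite F \<and> F \<subseteq> K \<and>
      (\<forall>x\<in>F. \<forall>y\<in>F. x \<noteq> y \<longrightarrow> eps < dist x y)}"

definition counting_function :: "(real \<Rightarrow> 'a::metric_space set \<Rightarrow> real) \<Rightarrow> real \<Rightarrow> bool" where
  "counting_function N G \<longleftrightarrow>
    (\<forall>eps K. compact K \<and> 0 < eps \<longrightarrow> 0 \<le> N eps K) \<and>
    \<comment> \<open>C1\<close>
    (\<forall>eps delta K. compact K \<and> 0 < delta \<and> delta \<le> eps \<longrightarrow> N eps K \<le> N delta K) \<and>
    \<comment> \<open>C2\<close>
    (\<forall>eps H K. compact H \<and> compact K \<and> H \<subseteq> K \<and> 0 < eps \<longrightarrow> N eps H \<le> N eps K) \<and>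
    \<comment> \<open>C3\<close>
    (\<forall>eps (n::nat) Ks. (\<forall>i<n. compact (Ks i)) \<and> 0 < eps \<longrightarrow>
        N eps (\<Union>i<n. Ks i) \<le> (\<Sum>i<n. N eps (Ks i))) \<and>
    \<comment> \<open>C4\<close>
    (\<exists>A>0. \<forall>eps K Q. compact K \<and> compact Q \<and> 0 < eps \<and> setdist K Q > A * eps \<longrightarrow>
        N eps (K \<union> Q) = N eps K + N eps Q) \<and>
    \<comment> \<open>C5, with the given constant G\<close>
    0 \<le> G \<and>
    (\<forall>tau L eps K (phi::'a \<Rightarrow> 'a). 0 < tau \<and> 0 < L \<and> compact K \<and>
        L-lipschitz_on (nbhd K (G * tau)) phi \<and> 0 < eps \<and> eps \<le> tau \<longrightarrow>
        N (L * eps) (phi ` K) \<le> N eps K) \<and>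
    \<comment> \<open>C6\<close>
    (\<exists>B>0. \<forall>eps K. compact K \<and> 0 < eps \<longrightarrow>
        sep_number (B * eps) K / B \<le> N eps K \<and> N eps K \<le> B * sep_number (eps / B) K)"

text \<open>Infinite words are functions nat => nat (letter omega k is the (k+1)-st letter),
  finite words are lists; the alphabet is {0..<N}.\<close>

definition pre :: "(nat \<Rightarrow> nat) \<Rightarrow> nat \<Rightarrow> nat list" where
  "pre \<omega> k = map \<omega> [0..<k]"

definition shift :: "(nat \<Rightarrow> nat) \<Rightarrow> nat \<Rightarrow> nat" where
  "shift \<omega> = (\<lambda>k. \<omega> (Suc k))"

definition tstar :: "(nat \<Rightarrow> nat) set \<Rightarrow> nat list set" where
  "tstar T = {pre \<omega> k | \<omega> k. \<omega> \<in> T}"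

definition incomparable :: "nat list \<Rightarrow> nat list \<Rightarrow> bool" where
  "incomparable I J \<longleftrightarrow> \<not> prefix I J \<and> \<not> prefix J I"

text \<open>Embedding of finite words into Sigma_{N+1}: I |-> I N N N ...\<close>
definition emb :: "nat \<Rightarrow> nat list \<Rightarrow> nat \<Rightarrow> nat" where
  "emb N I = (\<lambda>k. if k < length I then I ! k else N)"

definition holder_on :: "(nat \<Rightarrow> nat) set \<Rightarrow> ((nat \<Rightarrow> nat) \<Rightarrow> real) \<Rightarrow> bool" where
  "holder_on U g \<longleftrightarrow> (\<exists>a. 0 < a \<and> a < 1 \<and> (\<exists>M. \<forall>n. \<forall>\<omega>\<in>U. \<forall>\<tau>\<in>U.
      (\<forall>k<n. \<omega> k = \<tau> k) \<longrightarrow> \<bar>g \<omega> - g \<tau>\<bar> \<le> M * a ^ n))"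

text \<open>Continuity on U w.r.t. the metric 2^-(common prefix length).\<close>
definition word_continuous_on :: "(nat \<Rightarrow> nat) set \<Rightarrow> ((nat \<Rightarrow> nat) \<Rightarrow> real) \<Rightarrow> bool" where
  "word_continuous_on U h \<longleftrightarrow> (\<forall>\<omega>\<in>U. \<forall>e>0. \<exists>n. \<forall>\<tau>\<in>U.
      (\<forall>k<n. \<tau> k = \<omega> k) \<longrightarrow> \<bar>h \<tau> - h \<omega>\<bar> < e)"

definition cohomologous :: "(nat \<Rightarrow> nat) set \<Rightarrow> ((nat \<Rightarrow> nat) \<Rightarrow> real) \<Rightarrow> ((nat \<Rightarrow> nat) \<Rightarrow> real) \<Rightarrow> bool" where
  "cohomologous T f g \<longleftrightarrow> (\<exists>h. word_continuous_on T h \<and>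
      (\<forall>\<omega>\<in>T. f \<omega> - g \<omega> = h (shift \<omega>) - h \<omega>))"

definition proper_closed_subgroup :: "real set \<Rightarrow> bool" where
  "proper_closed_subgroup H \<longleftrightarrow> closed H \<and> H \<noteq> UNIV \<and> 0 \<in> H \<and>
      (\<forall>x\<in>H. \<forall>y\<in>H. x + y \<in> H) \<and> (\<forall>x\<in>H. - x \<in> H)"

definition lattice_fun :: "(nat \<Rightarrow> nat) set \<Rightarrow> ((nat \<Rightarrow> nat) \<Rightarrow> real) \<Rightarrow> bool" where
  "lattice_fun T f \<longleftrightarrow> (\<exists>g H. proper_closed_subgroup H \<and> (\<forall>\<omega>\<in>T. g \<omega> \<in> H) \<and> cohomologous T f g)"

text \<open>Transition matrix A in {0,1}^{N x N} encoded as a boolean relation on {0..<N}.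
  walk A N m i j  <->  (A^m)_{ij} > 0.\<close>
definition walk :: "(nat \<Rightarrow> nat \<Rightarrow> bool) \<Rightarrow> nat \<Rightarrow> nat \<Rightarrow> nat \<Rightarrow> nat \<Rightarrow> bool" where
  "walk A N m i j \<longleftrightarrow> (\<exists>w. length w = Suc m \<and> w ! 0 = i \<and> w ! m = j \<and>
      (\<forall>k\<le>m. w ! k < N) \<and> (\<forall>k<m. A (w ! k) (w ! Suc k)))"

definition irreducible_mat :: "nat \<Rightarrow> (nat \<Rightarrow> nat \<Rightarrow> bool) \<Rightarrow> bool" where
  "irreducible_mat N A \<longleftrightarrow> (\<forall>i<N. \<forall>j<N. \<exists>m>0. walk A N m i j)"

definition aperiodic_mat :: "nat \<Rightarrow> (nat \<Rightarrow> nat \<Rightarrow> bool) \<Rightarrow> bool" where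
  "aperiodic_mat N A \<longleftrightarrow> (\<forall>i<N. Gcd {m. 0 < m \<and> walk A N m i i} = 1)"

definition sft :: "nat \<Rightarrow> (nat \<Rightarrow> nat \<Rightarrow> bool) \<Rightarrow> (nat \<Rightarrow> nat) set" where
  "sft N A = {\<omega>. \<forall>n. \<omega> n < N \<and> A (\<omega> n) (\<omega> (Suc n))}"

definition xlim :: "(nat list \<Rightarrow> 'a::metric_space) \<Rightarrow> (nat \<Rightarrow> nat) \<Rightarrow> 'a" where
  "xlim x \<omega> = lim (\<lambda>n. x (pre \<omega> n))"

definition gen_set :: "(nat \<Rightarrow> nat) set \<Rightarrow> (nat list \<Rightarrow> 'a::metric_space) \<Rightarrow> 'a set" where
  "gen_set T x = xlim x ` T"

definition cyl_set :: "(nat \<Rightarrow> nat) set \<Rightarrow> (nat list \<Rightarrow> 'a::metric_space) \<Rightarrow> nat list \<Rightarrow> 'a set" where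
  "cyl_set T x I = {xlim x \<omega> | \<omega>. \<omega> \<in> T \<and> pre \<omega> (length I) = I}"

fun phiw :: "(nat \<Rightarrow> 'a \<Rightarrow> 'a) \<Rightarrow> nat list \<Rightarrow> 'a \<Rightarrow> 'a" where
  "phiw \<phi> [] = id"
| "phiw \<phi> (i # I) = \<phi> i \<circ> phiw \<phi> I"

text \<open>Optimal constants kappa^+_{i,J}, kappa^-_{i,J} of (M5) on the set phi_J(K_{G xi}).\<close>
definition lip_ratios :: "('a::metric_space \<Rightarrow> 'a) \<Rightarrow> 'a set \<Rightarrow> real set" where
  "lip_ratios g S = {dist (g x) (g y) / dist x y | x y. x \<in> S \<and> y \<in> S \<and> x \<noteq> y}"

definition kap_plus :: "(nat \<Rightarrow> 'a::metric_space \<Rightarrow> 'a) \<Rightarrow> (nat list \<Rightarrow> real) \<Rightarrow> 'a set \<Rightarrow> real \<Rightarrow> nat \<Rightarrow> nat list \<Rightarrow> real" where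
  "kap_plus \<phi> r K t i J = Sup (lip_ratios (\<phi> i) (phiw \<phi> J ` nbhd K t)) * r J / r (i # J)"

definition kap_minus :: "(nat \<Rightarrow> 'a::metric_space \<Rightarrow> 'a) \<Rightarrow> (nat list \<Rightarrow> real) \<Rightarrow> 'a set \<Rightarrow> real \<Rightarrow> nat \<Rightarrow> nat list \<Rightarrow> real" where
  "kap_minus \<phi> r K t i J = Inf (lip_ratios (\<phi> i) (phiw \<phi> J ` nbhd K t)) * r J / r (i # J)"

definition kap_word :: "(nat \<Rightarrow> nat list \<Rightarrow> real) \<Rightarrow> nat list \<Rightarrow> nat list \<Rightarrow> real" where
  "kap_word k I J = (\<Prod>n<length I. k (I ! n) (drop (Suc n) I @ J))"

definition fpot :: "(nat list \<Rightarrow> real) \<Rightarrow> (nat \<Rightarrow> nat list \<Rightarrow> real) \<Rightarrow> nat list \<Rightarrow> real" where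
  "fpot r k I = (if I = [] then 0 else ln (r (tl I) / (r I * k (hd I) (tl I))))"

definition rho_lim :: "(nat list \<Rightarrow> real) \<Rightarrow> (nat \<Rightarrow> nat) \<Rightarrow> real" where
  "rho_lim r \<omega> = lim (\<lambda>n. r (pre \<omega> (Suc n)) / r (pre (shift \<omega>) n))"

end

theory Submission
  imports Defs
begin

text \<open>Write \<open>n\<^sub>J(t)\<close> for the count of the cylinder \<open>K\<^sub>J\<close> at scale \<open>exp (-t)\<close> and normalise by the
  \<open>s\<close>-conformal measure \<open>\<nu>\<close>: \<open>v\<^sub>J(t) = exp (-st) n\<^sub>J(t) / \<nu>(J)\<close>. Subadditivity makes \<open>v\<^sub>J\<close> at most the
  \<open>\<nu>\<close>-average of the values at the descendants of \<open>J\<close>, and almost similarity identifies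
  \<open>v\<^sub>I\<^sub>J(t)\<close> with \<open>v\<^sub>J\<close> at the time \<open>t\<close> minus the Birkhoff sum of \<open>f\<close> along \<open>I\<close>, with an error that vanishes
  as \<open>J\<close> becomes long, uniformly in \<open>I\<close>. Let \<open>M\<close> be the supremum over \<open>J\<close> of
  \<open>limsup v\<^sub>J\<close>. If \<open>v\<^sub>J(t)\<close> is close to \<open>M\<close>, so are the values at the descendants of \<open>J\<close>; since \<open>f\<close> is non-lattice
  the Birkhoff sums are asymptotically dense, so \<open>v\<^sub>L\<close> is close to \<open>M\<close> on an arbitrarily long window
  for all words \<open>L\<close> of a fixed length. Conversely the count is almost superadditive, because
  (M2) and (T1) force the boundaries of the cylinders to be negligible; hence closeness to \<open>M\<close> on such a
  window persists for all later times, and \<open>v\<close> of the empty word converges to \<open>M\<close>.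

  Density: the increments of Birkhoff sums that can be realised between an arbitrary initial word
  and an arbitrary tail form a closed group \<open>H\<close>. Comparing a fixed infinite past of \<open>\<omega>\<close> with that of a
  base point gives a transfer function showing that \<open>f\<close> is cohomologous to an \<open>H\<close>-valued function;
  so \<open>H\<close> is the whole line if \<open>f\<close> is non-lattice.\<close>

subsection \<open>Words\<close>

text \<open>Convergence is obtained from a maximum principle, without a renewal theorem or transfer
  operators. This is possible because every comparison of the cylinder \<open>I @ J\<close> with
  \<open>J\<close> carries an error that depends on \<open>J\<close> alone: Birkhoff sums have
  bounded distortion and the products of the \<kappa> tend to 1 uniformly in \<open>I\<close>. So
  one tail length serves prefixes of every length, and only finitely many tails have to be treated.
  Density is obtained on two scales: powers of a loop give a coarse scale with bounded steps, and
  increments of size about \<open>e\<close>, switched on one at a time, fill a whole coarse step.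
  Boundaries are negligible because every cylinder contains a subcylinder around its node that
  carries a fixed share of the mass and keeps a distance from the rest; repeating this in what
  remains makes the lost mass decay geometrically, and (C6) makes counts comparable to mass.\<close>

definition wcat :: "nat list \<Rightarrow> (nat \<Rightarrow> nat) \<Rightarrow> nat \<Rightarrow> nat" (infixr "\<frown>" 65) where
  "I \<frown> \<omega> = (\<lambda>k. if k < length I then I ! k else \<omega> (k - length I))"

definition agree :: "nat \<Rightarrow> (nat \<Rightarrow> nat) \<Rightarrow> (nat \<Rightarrow> nat) \<Rightarrow> bool" where
  "agree n \<omega> \<tau> \<longleftrightarrow> (\<forall>k<n. \<omega> k = \<tau> k)"

lemma wcat_Nil [simp]: "[] \<frown> \<omega> = \<omega>"
  by (simp add: wcat_def)

lemma wcat_append [simp]: "(I @ J) \<frown> \<omega> = I \<frown> J \<frown> \<omega>"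
  by (auto simp: wcat_def nth_append fun_eq_iff)

lemma wcat_Cons_append [simp]: "(i # I @ J) \<frown> \<omega> = (i # I) \<frown> J \<frown> \<omega>"
  using wcat_append[of "i # I" J \<omega>] by simp

lemma wcat_Cons_0 [simp]: "((i # I) \<frown> \<omega>) 0 = i"
  by (simp add: wcat_def)

lemma wcat_Cons_Suc [simp]: "((i # I) \<frown> \<omega>) (Suc k) = (I \<frown> \<omega>) k"
  by (simp add: wcat_def)

lemma shift_wcat_Cons [simp]: "shift ((i # I) \<frown> \<omega>) = I \<frown> \<omega>"
  by (simp add: shift_def)

lemma wcat_shift: "[\<omega> 0] \<frown> shift \<omega> = \<omega>"
  by (auto simp: wcat_def shift_def fun_eq_iff)

lemma wcat_0: "I \<noteq> [] \<Longrightarrow> (I \<frown> \<omega>) 0 = hd I"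
  by (cases I) auto

lemma length_pre [simp]: "length (pre \<omega> n) = n"
  by (simp add: pre_def)

lemma pre_0 [simp]: "pre \<omega> 0 = []"
  by (simp add: pre_def)

lemma nth_pre: "k < n \<Longrightarrow> pre \<omega> n ! k = \<omega> k"
  by (simp add: pre_def)

lemma take_pre: "m \<le> n \<Longrightarrow> take m (pre \<omega> n) = pre \<omega> m"
  by (simp add: pre_def take_map)

lemma pre_wcat [simp]: "pre (I \<frown> \<omega>) (length I) = I"
  by (rule nth_equalityI) (auto simp: pre_def wcat_def)

lemma wcat_pre: "pre \<omega> n \<frown> (\<lambda>k. \<omega> (k + n)) = \<omega>"
  by (auto simp: wcat_def fun_eq_iff nth_pre)

lemma pre_Suc: "pre \<omega> (Suc n) = pre \<omega> n @ [\<omega> n]"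
  by (simp add: pre_def)

lemma prefix_pre: "m \<le> n \<Longrightarrow> prefix (pre \<omega> m) (pre \<omega> n)"
  by (metis take_is_prefix take_pre)

lemma pre_agree: "agree n \<omega> \<tau> \<longleftrightarrow> pre \<omega> n = pre \<tau> n"
  by (auto simp: agree_def pre_def)

lemma agree_wcat: "agree (length I) (I \<frown> \<omega>) (I \<frown> \<tau>)"
  by (simp add: agree_def wcat_def)

lemma agree_wcat_add: "agree n \<omega> \<tau> \<Longrightarrow> agree (length I + n) (I \<frown> \<omega>) (I \<frown> \<tau>)"
  by (auto simp: agree_def wcat_def)

lemma agree_mono: "agree n \<omega> \<tau> \<Longrightarrow> m \<le> n \<Longrightarrow> agree m \<omega> \<tau>"
  by (auto simp: agree_def)

text \<open>The Birkhoff sum of \<open>f\<close> over the first \<open>length I\<close> shifts of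
  \<open>I \<frown> \<omega>\<close>, with the infinite tail kept as a parameter.\<close>

fun bsum :: "((nat \<Rightarrow> nat) \<Rightarrow> real) \<Rightarrow> nat list \<Rightarrow> (nat \<Rightarrow> nat) \<Rightarrow> real" where
  "bsum f [] \<omega> = 0"
| "bsum f (i # I) \<omega> = f ((i # I) \<frown> \<omega>) + bsum f I \<omega>"

lemma bsum_append: "bsum f (I @ J) \<omega> = bsum f I (J \<frown> \<omega>) + bsum f J \<omega>"
  by (induction I) auto

fun wpow :: "nat list \<Rightarrow> nat \<Rightarrow> nat list" where
  "wpow U 0 = []"
| "wpow U (Suc n) = U @ wpow U n"

lemma length_wpow: "length (wpow U n) = n * length U"
  by (induction n) auto

lemma wpow_add: "wpow U (m + n) = wpow U m @ wpow U n"
  by (induction m) auto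

subsection \<open>Irreducible subshifts of finite type\<close>

locale irreducible_sft =
  fixes Nl :: nat and A :: "nat \<Rightarrow> nat \<Rightarrow> bool" and T :: "(nat \<Rightarrow> nat) set"
  assumes Nl2: "2 \<le> Nl"
    and irred: "irreducible_mat Nl A"
    and T_eq: "T = sft Nl A"
begin

lemma wcat_Cons_in_T:
  "(i # I) \<frown> \<omega> \<in> T \<longleftrightarrow> i < Nl \<and> A i ((I \<frown> \<omega>) 0) \<and> I \<frown> \<omega> \<in> T"
proof
  assume a: "(i # I) \<frown> \<omega> \<in> T"
  then have *: "\<And>n. ((i # I) \<frown> \<omega>) n < Nl \<and> A (((i # I) \<frown> \<omega>) n) (((i # I) \<frown> \<omega>) (Suc n))"
    by (simp add: T_eq sft_def)
  from *[of 0] have "i < Nl \<and> A i ((I \<frown> \<omega>) 0)" by simp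
  moreover have "I \<frown> \<omega> \<in> T"
    unfolding T_eq sft_def using *[of "Suc n" for n] by simp
  ultimately show "i < Nl \<and> A i ((I \<frown> \<omega>) 0) \<and> I \<frown> \<omega> \<in> T" by simp
next
  assume a: "i < Nl \<and> A i ((I \<frown> \<omega>) 0) \<and> I \<frown> \<omega> \<in> T"
  have "((i # I) \<frown> \<omega>) n < Nl \<and> A (((i # I) \<frown> \<omega>) n) (((i # I) \<frown> \<omega>) (Suc n))" for n
    using a by (cases n) (auto simp: T_eq sft_def)
  then show "(i # I) \<frown> \<omega> \<in> T"
    unfolding T_eq sft_def by blast
qed

lemma wcat_in_T_D: "I \<frown> \<omega> \<in> T \<Longrightarrow> \<omega> \<in> T"
  by (induction I) (auto simp: wcat_Cons_in_T)

lemma shift_in_T: "\<omega> \<in> T \<Longrightarrow> shift \<omega> \<in> T"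
  using wcat_in_T_D[of "[\<omega> 0]" "shift \<omega>"] by (simp add: wcat_shift)

text \<open>Admissibility only involves neighbouring letters, so behind a nonempty overlap
  \<open>Q\<close> any admissible continuation can be exchanged. This one-step memory lies behind
  all later gluing.\<close>

lemma T_glue: "(P @ Q) \<frown> \<omega> \<in> T \<Longrightarrow> Q \<noteq> [] \<Longrightarrow> Q \<frown> \<omega>' \<in> T \<Longrightarrow> (P @ Q) \<frown> \<omega>' \<in> T"
proof (induction P)
  case (Cons p P)
  have "(P \<frown> Q \<frown> \<omega>) 0 = (P \<frown> Q \<frown> \<omega>') 0"
    using Cons.prems(2) by (cases P) (auto simp: wcat_0)
  then show ?case
    using Cons by (simp add: wcat_Cons_in_T)
qed auto

lemma tstar_iff: "I \<in> tstar T \<longleftrightarrow> (\<exists>\<omega>. I \<frown> \<omega> \<in> T)"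
proof
  assume "I \<in> tstar T"
  then obtain \<omega> k where "\<omega> \<in> T" "I = pre \<omega> k" by (auto simp: tstar_def)
  then show "\<exists>\<omega>. I \<frown> \<omega> \<in> T" using wcat_pre by metis
next
  assume "\<exists>\<omega>. I \<frown> \<omega> \<in> T"
  then show "I \<in> tstar T"
    unfolding tstar_def using pre_wcat by (metis (mono_tags, lifting) mem_Collect_eq)
qed

lemma pre_in_tstar: "\<omega> \<in> T \<Longrightarrow> pre \<omega> n \<in> tstar T"
  by (auto simp: tstar_def)

lemma tstar_append_D: "I @ J \<in> tstar T \<Longrightarrow> I \<in> tstar T \<and> J \<in> tstar T"
  by (metis tstar_iff wcat_append wcat_in_T_D)

lemma tstar_prefix: "J \<in> tstar T \<Longrightarrow> prefix I J \<Longrightarrow> I \<in> tstar T"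
  by (auto elim!: prefixE dest: tstar_append_D)

lemma tstar_glue: "P @ Q \<in> tstar T \<Longrightarrow> Q \<noteq> [] \<Longrightarrow> Q @ Y \<in> tstar T \<Longrightarrow> P @ Q @ Y \<in> tstar T"
  unfolding tstar_iff using T_glue by (metis wcat_append)

lemma wcat_glue: "P @ Q \<in> tstar T \<Longrightarrow> Q \<noteq> [] \<Longrightarrow> Q \<frown> \<omega> \<in> T \<Longrightarrow> P \<frown> Q \<frown> \<omega> \<in> T"
  unfolding tstar_iff using T_glue by (metis wcat_append)

lemma tstar_letters: "I \<in> tstar T \<Longrightarrow> set I \<subseteq> {..<Nl}"
proof (induction I)
  case (Cons i I)
  then show ?case by (auto simp: tstar_iff wcat_Cons_in_T)
qed auto

lemma T_letter: "\<omega> \<in> T \<Longrightarrow> \<omega> n < Nl"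
  by (simp add: T_eq sft_def)

lemma finite_tstar_length: "finite {I \<in> tstar T. length I = n}"
  by (rule finite_subset[OF _ finite_lists_length_eq[of "{..<Nl}" n]])
    (use tstar_letters in auto)

lemma finite_tstar_length_le: "finite {I \<in> tstar T. length I \<le> n}"
  by (rule finite_subset[OF _ finite_lists_length_le[of "{..<Nl}" n]])
    (use tstar_letters in auto)

lemma letter_connect:
  assumes "i < Nl" "\<omega> \<in> T"
  shows "\<exists>I. (i # I) \<frown> \<omega> \<in> T"
proof -
  have "\<omega> 0 < Nl" using assms by (simp add: T_letter)
  then obtain m where m: "0 < m" "walk A Nl m i (\<omega> 0)"
    using irred assms unfolding irreducible_mat_def by blast
  then obtain w where w: "length w = Suc m" "w ! 0 = i" "w ! m = \<omega> 0"
    "\<forall>k\<le>m. w ! k < Nl" "\<forall>k<m. A (w ! k) (w ! Suc k)"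
    unfolding walk_def by blast
  \<comment> \<open>The last letter of the walk is the first letter of \<open>\<omega>\<close>, so
    only the first \<open>m\<close> letters are put in front.\<close>
  have val: "(take m w \<frown> \<omega>) k = w ! k" if "k \<le> m" for k
    using that w by (cases "k = m") (auto simp: wcat_def)
  have "(take m w \<frown> \<omega>) n < Nl \<and> A ((take m w \<frown> \<omega>) n) ((take m w \<frown> \<omega>) (Suc n))" for n
  proof (cases "n < m")
    case True
    then show ?thesis using w by (simp add: val)
  next
    case False
    then have "(take m w \<frown> \<omega>) n = \<omega> (n - m)" "(take m w \<frown> \<omega>) (Suc n) = \<omega> (Suc (n - m))"
      using w(1) by (auto simp: wcat_def Suc_diff_le)
    then show ?thesis using assms by (simp add: T_eq sft_def)
  qed
  then have "take m w \<frown> \<omega> \<in> T" by (simp add: T_eq sft_def)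
  moreover obtain v I where "w = v # I" using w(1) by (cases w) auto
  moreover have "v = i" using w(2) calculation by simp
  ultimately have "(i # take (m - 1) I) \<frown> \<omega> \<in> T" using m(1) by (cases m) auto
  then show ?thesis by blast
qed

lemma connect:
  assumes "Q \<in> tstar T" "\<omega> \<in> T"
  shows "\<exists>I. Q \<frown> I \<frown> \<omega> \<in> T"
proof (cases "Q = []")
  case True
  then show ?thesis using assms by (auto intro: exI[of _ "[]"])
next
  case False
  then obtain P i where Q: "Q = P @ [i]" by (metis append_butlast_last_id)
  have "i < Nl" using tstar_letters[OF assms(1)] by (simp add: Q)
  then obtain I where I: "(i # I) \<frown> \<omega> \<in> T" using letter_connect assms(2) by blast
  have "P \<frown> [i] \<frown> I \<frown> \<omega> \<in> T"
    by (rule wcat_glue) (use assms I in \<open>auto simp: Q simp flip: wcat_append\<close>)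
  then show ?thesis by (auto simp: Q)
qed

lemma T_nonempty: "\<exists>\<omega>. \<omega> \<in> T"
proof -
  have ex: "\<exists>j. j < Nl \<and> A i j" if i: "i < Nl" for i
  proof -
    obtain m where "0 < m" "walk A Nl m i i"
      using irred i unfolding irreducible_mat_def by blast
    then obtain w where w: "w ! 0 = i" "\<forall>k\<le>m. w ! k < Nl" "\<forall>k<m. A (w ! k) (w ! Suc k)"
      unfolding walk_def by blast
    then have "w ! Suc 0 < Nl" "A i (w ! Suc 0)"
      using \<open>0 < m\<close> by (auto simp: Suc_leI)
    then show ?thesis by blast
  qed
  then obtain s where s: "\<And>i. i < Nl \<Longrightarrow> s i < Nl \<and> A i (s i)" by metis
  define \<omega> where "\<omega> n = (s ^^ n) 0" for n
  have lt: "\<omega> n < Nl" for n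
    by (induction n) (use s Nl2 in \<open>auto simp: \<omega>_def\<close>)
  have "A (\<omega> n) (\<omega> (Suc n))" for n
    using s[OF lt[of n]] by (simp add: \<omega>_def)
  then have "\<omega> \<in> T" using lt by (simp add: T_eq sft_def)
  then show ?thesis by blast
qed

lemma Nil_in_tstar: "[] \<in> tstar T"
  using T_nonempty by (simp add: tstar_iff)

lemma letter_in_tstar: "i < Nl \<Longrightarrow> [i] \<in> tstar T"
  using letter_connect T_nonempty unfolding tstar_iff
  by (metis append_Cons append_Nil wcat_append)

lemma tstar_connect:
  assumes "Q \<in> tstar T" "P \<in> tstar T"
  shows "\<exists>I. Q @ I @ P \<in> tstar T"
proof -
  obtain \<omega> where \<omega>: "P \<frown> \<omega> \<in> T" using assms tstar_iff by blast
  obtain I where "Q \<frown> I \<frown> P \<frown> \<omega> \<in> T" using connect[OF assms(1) \<omega>] by blast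
  then have "(Q @ I @ P) \<frown> \<omega> \<in> T" by simp
  then show ?thesis unfolding tstar_iff by blast
qed

text \<open>A connecting word from \<open>Q @ P\<close> back to itself closes the loop, where
  \<open>P\<close> makes the overlap nonempty. Admissibility of the square gives that of all
  powers.\<close>

lemma loop_word:
  assumes "Q \<in> tstar T"
  shows "\<exists>U. Q @ U \<noteq> [] \<and> (Q @ U) @ (Q @ U) \<in> tstar T"
proof -
  obtain P where P: "Q @ P \<noteq> []" "Q @ P \<in> tstar T"
  proof (cases "Q = []")
    case True
    then show ?thesis using that[of "[0]"] letter_in_tstar[of 0] Nl2 by auto
  next
    case False
    then show ?thesis using that[of "[]"] assms by auto
  qed
  obtain I where I: "(Q @ P) @ I @ (Q @ P) \<in> tstar T" using tstar_connect[OF P(2) P(2)] by blast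
  have 1: "(Q @ P @ I) @ (Q @ P) \<in> tstar T" using I by simp
  have 2: "(Q @ P) @ I \<in> tstar T" using tstar_append_D[of "(Q @ P) @ I"] I by simp
  have "(Q @ P @ I) @ (Q @ P) @ I \<in> tstar T" using tstar_glue[OF 1 P(1) 2] by simp
  then show ?thesis using P(1) by (intro exI[of _ "P @ I"]) auto
qed

lemma wpow_tstar:
  assumes "U @ U \<in> tstar T" "U \<noteq> []"
  shows "wpow U n \<in> tstar T"
proof (cases n)
  case 0
  then show ?thesis by (simp add: Nil_in_tstar)
next
  case (Suc m)
  have "wpow U (Suc m) \<in> tstar T" for m
  proof (induction m)
    case 0
    then show ?case using tstar_append_D[OF assms(1)] by simp
  next
    case (Suc m)
    then show ?case using tstar_glue[of U U "wpow U m"] assms by simp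
  qed
  then show ?thesis using Suc by simp
qed

lemma wpow_wcat:
  assumes "U @ U \<in> tstar T" "U \<noteq> []" "wpow U (Suc n) \<frown> \<omega> \<in> T"
  shows "wpow U (m + Suc n) \<frown> \<omega> \<in> T"
proof (induction m)
  case (Suc m)
  have "U \<frown> U \<frown> wpow U (m + n) \<frown> \<omega> \<in> T"
    by (rule wcat_glue) (use assms Suc in auto)
  then show ?case by simp
qed (use assms in simp)

end

subsection \<open>Birkhoff sums of Hoelder potentials\<close>

lemma geometric_Cauchy:
  fixes g :: "nat \<Rightarrow> real"
  assumes a: "0 < a" "a < 1" and g: "\<And>m n. \<bar>g (m + n) - g n\<bar> \<le> K * a ^ n"
  shows "\<exists>l. g \<longlonglongrightarrow> l \<and> (\<forall>n. \<bar>l - g n\<bar> \<le> K * a ^ n)"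
proof -
  have lim0: "(\<lambda>n. K * a ^ n) \<longlonglongrightarrow> 0"
    using tendsto_mult_right_zero[OF LIMSEQ_power_zero[of a]] a by simp
  have "Cauchy g"
  proof (rule metric_CauchyI)
    fix e :: real assume "0 < e"
    then obtain n0 where n0: "K * a ^ n0 < e / 2"
      using order_tendstoD(2)[OF lim0, of "e / 2"] by (auto simp: eventually_sequentially)
    have "\<bar>g m - g n0\<bar> < e / 2" if "m \<ge> n0" for m
      using g[of "m - n0" n0] n0 that by simp
    then have "dist (g m) (g n) < e" if "m \<ge> n0" "n \<ge> n0" for m n
      using that by (smt (verit) dist_real_def field_sum_of_halves)
    then show "\<exists>M. \<forall>m\<ge>M. \<forall>n\<ge>M. dist (g m) (g n) < e" by blast
  qed
  then obtain l where l: "g \<longlonglongrightarrow> l" using Cauchy_convergent_iff convergent_def by blast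
  have "\<bar>l - g n\<bar> \<le> K * a ^ n" for n
  proof (rule LIMSEQ_le_const2)
    show "(\<lambda>m. \<bar>g (m + n) - g n\<bar>) \<longlonglongrightarrow> \<bar>l - g n\<bar>"
      by (intro tendsto_intros LIMSEQ_ignore_initial_segment l)
  qed (use g in auto)
  then show ?thesis using l by blast
qed

locale sft_potential = irreducible_sft +
  fixes f :: "(nat \<Rightarrow> nat) \<Rightarrow> real" and M a :: real
  assumes a: "0 < a" "a < 1"
    and holder: "\<And>n \<omega> \<tau>. \<omega> \<in> T \<Longrightarrow> \<tau> \<in> T \<Longrightarrow> agree n \<omega> \<tau> \<Longrightarrow> \<bar>f \<omega> - f \<tau>\<bar> \<le> M * a ^ n"
begin

text \<open>Sum of the geometric series of all Hoelder bounds \<open>M * a ^ k\<close>.\<close>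

definition "Cd = M / (1 - a)"

lemma M_nonneg: "0 \<le> M"
  using T_nonempty holder[of _ _ 0] by (fastforce simp: agree_def)

lemma Cd_nonneg: "0 \<le> Cd"
  using M_nonneg a by (simp add: Cd_def)

text \<open>The terms of the two sums are taken at points that agree on \<open>n\<close> letters
  plus the rest of \<open>I\<close>, so the differences are dominated by a geometric series,
  whatever the length of \<open>I\<close>.\<close>

lemma bsum_distortion:
  assumes "I \<frown> \<omega> \<in> T" "I \<frown> \<tau> \<in> T" "agree n \<omega> \<tau>"
  shows "\<bar>bsum f I \<omega> - bsum f I \<tau>\<bar> \<le> Cd * a ^ n"
proof -
  \<comment> \<open>The partial geometric sum is kept in the induction; the full sum
    \<open>Cd\<close> would leave no room for the next term.\<close>
  have "\<bar>bsum f I \<omega> - bsum f I \<tau>\<bar> \<le> M * a ^ n * ((1 - a ^ length I) / (1 - a))"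
    using assms(1,2)
  proof (induction I)
    case (Cons i I)
    have ag: "agree (length (i # I) + n) ((i # I) \<frown> \<omega>) ((i # I) \<frown> \<tau>)"
      by (rule agree_wcat_add) fact
    have "\<bar>f ((i # I) \<frown> \<omega>) - f ((i # I) \<frown> \<tau>)\<bar> \<le> M * a ^ (length (i # I) + n)"
      by (rule holder[OF Cons.prems ag])
    also have "\<dots> \<le> M * a ^ (length I + n)"
      using a M_nonneg by (intro mult_left_mono power_decreasing) auto
    also have "\<dots> = M * a ^ n * (a ^ length I * (1 - a) / (1 - a))"
      using a by (simp add: power_add)
    finally have "\<bar>f ((i # I) \<frown> \<omega>) - f ((i # I) \<frown> \<tau>)\<bar> \<le> M * a ^ n * (a ^ length I * (1 - a) / (1 - a))" .
    moreover have "\<bar>bsum f I \<omega> - bsum f I \<tau>\<bar> \<le> M * a ^ n * ((1 - a ^ length I) / (1 - a))"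
      using Cons by (simp add: wcat_Cons_in_T)
    ultimately have "\<bar>bsum f (i # I) \<omega> - bsum f (i # I) \<tau>\<bar> \<le>
        M * a ^ n * (a ^ length I * (1 - a) / (1 - a)) + M * a ^ n * ((1 - a ^ length I) / (1 - a))"
      by simp
    also have "\<dots> = M * a ^ n * ((1 - a ^ length (i # I)) / (1 - a))"
    proof -
      have "a ^ length I * (1 - a) / (1 - a) + (1 - a ^ length I) / (1 - a) = (1 - a ^ length (i # I)) / (1 - a)"
        by (subst add_divide_distrib[symmetric]) (simp add: algebra_simps)
      then show ?thesis by (metis distrib_left)
    qed
    finally show ?case .
  qed simp
  also have "\<dots> \<le> M * a ^ n * (1 / (1 - a))"
    using a M_nonneg by (intro mult_left_mono divide_right_mono) auto
  finally show ?thesis by (simp add: Cd_def)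
qed

lemma distortion_small:
  assumes "0 < e" shows "\<exists>n. Cd * a ^ n \<le> e"
proof -
  have "(\<lambda>n. Cd * a ^ n) \<longlonglongrightarrow> 0"
    using tendsto_mult_right_zero[OF LIMSEQ_power_zero[of a]] a by simp
  from order_tendstoD(2)[OF this assms] show ?thesis
    by (auto simp: eventually_sequentially intro: less_imp_le)
qed

lemma distortion_mono: "m \<le> n \<Longrightarrow> Cd * a ^ n \<le> Cd * a ^ m"
  using a Cd_nonneg by (intro mult_left_mono power_decreasing) auto

lemma T_first: "Z \<frown> \<omega> \<in> T \<Longrightarrow> \<tau> \<in> T \<Longrightarrow> \<omega> 0 = \<tau> 0 \<Longrightarrow> Z \<frown> \<tau> \<in> T"
proof (induction Z)
  case (Cons z Z)
  have "(Z \<frown> \<omega>) 0 = (Z \<frown> \<tau>) 0" using Cons.prems by (cases Z) auto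
  then show ?case using Cons by (simp add: wcat_Cons_in_T)
qed simp

text \<open>The group of increments of the Birkhoff sums that can be realised by changing the word between
  an arbitrary initial word and an arbitrary tail.\<close>

definition increments :: "real set" where
  "increments = {d. \<forall>e>0. \<forall>Q\<in>tstar T. \<forall>\<omega>\<in>T. \<exists>I I'. Q \<frown> I \<frown> \<omega> \<in> T \<and> Q \<frown> I' \<frown> \<omega> \<in> T \<and>
      \<bar>bsum f (Q @ I) \<omega> - bsum f (Q @ I') \<omega> - d\<bar> \<le> e}"

lemma incrementsD:
  assumes "d \<in> increments" "0 < e" "Q \<in> tstar T" "\<omega> \<in> T"
  obtains I I' where "Q \<frown> I \<frown> \<omega> \<in> T" "Q \<frown> I' \<frown> \<omega> \<in> T"
    "\<bar>bsum f (Q @ I) \<omega> - bsum f (Q @ I') \<omega> - d\<bar> \<le> e"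
  using assms unfolding increments_def by blast

lemma increments_0: "0 \<in> increments"
  unfolding increments_def using connect by fastforce

lemma increments_uminus:
  assumes d: "d \<in> increments" shows "- d \<in> increments"
  unfolding increments_def
proof (intro CollectI allI impI ballI)
  fix e Q \<omega> assume *: "0 < (e::real)" "Q \<in> tstar T" "\<omega> \<in> T"
  obtain I I' where "Q \<frown> I \<frown> \<omega> \<in> T" "Q \<frown> I' \<frown> \<omega> \<in> T"
    "\<bar>bsum f (Q @ I) \<omega> - bsum f (Q @ I') \<omega> - d\<bar> \<le> e"
    using incrementsD[OF d *] by blast
  then show "\<exists>I I'. Q \<frown> I \<frown> \<omega> \<in> T \<and> Q \<frown> I' \<frown> \<omega> \<in> T \<and>
      \<bar>bsum f (Q @ I) \<omega> - bsum f (Q @ I') \<omega> - - d\<bar> \<le> e"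
    by (intro exI[of _ I'] exI[of _ I]) auto
qed

text \<open>The two changes are made one behind the other, separated by a word \<open>Q'\<close>
  longer than \<open>n\<close>. The change behind \<open>Q'\<close> is felt by the sum in front of
  it only through the distortion \<open>Cd * a ^ n\<close>.\<close>

lemma increments_add:
  assumes d1: "d1 \<in> increments" and d2: "d2 \<in> increments" shows "d1 + d2 \<in> increments"
  unfolding increments_def
proof (intro CollectI allI impI ballI)
  fix e Q \<omega> assume *: "0 < (e::real)" "Q \<in> tstar T" "\<omega> \<in> T"
  obtain n where n: "Cd * a ^ n \<le> e / 3" using distortion_small[of "e / 3"] *(1) by auto
  define Q' where "Q' = pre \<omega> (Suc n)"
  have Q': "Q' \<in> tstar T" "Q' \<noteq> []" "length Q' = Suc n"
    using * pre_in_tstar[of \<omega> "Suc n"] by (auto simp: Q'_def pre_Suc)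
  obtain I2 J2 where 2: "Q' \<frown> I2 \<frown> \<omega> \<in> T" "Q' \<frown> J2 \<frown> \<omega> \<in> T"
    "\<bar>bsum f (Q' @ I2) \<omega> - bsum f (Q' @ J2) \<omega> - d2\<bar> \<le> e / 3"
    using incrementsD[OF d2 _ Q'(1) *(3), of "e / 3"] *(1) by auto
  obtain I1 J1 where 1: "Q \<frown> I1 \<frown> Q' \<frown> I2 \<frown> \<omega> \<in> T" "Q \<frown> J1 \<frown> Q' \<frown> I2 \<frown> \<omega> \<in> T"
    "\<bar>bsum f (Q @ I1) (Q' \<frown> I2 \<frown> \<omega>) - bsum f (Q @ J1) (Q' \<frown> I2 \<frown> \<omega>) - d1\<bar> \<le> e / 3"
    using incrementsD[OF d1 _ *(2) 2(1), of "e / 3"] *(1) by auto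
  have 3: "Q \<frown> J1 \<frown> Q' \<frown> J2 \<frown> \<omega> \<in> T"
    using T_first[of "Q @ J1" "Q' \<frown> I2 \<frown> \<omega>" "Q' \<frown> J2 \<frown> \<omega>"] 1(2) 2(2) Q'(2) by (simp add: wcat_0)
  have "agree (Suc n) (Q' \<frown> I2 \<frown> \<omega>) (Q' \<frown> J2 \<frown> \<omega>)"
    using agree_wcat[of Q'] Q'(3) by simp
  then have "agree n (Q' \<frown> I2 \<frown> \<omega>) (Q' \<frown> J2 \<frown> \<omega>)"
    by (rule agree_mono) simp
  then have "\<bar>bsum f (Q @ J1) (Q' \<frown> I2 \<frown> \<omega>) - bsum f (Q @ J1) (Q' \<frown> J2 \<frown> \<omega>)\<bar> \<le> Cd * a ^ n"
    using 1(2) 3 by (intro bsum_distortion) auto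
  then have "\<bar>bsum f (Q @ I1) (Q' \<frown> I2 \<frown> \<omega>) + bsum f (Q' @ I2) \<omega> -
      (bsum f (Q @ J1) (Q' \<frown> J2 \<frown> \<omega>) + bsum f (Q' @ J2) \<omega>) - (d1 + d2)\<bar> \<le> e"
    using 1(3) 2(3) n by linarith
  then show "\<exists>I I'. Q \<frown> I \<frown> \<omega> \<in> T \<and> Q \<frown> I' \<frown> \<omega> \<in> T \<and>
      \<bar>bsum f (Q @ I) \<omega> - bsum f (Q @ I') \<omega> - (d1 + d2)\<bar> \<le> e"
    using 1 3
    by (intro exI[of _ "I1 @ Q' @ I2"] exI[of _ "J1 @ Q' @ J2"]) (simp add: bsum_append add.assoc)
qed

lemma closed_increments: "closed increments"
  unfolding closed_sequential_limits
proof (intro allI impI)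
  fix X l assume X: "(\<forall>n. X n \<in> increments) \<and> X \<longlonglongrightarrow> l"
  show "l \<in> increments"
    unfolding increments_def
  proof (intro CollectI allI impI ballI)
    fix e Q \<omega> assume *: "0 < (e::real)" "Q \<in> tstar T" "\<omega> \<in> T"
    obtain n where n: "\<bar>X n - l\<bar> < e / 2"
      using X *(1) unfolding lim_sequentially dist_real_def
      by (meson half_gt_zero order_refl)
    obtain I I' where I: "Q \<frown> I \<frown> \<omega> \<in> T" "Q \<frown> I' \<frown> \<omega> \<in> T"
      "\<bar>bsum f (Q @ I) \<omega> - bsum f (Q @ I') \<omega> - X n\<bar> \<le> e / 2"
      using incrementsD[of "X n" "e / 2" Q \<omega>] X * by auto
    have "\<bar>bsum f (Q @ I) \<omega> - bsum f (Q @ I') \<omega> - l\<bar> \<le> e"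
      using n I(3) by linarith
    then show "\<exists>I I'. Q \<frown> I \<frown> \<omega> \<in> T \<and> Q \<frown> I' \<frown> \<omega> \<in> T \<and>
        \<bar>bsum f (Q @ I) \<omega> - bsum f (Q @ I') \<omega> - l\<bar> \<le> e"
      using I by blast
  qed
qed

text \<open>The past is the infinite power of a loop \<open>U\<close>, joined to
  \<open>\<omega>\<close> by a word depending only on its first letter. With \<open>h\<close> the
  limiting sum over this past, \<open>f - (h \<circ> shift - h)\<close> at \<open>\<omega>\<close>
  is the difference between two ways from the past to \<open>shift \<omega>\<close>: through
  \<open>\<omega>\<close>, or directly. Cutting off the past and changing the tail far away alter
  this difference little, so it is an increment.\<close>

lemma lattice_if_increments:
  assumes ne: "increments \<noteq> UNIV" shows "lattice_fun T f"
proof -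
  obtain U where U: "U \<noteq> []" "U @ U \<in> tstar T"
    using loop_word[OF Nil_in_tstar] by auto
  have Ut: "U \<in> tstar T" using tstar_append_D U(2) by blast
  obtain c where c: "\<And>b. b < Nl \<Longrightarrow> U @ c b @ [b] \<in> tstar T"
    using tstar_connect[OF Ut letter_in_tstar] by metis
  have cT: "U \<frown> c (\<omega> 0) \<frown> \<omega> \<in> T" if "\<omega> \<in> T" for \<omega>
    using wcat_glue[of "U @ c (\<omega> 0)" "[\<omega> 0]" "shift \<omega>"] that c[of "\<omega> 0"] T_letter[OF that]
    by (simp add: wcat_shift)
  have cT: "wpow U n \<frown> c (\<omega> 0) \<frown> \<omega> \<in> T" if "\<omega> \<in> T" for \<omega> n
  proof (cases n)
    case (Suc m)
    then show ?thesis using wpow_wcat[OF U(2,1), of 0 "c (\<omega> 0) \<frown> \<omega>" m] cT[OF that] by simp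
  qed (use wcat_in_T_D cT[OF that] in auto)
  have agU: "agree n (wpow U n \<frown> \<omega>) (wpow U n \<frown> \<tau>)" for n \<omega> \<tau>
    by (rule agree_mono[OF agree_wcat]) (use U in \<open>simp add: length_wpow Suc_leI\<close>)
  obtain \<omega>0 where \<omega>0: "\<omega>0 \<in> T" using T_nonempty by blast
  \<comment> \<open>Each sum alone need not converge; subtracting that of the base point
    \<open>\<omega>0\<close> gives convergence, because both pasts consist of the same loop.\<close>
  define g where "g n \<omega> = bsum f (wpow U n @ c (\<omega> 0)) \<omega> - bsum f (wpow U n @ c (\<omega>0 0)) \<omega>0" for n \<omega>
  have g_diff: "\<bar>g (m + n) \<omega> - g n \<omega>\<bar> \<le> Cd * a ^ n" if "\<omega> \<in> T" for m n \<omega>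
  proof -
    have "\<bar>bsum f (wpow U m) (wpow U n \<frown> c (\<omega> 0) \<frown> \<omega>) - bsum f (wpow U m) (wpow U n \<frown> c (\<omega>0 0) \<frown> \<omega>0)\<bar> \<le> Cd * a ^ n"
      using cT[OF that, of "m + n"] cT[OF \<omega>0, of "m + n"]
      by (intro bsum_distortion agU) (auto simp: wpow_add)
    then show ?thesis by (simp add: g_def wpow_add bsum_append)
  qed
  define h where "h \<omega> = (SOME l. (\<lambda>n. g n \<omega>) \<longlonglongrightarrow> l \<and> (\<forall>n. \<bar>l - g n \<omega>\<bar> \<le> Cd * a ^ n))" for \<omega>
  have h: "(\<lambda>n. g n \<omega>) \<longlonglongrightarrow> h \<omega>" "\<bar>h \<omega> - g n \<omega>\<bar> \<le> Cd * a ^ n" if "\<omega> \<in> T" for \<omega> n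
    using someI_ex[OF geometric_Cauchy[OF a, of "\<lambda>n. g n \<omega>" Cd]] g_diff[OF that] unfolding h_def by auto
  have hcont: "word_continuous_on T h"
    unfolding word_continuous_on_def
  proof (intro ballI allI impI)
    fix \<omega> and e :: real assume \<omega>: "\<omega> \<in> T" and e: "0 < e"
    obtain n where n: "Cd * a ^ n \<le> e / 2" using distortion_small[of "e / 2"] e by auto
    \<comment> \<open>\<open>Suc n\<close> forces agreement of the first letter even for
      \<open>n = 0\<close>, so both points have the same connecting word.\<close>
    have "\<bar>h \<tau> - h \<omega>\<bar> < e" if \<tau>: "\<tau> \<in> T" "\<forall>k<Suc n. \<tau> k = \<omega> k" for \<tau>
    proof -
      have eq: "\<tau> 0 = \<omega> 0" using \<tau> by simp
      have ag: "agree n \<tau> \<omega>" using \<tau> by (simp add: agree_def)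
      have "\<bar>g k \<tau> - g k \<omega>\<bar> \<le> Cd * a ^ n" for k
        using bsum_distortion[of "wpow U k @ c (\<omega> 0)", OF _ _ ag] cT[OF \<tau>(1), of k] cT[OF \<omega>, of k] eq
        by (simp add: g_def)
      then have "\<bar>h \<tau> - h \<omega>\<bar> \<le> Cd * a ^ n"
        by (intro LIMSEQ_le_const2[OF tendsto_rabs[OF tendsto_diff[OF h(1)[OF \<tau>(1)] h(1)[OF \<omega>]]]]) auto
      then show ?thesis using n e by simp
    qed
    then show "\<exists>n. \<forall>\<tau>\<in>T. (\<forall>k<n. \<tau> k = \<omega> k) \<longrightarrow> \<bar>h \<tau> - h \<omega>\<bar> < e" by blast
  qed
  define D where "D \<omega> = f \<omega> - (h (shift \<omega>) - h \<omega>)" for \<omega>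
  have D_in: "D \<omega> \<in> increments" if \<omega>: "\<omega> \<in> T" for \<omega>
    unfolding increments_def
  proof (intro CollectI allI impI ballI)
    fix e Q \<omega>2 assume *: "0 < (e::real)" "Q \<in> tstar T" "\<omega>2 \<in> T"
    define b where "b = \<omega> 0"
    define \<omega>' where "\<omega>' = shift \<omega>"
    have \<omega>_eq: "\<omega> = [b] \<frown> \<omega>'" by (simp add: b_def \<omega>'_def wcat_shift)
    have \<omega>': "\<omega>' \<in> T" using shift_in_T[OF \<omega>] by (simp add: \<omega>'_def)
    obtain n where n: "Cd * a ^ n \<le> e / 8" using distortion_small[of "e / 8"] *(1) by auto
    have n': "Cd * a ^ Suc n \<le> e / 8" using distortion_mono[of n "Suc n"] n by linarith
    \<comment> \<open>\<open>Z1\<close> runs through \<open>\<omega>\<close>, \<open>Z2\<close>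
      leads directly to \<open>shift \<omega>\<close>. \<open>Suc n\<close> leaves at least one copy
      of \<open>U\<close> for gluing to \<open>Q @ E\<close>.\<close>
    define Z1 where "Z1 = wpow U (Suc n) @ c b @ [b]"
    define Z2 where "Z2 = wpow U (Suc n) @ c (\<omega>' 0)"
    have "\<bar>D \<omega> - (f \<omega> + g (Suc n) \<omega> - g (Suc n) \<omega>')\<bar> \<le> e / 4"
      using h(2)[OF \<omega>, of "Suc n"] h(2)[OF \<omega>', of "Suc n"] n' unfolding D_def \<omega>'_def[symmetric] by linarith
    moreover have "f \<omega> + g (Suc n) \<omega> - g (Suc n) \<omega>' = bsum f Z1 \<omega>' - bsum f Z2 \<omega>'"
      by (simp add: g_def Z1_def Z2_def bsum_append b_def[symmetric]) (simp add: \<omega>_eq bsum_append)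
    ultimately have D1: "\<bar>D \<omega> - (bsum f Z1 \<omega>' - bsum f Z2 \<omega>')\<bar> \<le> e / 4" by simp
    define Y where "Y = pre \<omega>' (Suc n)"
    obtain d where d: "Y \<frown> d \<frown> \<omega>2 \<in> T"
      using connect[OF _ *(3), of Y] pre_in_tstar[OF \<omega>'] by (auto simp: Y_def)
    \<comment> \<open>The required tail \<open>\<omega>2\<close>, entered only behind
      \<open>n + 1\<close> letters of \<open>\<omega>'\<close>, so that the sums over
      \<open>Z1\<close> and \<open>Z2\<close> hardly change.\<close>
    define \<tau> where "\<tau> = Y \<frown> d \<frown> \<omega>2"
    have \<tau>: "\<tau> \<in> T" using d by (simp add: \<tau>_def)
    have ag: "agree (Suc n) \<omega>' \<tau>"
      by (auto simp: agree_def \<tau>_def Y_def wcat_def nth_pre)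
    have 0: "\<omega>' 0 = \<tau> 0" using ag by (simp add: agree_def)
    have Z1\<omega>: "Z1 \<frown> \<omega>' \<in> T" using cT[OF \<omega>, of "Suc n"] by (simp add: Z1_def b_def[symmetric]) (simp add: \<omega>_eq)
    have Z2\<omega>: "Z2 \<frown> \<omega>' \<in> T" using cT[OF \<omega>', of "Suc n"] by (simp add: Z2_def)
    have Z\<tau>: "Z1 \<frown> \<tau> \<in> T" "Z2 \<frown> \<tau> \<in> T"
      using T_first[OF Z1\<omega> \<tau> 0] T_first[OF Z2\<omega> \<tau> 0] by auto
    obtain E where E: "Q @ E @ U \<in> tstar T" using tstar_connect[OF *(2) Ut] by blast
    have EZ: "Q \<frown> E \<frown> Z \<frown> \<tau> \<in> T" if "Z = wpow U (Suc n) @ V" "Z \<frown> \<tau> \<in> T" for Z V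
      using wcat_glue[of "Q @ E" U "wpow U n \<frown> V \<frown> \<tau>"] E U(1) that by simp
    have EZ1: "Q \<frown> E \<frown> Z1 \<frown> \<tau> \<in> T" and EZ2: "Q \<frown> E \<frown> Z2 \<frown> \<tau> \<in> T"
      using EZ[OF Z1_def] EZ[OF Z2_def] Z\<tau> by auto
    have "agree (Suc n) (Z1 \<frown> \<tau>) (Z2 \<frown> \<tau>)"
      unfolding Z1_def Z2_def wcat_append by (rule agU)
    then have "\<bar>bsum f (Q @ E) (Z1 \<frown> \<tau>) - bsum f (Q @ E) (Z2 \<frown> \<tau>)\<bar> \<le> Cd * a ^ Suc n"
      using EZ1 EZ2 by (intro bsum_distortion) auto
    moreover have "\<bar>bsum f Z1 \<omega>' - bsum f Z1 \<tau>\<bar> \<le> Cd * a ^ Suc n" "\<bar>bsum f Z2 \<omega>' - bsum f Z2 \<tau>\<bar> \<le> Cd * a ^ Suc n"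
      using bsum_distortion[OF _ _ ag] Z1\<omega> Z2\<omega> Z\<tau> by blast+
    ultimately have "\<bar>bsum f (Q @ E) (Z1 \<frown> \<tau>) + bsum f Z1 \<tau> - (bsum f (Q @ E) (Z2 \<frown> \<tau>) + bsum f Z2 \<tau>) - D \<omega>\<bar> \<le> e"
      using D1 n' *(1) by linarith
    then show "\<exists>I I'. Q \<frown> I \<frown> \<omega>2 \<in> T \<and> Q \<frown> I' \<frown> \<omega>2 \<in> T \<and>
        \<bar>bsum f (Q @ I) \<omega>2 - bsum f (Q @ I') \<omega>2 - D \<omega>\<bar> \<le> e"
      using EZ1 EZ2
      by (intro exI[of _ "E @ Z1 @ Y @ d"] exI[of _ "E @ Z2 @ Y @ d"]) (simp add: bsum_append \<tau>_def)
  qed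
  have "proper_closed_subgroup increments"
    unfolding proper_closed_subgroup_def
    using closed_increments ne increments_0 increments_add increments_uminus by blast
  moreover have "cohomologous T f D"
    unfolding cohomologous_def using hcont by (intro exI[of _ h]) (auto simp: D_def)
  ultimately show ?thesis
    unfolding lattice_fun_def using D_in by blast
qed

end

section \<open>Asymptotic density of Birkhoff sums\<close>

context sft_potential
begin

text \<open>A ladder of \<open>n + 1\<close> words whose sums rise by about \<open>e\<close> from
  rung to rung, whatever word \<open>X\<close> stands in front. Each rung uses one realisation of
  the increment \<open>e\<close> up to \<open>e / 4\<close>; the common block \<open>Q\<close>
  limits the effect on the sum over \<open>X\<close> to another \<open>e / 4\<close>.\<close>

lemma toggle_words:
  assumes inc: "increments = UNIV" and e: "0 < e"
    and Q: "Q \<in> tstar T" "Q \<noteq> []" "Cd * a ^ length Q \<le> e / 4" and \<omega>: "\<omega> \<in> T"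
  shows "\<exists>J. (\<forall>i\<le>n. Q \<frown> J i \<frown> \<omega> \<in> T) \<and>
    (\<forall>i<n. \<forall>X. X @ Q \<in> tstar T \<longrightarrow>
      e / 2 \<le> bsum f (X @ Q @ J (Suc i)) \<omega> - bsum f (X @ Q @ J i) \<omega> \<and>
      bsum f (X @ Q @ J (Suc i)) \<omega> - bsum f (X @ Q @ J i) \<omega> \<le> 3 * e / 2)"
proof (induction n)
  case 0
  obtain I where "Q \<frown> I \<frown> \<omega> \<in> T" using connect[OF Q(1) \<omega>] by blast
  then show ?case by (intro exI[of _ "\<lambda>_. I"]) auto
next
  case (Suc n)
  then obtain J where JT: "\<And>i. i \<le> n \<Longrightarrow> Q \<frown> J i \<frown> \<omega> \<in> T"
    and J: "\<And>i X. i < n \<Longrightarrow> X @ Q \<in> tstar T \<Longrightarrow>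
      e / 2 \<le> bsum f (X @ Q @ J (Suc i)) \<omega> - bsum f (X @ Q @ J i) \<omega> \<and>
      bsum f (X @ Q @ J (Suc i)) \<omega> - bsum f (X @ Q @ J i) \<omega> \<le> 3 * e / 2"
    by blast
  obtain I I' where I: "Q \<frown> I \<frown> Q \<frown> J n \<frown> \<omega> \<in> T" "Q \<frown> I' \<frown> Q \<frown> J n \<frown> \<omega> \<in> T"
    "\<bar>bsum f (Q @ I) (Q \<frown> J n \<frown> \<omega>) - bsum f (Q @ I') (Q \<frown> J n \<frown> \<omega>) - e\<bar> \<le> e / 4"
    using incrementsD[of e "e / 4" Q "Q \<frown> J n \<frown> \<omega>"] inc e Q JT by auto
  \<comment> \<open>The new rung arises from the old top by using \<open>I\<close> in place of
    \<open>I'\<close>; the old rungs all receive the block \<open>I' @ Q\<close> and keep the bounds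
    on their differences.\<close>
  define J' where "J' i = (if i \<le> n then I' @ Q @ J i else I @ Q @ J n)" for i
  have memb: "Q \<frown> J' i \<frown> \<omega> \<in> T" for i
  proof (cases "i \<le> n")
    case True
    then show ?thesis
      using T_first[of "Q @ I'" "Q \<frown> J n \<frown> \<omega>" "Q \<frown> J i \<frown> \<omega>"] I(2) JT Q(2)
      by (simp add: J'_def wcat_0)
  qed (use I in \<open>simp add: J'_def\<close>)
  have "e / 2 \<le> bsum f (X @ Q @ J' (Suc i)) \<omega> - bsum f (X @ Q @ J' i) \<omega> \<and>
      bsum f (X @ Q @ J' (Suc i)) \<omega> - bsum f (X @ Q @ J' i) \<omega> \<le> 3 * e / 2"
    if i: "i < Suc n" and X: "X @ Q \<in> tstar T" for i X
  proof (cases "i < n")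
    case True
    have "Q @ I' @ Q \<in> tstar T" using I(2) unfolding tstar_iff by (metis wcat_append)
    then have "(X @ Q @ I') @ Q \<in> tstar T" using tstar_glue[OF X Q(2)] by simp
    from J[OF True this] show ?thesis using True by (simp add: J'_def)
  next
    case False
    then have i: "i = n" using i by simp
    have XI: "X \<frown> Q \<frown> I \<frown> Q \<frown> J n \<frown> \<omega> \<in> T" "X \<frown> Q \<frown> I' \<frown> Q \<frown> J n \<frown> \<omega> \<in> T"
      using wcat_glue[OF X Q(2)] I by blast+
    have "\<bar>bsum f X (Q \<frown> I \<frown> Q \<frown> J n \<frown> \<omega>) - bsum f X (Q \<frown> I' \<frown> Q \<frown> J n \<frown> \<omega>)\<bar> \<le> Cd * a ^ length Q"
      by (intro bsum_distortion XI agree_wcat)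
    then have "\<bar>bsum f X (Q \<frown> I \<frown> Q \<frown> J n \<frown> \<omega>) + bsum f (Q @ I) (Q \<frown> J n \<frown> \<omega>) -
        (bsum f X (Q \<frown> I' \<frown> Q \<frown> J n \<frown> \<omega>) + bsum f (Q @ I') (Q \<frown> J n \<frown> \<omega>)) - e\<bar> \<le> e / 2"
      using I(3) Q(3) by linarith
    moreover have "bsum f (X @ Q @ J' (Suc n)) \<omega> =
        bsum f X (Q \<frown> I \<frown> Q \<frown> J n \<frown> \<omega>) + bsum f (Q @ I) (Q \<frown> J n \<frown> \<omega>) + bsum f (Q @ J n) \<omega>"
      "bsum f (X @ Q @ J' n) \<omega> =
        bsum f X (Q \<frown> I' \<frown> Q \<frown> J n \<frown> \<omega>) + bsum f (Q @ I') (Q \<frown> J n \<frown> \<omega>) + bsum f (Q @ J n) \<omega>"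
      by (simp_all add: J'_def bsum_append)
    ultimately show ?thesis
      unfolding i by linarith
  qed
  then show ?case using memb by (intro exI[of _ J']) blast
qed

lemma bsum_bounded: "\<exists>B::real. \<forall>I \<omega>. I \<frown> \<omega> \<in> T \<longrightarrow> \<bar>bsum f I \<omega>\<bar> \<le> length I * B"
proof -
  obtain \<omega>0 where \<omega>0: "\<omega>0 \<in> T" using T_nonempty by blast
  define B where "B = \<bar>f \<omega>0\<bar> + M"
  have B: "\<bar>f \<omega>\<bar> \<le> B" if "\<omega> \<in> T" for \<omega>
    using holder[OF that \<omega>0, of 0] by (simp add: B_def agree_def)
  have "\<bar>bsum f I \<omega>\<bar> \<le> length I * B" if "I \<frown> \<omega> \<in> T" for I \<omega>
    using that
  proof (induction I)
    case (Cons i I)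
    then show ?case using B[OF Cons.prems] by (simp add: wcat_Cons_in_T algebra_simps)
  qed simp
  then show ?thesis by blast
qed

text \<open>Powers of a loop give a coarse scale that rises by at most \<open>length U * B\<close>
  per turn; a ladder of \<open>n\<close> small steps, each at most \<open>e\<close>, spans such a
  turn. Hence every large \<open>t\<close> is within \<open>e\<close> of some rung.\<close>

lemma bsum_asymptotically_dense:
  fixes c d :: real
  assumes inc: "increments = UNIV"
    and growth: "0 < c" "\<And>I \<omega>. I \<frown> \<omega> \<in> T \<Longrightarrow> c * length I - d \<le> bsum f I \<omega>"
    and e: "0 < e" and Q0: "Q0 \<in> tstar T" and \<omega>: "\<omega> \<in> T"
  shows "\<exists>T0. \<forall>t\<ge>T0. \<exists>I. Q0 \<frown> I \<frown> \<omega> \<in> T \<and> \<bar>bsum f (Q0 @ I) \<omega> - t\<bar> \<le> e"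
proof -
  \<comment> \<open>With \<open>Q0\<close> as initial segment of the loop, every word built from its
    powers starts with \<open>Q0\<close>.\<close>
  obtain V where V: "Q0 @ V \<noteq> []" "(Q0 @ V) @ (Q0 @ V) \<in> tstar T" using loop_word[OF Q0] by blast
  define U where "U = Q0 @ V"
  have U: "U \<noteq> []" "U @ U \<in> tstar T" using V by (auto simp: U_def)
  obtain q where q: "Cd * a ^ q \<le> e / 8" using distortion_small[of "e / 8"] e by auto
  define Q where "Q = wpow U (Suc q)"
  have Q: "Q \<in> tstar T" "Q \<noteq> []" using wpow_tstar U by (auto simp: Q_def simp del: wpow.simps) (simp add: Q_def)
  have "q \<le> length Q" using U(1) unfolding Q_def length_wpow by (cases U) auto
  then have "Cd * a ^ length Q \<le> (e / 2) / 4" using distortion_mono[of q "length Q"] q by linarith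
  note Q = Q this
  obtain B :: real where B: "\<And>I \<omega>. I \<frown> \<omega> \<in> T \<Longrightarrow> \<bar>bsum f I \<omega>\<bar> \<le> length I * B" using bsum_bounded by blast
  \<comment> \<open>Rungs will rise by at least \<open>e / 4\<close>, so \<open>n\<close> of them
    cover one turn of the loop.\<close>
  obtain n :: nat where n: "length U * B / (e / 4) \<le> n" using real_arch_simple by blast
  have n: "length U * B \<le> n * (e / 4)" using n e by (simp add: field_simps)
  obtain J where JT: "\<And>i. i \<le> n \<Longrightarrow> Q \<frown> J i \<frown> \<omega> \<in> T"
    and J: "\<And>i X. i < n \<Longrightarrow> X @ Q \<in> tstar T \<Longrightarrow>
      e / 2 / 2 \<le> bsum f (X @ Q @ J (Suc i)) \<omega> - bsum f (X @ Q @ J i) \<omega> \<and>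
      bsum f (X @ Q @ J (Suc i)) \<omega> - bsum f (X @ Q @ J i) \<omega> \<le> 3 * (e / 2) / 2"
    using toggle_words[OF inc _ Q \<omega>, of n] e by auto
  define b where "b k i = bsum f (wpow U k @ Q @ J i) \<omega>" for k i
  have in_T: "wpow U k \<frown> Q \<frown> J i \<frown> \<omega> \<in> T" if "i \<le> n" for i k
    using wpow_wcat[OF U(2,1), of q "J i \<frown> \<omega>" k] JT[OF that]
    unfolding Q_def wpow_add[of U k "Suc q"] wcat_append by simp
  have XQ: "wpow U k @ Q \<in> tstar T" for k
    using wpow_tstar[OF U(2,1), of "k + Suc q"] by (simp only: Q_def wpow_add)
  have b_Suc: "b (Suc k) i \<le> b k i + n * (e / 4)" if "i \<le> n" for k i
    using B[OF in_T[OF that, of "Suc k", unfolded wpow.simps wcat_append]] n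
    by (simp add: b_def bsum_append)
  have step: "e / 4 \<le> b k (Suc i) - b k i" "b k (Suc i) - b k i \<le> e" if "i < n" for k i
    using J[OF that XQ[of k]] e by (auto simp: b_def)
  have b_n: "b k 0 + i * (e / 4) \<le> b k i" if "i \<le> n" for i k
    using that
  proof (induction i)
    case (Suc i)
    then show ?case using step(1)[of i k] by (simp add: field_simps)
  qed simp
  have unb: "\<exists>k. t < b k 0" for t
  proof -
    obtain k :: nat where k: "(t + d) / c < k" using reals_Archimedean2 by blast
    have "t < c * k - d" using k growth(1) by (simp add: field_simps)
    also have "\<dots> \<le> c * length (wpow U k @ Q @ J 0) - d"
      using growth(1) U(1) by (cases U) (auto simp: length_wpow)
    also have "\<dots> \<le> b k 0"
      unfolding b_def by (rule growth(2)) (use in_T in auto)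
    finally show ?thesis by blast
  qed
  have "\<exists>I. Q0 \<frown> I \<frown> \<omega> \<in> T \<and> \<bar>bsum f (Q0 @ I) \<omega> - t\<bar> \<le> e" if t: "b 0 0 \<le> t" for t
  proof -
    \<comment> \<open>The values \<open>b k 0\<close> are not known to increase with
      \<open>k\<close>; at the first passage above \<open>t\<close> one still has
      \<open>b k 0 \<le> t < b k n\<close> for the preceding \<open>k\<close>.\<close>
    define k' where "k' = (LEAST k. t < b k 0)"
    have k': "t < b k' 0" "\<And>k. k < k' \<Longrightarrow> b k 0 \<le> t"
      unfolding k'_def using LeastI_ex[OF unb[of t]] not_less_Least by (auto simp: not_less[symmetric])
    then have "k' \<noteq> 0" using t by (metis not_less)
    then obtain k where k: "k' = Suc k" by (cases k') auto
    have "b k 0 \<le> t" using k' k by simp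
    moreover have "t < b k n" using k'(1) b_Suc[of 0 k] b_n[of n k] by (simp add: k)
    define i' where "i' = (LEAST i. t < b k i)"
    have i': "t < b k i'" "\<And>i. i < i' \<Longrightarrow> b k i \<le> t" "i' \<le> n"
      unfolding i'_def using LeastI[of "\<lambda>i. t < b k i", OF \<open>t < b k n\<close>] not_less_Least Least_le[of "\<lambda>i. t < b k i", OF \<open>t < b k n\<close>]
      by (auto simp: not_less[symmetric])
    ultimately have "i' \<noteq> 0" by (metis not_less)
    then obtain i where i: "i' = Suc i" by (cases i') auto
    have "\<bar>b k i - t\<bar> \<le> e" using i'(1,3) i'(2)[of i] step(2)[of i k] i by simp
    moreover have "wpow U k @ Q @ J i = Q0 @ V @ wpow U (k + q) @ J i"
      unfolding Q_def using wpow_add[of U k "Suc q"] by (simp add: U_def)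
    moreover have "wpow U k \<frown> Q \<frown> J i \<frown> \<omega> \<in> T" using in_T[of i k] i i' by simp
    ultimately show ?thesis
      unfolding b_def by (metis wcat_append)
  qed
  then show ?thesis by blast
qed

end

subsection \<open>Cesaro means\<close>

definition cesaro :: "(nat \<Rightarrow> real) \<Rightarrow> nat \<Rightarrow> real" where
  "cesaro u n = (\<Sum>m<n. u m) / n"

lemma cesaro_add: "cesaro (\<lambda>m. u m + v m) n = cesaro u n + cesaro v n"
  by (simp add: cesaro_def sum.distrib add_divide_distrib)

lemma cesaro_sum: "cesaro (\<lambda>m. \<Sum>i\<in>S. u i m) n = (\<Sum>i\<in>S. cesaro (u i) n)"
  unfolding cesaro_def by (subst sum.swap) (simp add: sum_divide_distrib)

lemma cesaro_cmult: "cesaro (\<lambda>m. c * u m) n = c * cesaro u n"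
  by (simp add: cesaro_def sum_distrib_left)

lemma cesaro_mono: "(\<And>m. u m \<le> v m) \<Longrightarrow> cesaro u n \<le> cesaro v n"
  by (auto simp: cesaro_def intro!: divide_right_mono sum_mono)

lemma cesaro_bounds: "(\<And>m. 0 \<le> u m) \<Longrightarrow> (\<And>m. u m \<le> b) \<Longrightarrow> 0 \<le> b \<Longrightarrow> 0 \<le> cesaro u n \<and> cesaro u n \<le> b"
  using sum_bounded_above[of "{..<n}" u b]
  by (cases "n = 0") (auto simp: cesaro_def field_simps intro!: sum_nonneg)

lemma cesaro_finite_support:
  assumes "\<And>m. m \<ge> k \<Longrightarrow> u m = 0" shows "cesaro u \<longlonglongrightarrow> 0"
proof (rule Lim_transform_eventually)
  show "(\<lambda>n. (\<Sum>m<k. u m) / real n) \<longlonglongrightarrow> 0"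
    by (rule real_tendsto_divide_at_top[OF tendsto_const filterlim_real_sequentially])
  show "\<forall>\<^sub>F n in sequentially. (\<Sum>m<k. u m) / real n = cesaro u n"
    using eventually_ge_at_top[of k]
  proof eventually_elim
    case (elim n)
    have "(\<Sum>m<k. u m) = (\<Sum>m<n. u m)"
      by (rule sum.mono_neutral_left) (use elim assms in auto)
    then show ?case by (simp add: cesaro_def)
  qed
qed

lemma cesaro_shift:
  assumes b: "\<And>m. 0 \<le> u m" "\<And>m. u m \<le> b"
  shows "(\<lambda>n. cesaro (\<lambda>m. u (m + k)) n - cesaro u n) \<longlonglongrightarrow> 0"
proof (rule Lim_null_comparison)
  show "(\<lambda>n. k * b / real n) \<longlonglongrightarrow> 0"
    by (rule real_tendsto_divide_at_top[OF tendsto_const filterlim_real_sequentially])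
  have "norm (cesaro (\<lambda>m. u (m + k)) n - cesaro u n) \<le> k * b / real n" for n
  proof -
    have split: "(\<Sum>m<i + j. u m) = (\<Sum>m<i. u m) + (\<Sum>m<j. u (i + m))" for i j
      by (induction j) auto
    have "(\<Sum>m<n. u (m + k)) - (\<Sum>m<n. u m) = (\<Sum>m<k. u (n + m)) - (\<Sum>m<k. u m)"
      using split[of n k] split[of k n] by (simp add: add.commute)
    moreover have "0 \<le> (\<Sum>m<k. u (n + m))" "(\<Sum>m<k. u (n + m)) \<le> k * b" "0 \<le> (\<Sum>m<k. u m)" "(\<Sum>m<k. u m) \<le> k * b"
      using b sum_bounded_above[of "{..<k}" _ b] by (auto intro!: sum_nonneg)
    ultimately have "\<bar>(\<Sum>m<n. u (m + k)) - (\<Sum>m<n. u m)\<bar> \<le> k * b" by linarith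
    then show ?thesis
      by (simp add: cesaro_def diff_divide_distrib[symmetric] divide_right_mono)
  qed
  then show "\<forall>\<^sub>F n in sequentially. norm (cesaro (\<lambda>m. u (m + k)) n - cesaro u n) \<le> k * b / real n"
    by simp
qed

subsection \<open>Trees of radii\<close>

locale radius_tree = irreducible_sft +
  fixes r :: "nat list \<Rightarrow> real" and s \<rho> E R :: real
  assumes r_pos: "\<And>I. I \<in> tstar T \<Longrightarrow> 0 < r I"
    and rho_pos: "0 < \<rho>" and E_pos: "0 < E"
    and T3: "\<And>I n \<I>. I \<in> tstar T \<Longrightarrow> \<I> \<subseteq> {J \<in> tstar T. n \<le> length J} \<Longrightarrow>
               (\<forall>\<omega>\<in>T. \<exists>!J. J \<in> \<I> \<and> pre \<omega> (length J) = J) \<Longrightarrow> (\<exists>J\<in>\<I>. prefix I J) \<Longrightarrow>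
               r I powr s / E \<le> (\<Sum>J\<in>{J\<in>\<I>. prefix I J}. r J powr s) \<and>
               (\<Sum>J\<in>{J\<in>\<I>. prefix I J}. r J powr s) \<le> E * r I powr s"
    and T5: "\<And>I j. I @ [j] \<in> tstar T \<Longrightarrow> \<rho> * r I \<le> r (I @ [j])"
    and R: "0 < R" "R < 1"
    and M3: "\<And>I j. I @ [j] \<in> tstar T \<Longrightarrow> r (I @ [j]) \<le> R * r I"
begin

lemma r_lower: "I @ J \<in> tstar T \<Longrightarrow> \<rho> ^ length J * r I \<le> r (I @ J)"
proof (induction J rule: rev_induct)
  case (snoc j J)
  have IJ: "I @ J \<in> tstar T" using snoc.prems tstar_append_D[of "I @ J" "[j]"] by simp
  have "\<rho> * (\<rho> ^ length J * r I) \<le> \<rho> * r (I @ J)"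
    using snoc.IH[OF IJ] rho_pos by (intro mult_left_mono) auto
  also have "\<dots> \<le> r (I @ J @ [j])" using T5[of "I @ J" j] snoc.prems by simp
  finally show ?case by (simp add: algebra_simps)
qed simp

lemma r_upper: "I @ J \<in> tstar T \<Longrightarrow> r (I @ J) \<le> R ^ length J * r I"
proof (induction J rule: rev_induct)
  case (snoc j J)
  have IJ: "I @ J \<in> tstar T" using snoc.prems tstar_append_D[of "I @ J" "[j]"] by simp
  have "r (I @ J @ [j]) \<le> R * r (I @ J)" using M3[of "I @ J" j] snoc.prems by simp
  also have "\<dots> \<le> R * (R ^ length J * r I)"
    using snoc.IH[OF IJ] R by (intro mult_left_mono) auto
  finally show ?case by (simp add: algebra_simps)
qed simp

lemma r_mono: "I @ J \<in> tstar T \<Longrightarrow> r (I @ J) \<le> r I"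
  using r_upper[of I J] r_pos[of I] tstar_append_D[of I J] power_le_one[of R "length J"] R
  by (smt (verit) mult_left_le_one_le zero_le_power)

lemma r_mono_prefix: "J \<in> tstar T \<Longrightarrow> prefix I J \<Longrightarrow> r J \<le> r I"
  using r_mono by (auto elim!: prefixE)

lemma rho_le_R: "\<rho> \<le> R"
proof -
  have "[0] \<in> tstar T" using letter_in_tstar Nl2 by simp
  then have "\<rho> * r [] \<le> R * r []" using T5[of "[]" 0] M3[of "[]" 0] by simp
  then show ?thesis using r_pos[OF Nil_in_tstar] by simp
qed

lemma r_small: "0 < e \<Longrightarrow> \<exists>n0. \<forall>I\<in>tstar T. n0 \<le> length I \<longrightarrow> r I < e"
proof -
  assume e: "0 < e"
  obtain n0 where n0: "R ^ n0 < e / r []"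
    using real_arch_pow_inv[of "e / r []" R] R e r_pos[OF Nil_in_tstar] by auto
  have "r I < e" if "I \<in> tstar T" "n0 \<le> length I" for I
  proof -
    have "r I \<le> R ^ length I * r []" using r_upper[of "[]" I] that by simp
    also have "\<dots> \<le> R ^ n0 * r []"
      using R that r_pos[OF Nil_in_tstar] by (intro mult_right_mono power_decreasing) auto
    also have "\<dots> < e" using n0 r_pos[OF Nil_in_tstar] by (simp add: field_simps)
    finally show ?thesis .
  qed
  then show ?thesis by blast
qed

section \<open>Level sums and the conformal measure\<close>

definition Lev :: "nat \<Rightarrow> nat list \<Rightarrow> nat list set" where
  "Lev n J = {w \<in> tstar T. length w = n \<and> prefix J w}"

lemma finite_Lev [simp]: "finite (Lev n J)"
  using finite_tstar_length[of n] by (rule finite_subset[rotated]) (auto simp: Lev_def)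

lemma tstar_extend: "J \<in> tstar T \<Longrightarrow> length J \<le> n \<Longrightarrow> \<exists>w. w \<in> Lev n J"
proof -
  assume J: "J \<in> tstar T" "length J \<le> n"
  then obtain \<omega> where \<omega>: "J \<frown> \<omega> \<in> T" using tstar_iff by blast
  have "prefix (pre (J \<frown> \<omega>) (length J)) (pre (J \<frown> \<omega>) n)" by (rule prefix_pre) fact
  then have "pre (J \<frown> \<omega>) n \<in> Lev n J" using pre_in_tstar[OF \<omega>] by (simp add: Lev_def)
  then show ?thesis by blast
qed

definition S :: "nat \<Rightarrow> nat list \<Rightarrow> real" where
  "S n J = (\<Sum>w\<in>Lev n J. r w powr s)"

lemma S_nonneg: "0 \<le> S n J"
  unfolding S_def by (intro sum_nonneg) simp

lemma S_eq_0: "n < length J \<or> J \<notin> tstar T \<Longrightarrow> S n J = 0"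
  unfolding S_def Lev_def
  by (intro sum.neutral) (use tstar_prefix in \<open>auto dest: prefix_length_le\<close>)

lemma S_bounds:
  assumes "J \<in> tstar T" "length J \<le> n"
  shows "r J powr s / E \<le> S n J" "S n J \<le> E * r J powr s"
proof -
  obtain w where w: "w \<in> Lev n J" using tstar_extend[OF assms] by blast
  define X where "X = {w \<in> tstar T. length w = n}"
  have Lev: "Lev n J = {w \<in> X. prefix J w}" by (auto simp: Lev_def X_def)
  have 1: "X \<subseteq> {w \<in> tstar T. n \<le> length w}" by (auto simp: X_def)
  have 2: "\<forall>\<omega>\<in>T. \<exists>!w. w \<in> X \<and> pre \<omega> (length w) = w"
    unfolding X_def using pre_in_tstar by (metis (mono_tags, lifting) length_pre mem_Collect_eq)
  have 3: "\<exists>w\<in>X. prefix J w" using w Lev by auto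
  show "r J powr s / E \<le> S n J" "S n J \<le> E * r J powr s"
    unfolding S_def Lev using T3[OF assms(1) 1 2 3] by blast+
qed

lemma S_le: "J \<in> tstar T \<Longrightarrow> S n J \<le> E * r J powr s"
  using S_bounds(2)[of J n] S_eq_0[of n J] E_pos by (cases "length J \<le> n") auto

lemma finite_children: "finite {i. J @ [i] \<in> tstar T}"
  by (rule finite_subset[of _ "{..<Nl}"]) (use tstar_letters in fastforce)+

lemma Lev_children:
  assumes "length J < n"
  shows "Lev n J = (\<Union>i\<in>{i. J @ [i] \<in> tstar T}. Lev n (J @ [i]))"
proof (intro equalityI subsetI)
  fix w assume w: "w \<in> Lev n J"
  then obtain K where K: "w = J @ K" by (auto simp: Lev_def elim: prefixE)
  then obtain i K' where i: "K = i # K'" using w assms by (cases K) (auto simp: Lev_def)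
  have "J @ [i] \<in> tstar T" using w K i tstar_append_D[of "J @ [i]" K'] by (auto simp: Lev_def)
  then show "w \<in> (\<Union>i\<in>{i. J @ [i] \<in> tstar T}. Lev n (J @ [i]))"
    using w K i by (auto simp: Lev_def)
qed (auto simp: Lev_def dest: append_prefixD)

lemma sum_Lev_children:
  "length J < n \<Longrightarrow> (\<Sum>w\<in>Lev n J. g w) = (\<Sum>i\<in>{i. J @ [i] \<in> tstar T}. \<Sum>w\<in>Lev n (J @ [i]). g w)"
proof -
  have "Lev n (J @ [i]) \<inter> Lev n (J @ [j]) = {}" if "i \<noteq> j" for i j
    using that by (auto simp: Lev_def elim!: prefixE)
  then show "length J < n \<Longrightarrow> ?thesis"
    unfolding Lev_children by (intro sum.UNION_disjoint[OF finite_children]) auto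
qed

lemma S_children: "length J < n \<Longrightarrow> S n J = (\<Sum>i\<in>{i. J @ [i] \<in> tstar T}. S n (J @ [i]))"
  unfolding S_def by (rule sum_Lev_children)

text \<open>By one-step memory a nonempty \<open>L\<close> has the same continuations as
  \<open>I @ L\<close>.\<close>

lemma Lev_shift:
  assumes "I @ L \<in> tstar T" "L \<noteq> []"
  shows "Lev (n + length I) (I @ L) = (\<lambda>w. I @ w) ` Lev n L"
proof (intro equalityI subsetI)
  fix v assume v: "v \<in> Lev (n + length I) (I @ L)"
  then obtain Y where Y: "v = I @ L @ Y" by (auto simp: Lev_def elim: prefixE)
  then have "L @ Y \<in> tstar T" using v tstar_append_D[of I "L @ Y"] by (auto simp: Lev_def)
  then show "v \<in> (\<lambda>w. I @ w) ` Lev n L" using v Y by (auto simp: Lev_def)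
next
  fix v assume "v \<in> (\<lambda>w. I @ w) ` Lev n L"
  then obtain Y where "v = I @ L @ Y" "L @ Y \<in> tstar T" "length (L @ Y) = n"
    by (auto simp: Lev_def elim!: prefixE)
  then show "v \<in> Lev (n + length I) (I @ L)"
    using tstar_glue[OF assms, of Y] by (auto simp: Lev_def)
qed

lemma S_shift:
  assumes IL: "I @ L \<in> tstar T" "L \<noteq> []"
  shows "S (n + length I) (I @ L) = (\<Sum>w\<in>Lev n L. r (I @ w) powr s)"
  unfolding S_def Lev_shift[OF IL] by (subst sum.reindex) (auto simp: inj_on_def)

text \<open>Radii tend to 0 while the level sums stay below a fixed bound \<open>B\<close>; for
  negative \<open>s\<close> a single term of a deep level would exceed it. The threshold
  \<open>e\<close> solves \<open>e powr s = B\<close>.\<close>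

lemma s_nonneg: "0 \<le> s"
proof (rule ccontr)
  assume "\<not> 0 \<le> s"
  define B where "B = E * r [] powr s"
  have B: "0 < B" using E_pos r_pos[OF Nil_in_tstar] by (simp add: B_def)
  define e where "e = B powr (1 / s)"
  have e: "0 < e" using B by (simp add: e_def)
  obtain n0 where n0: "\<forall>I\<in>tstar T. n0 \<le> length I \<longrightarrow> r I < e" using r_small[OF e] by blast
  obtain w where w: "w \<in> Lev n0 []" using tstar_extend[OF Nil_in_tstar] by auto
  have "B = e powr s" using \<open>\<not> 0 \<le> s\<close> B by (simp add: e_def powr_powr)
  also have "\<dots> < r w powr s"
    using n0 w \<open>\<not> 0 \<le> s\<close> r_pos by (intro powr_less_mono2_neg) (auto simp: Lev_def)
  also have "\<dots> \<le> S n0 []" unfolding S_def using w by (intro member_le_sum) auto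
  finally show False using S_le[OF Nil_in_tstar, of n0] by (simp add: B_def)
qed

text \<open>The \<open>s\<close>-conformal measure of the tree, given by its values on cylinders: a limit point of the
  Cesaro means of the sums over the levels. The averaging makes the limit invariant under
  the shift of levels, which turns almost similarity of subtrees into the last estimate.\<close>

definition conformal :: "(nat list \<Rightarrow> real) \<Rightarrow> bool" where
  "conformal \<nu> \<longleftrightarrow>
    (\<forall>J\<in>tstar T. r J powr s / E \<le> \<nu> J \<and> \<nu> J \<le> E * r J powr s) \<and>
    (\<forall>J\<in>tstar T. \<nu> J = (\<Sum>i\<in>{i. J @ [i] \<in> tstar T}. \<nu> (J @ [i]))) \<and>
    (\<forall>I L c c'. I @ L \<in> tstar T \<and> L \<noteq> [] \<and> 0 < c \<and>
        (\<forall>w\<in>tstar T. prefix L w \<longrightarrow> c * r w \<le> r (I @ w) \<and> r (I @ w) \<le> c' * r w) \<longrightarrow>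
      c powr s * \<nu> L \<le> \<nu> (I @ L) \<and> \<nu> (I @ L) \<le> c' powr s * \<nu> L)"

lemma conformal_exists: "\<exists>\<nu>. conformal \<nu>"
proof -
  define b where "b J = (if J \<in> tstar T then E * r J powr s else 0)" for J
  have b: "0 \<le> b J" "S n J \<le> b J" for J n
    using E_pos S_le S_eq_0 by (auto simp: b_def)
  define P where "P n J = cesaro (\<lambda>m. S m J) n" for n J
  \<comment> \<open>Tychonoff: the means are bounded at each word, so a single subsequence converges
    at all words at once.\<close>
  have "compactin (product_topology (\<lambda>_. euclidean) UNIV) (PiE UNIV (\<lambda>J. {0..b J}))"
    by (simp add: compactin_PiE)
  then have "compact (PiE UNIV (\<lambda>J. {0..b J}))"
    by (simp add: euclidean_product_topology)
  then have "seq_compact (PiE UNIV (\<lambda>J. {0..b J}))" by (rule compact_imp_seq_compact)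
  moreover have "P n \<in> PiE UNIV (\<lambda>J. {0..b J})" for n
    using cesaro_bounds[OF S_nonneg b(2) b(1)] by (auto simp: P_def)
  moreover have cb: "cesaro (\<lambda>m. S m J) n \<le> b J" for n J
    using cesaro_bounds[of "\<lambda>m. S m J" "b J"] S_nonneg b by blast
  ultimately obtain \<nu> \<phi> where \<phi>: "strict_mono \<phi>" "(P \<circ> \<phi>) \<longlonglongrightarrow> \<nu>"
    unfolding seq_compact_def by (metis (no_types, lifting))
  have lim: "(\<lambda>n. cesaro (\<lambda>m. S m J) (\<phi> n)) \<longlonglongrightarrow> \<nu> J" for J
  proof -
    have "continuous_on UNIV (\<lambda>g :: nat list \<Rightarrow> real. g J)" by (rule continuous_on_product_coordinates)
    then have "isCont (\<lambda>g :: nat list \<Rightarrow> real. g J) \<nu>"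
      using continuous_on_eq_continuous_at[OF open_UNIV] by blast
    from isCont_tendsto_compose[OF this \<phi>(2)] show ?thesis by (simp add: P_def o_def)
  qed
  have sub: "(\<lambda>n. X (\<phi> n)) \<longlonglongrightarrow> l" if "X \<longlonglongrightarrow> l" for X :: "nat \<Rightarrow> real" and l
    using LIMSEQ_subseq_LIMSEQ[OF that \<phi>(1)] by (simp add: o_def)
  have up: "\<nu> J \<le> E * r J powr s" if "J \<in> tstar T" for J
    by (rule LIMSEQ_le_const2[OF lim])
      (use cb[of J] that in \<open>auto simp: b_def\<close>)
  have low: "r J powr s / E \<le> \<nu> J" if J: "J \<in> tstar T" for J
  proof -
    \<comment> \<open>On the levels \<open>m < length J\<close> the sum is 0 and the lower bound
      fails; \<open>u\<close> fills these finitely many gaps and vanishes in the mean.\<close>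
    define u where "u m = (if m < length J then r J powr s / E else 0)" for m
    have "r J powr s / E \<le> cesaro (\<lambda>m. S m J + u m) n" if "n > 0" for n
    proof -
      have "r J powr s / E = cesaro (\<lambda>_. r J powr s / E) n" using that by (simp add: cesaro_def)
      also have "\<dots> \<le> cesaro (\<lambda>m. S m J + u m) n"
        by (rule cesaro_mono) (use S_bounds(1)[OF J] S_nonneg in \<open>auto simp: u_def not_less\<close>)
      finally show ?thesis .
    qed
    moreover have "(\<lambda>n. cesaro (\<lambda>m. S m J + u m) (\<phi> n)) \<longlonglongrightarrow> \<nu> J + 0"
      unfolding cesaro_add
      by (intro tendsto_add lim sub cesaro_finite_support[of "length J"]) (simp add: u_def)
    moreover have "n \<ge> 1 \<Longrightarrow> \<phi> n > 0" for n
      using strict_mono_imp_increasing[OF \<phi>(1), of n] by simp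
    ultimately show ?thesis
      by (intro LIMSEQ_le_const[of _ "\<nu> J"]) (auto intro!: exI[of _ 1])
  qed
  have add: "\<nu> J = (\<Sum>i\<in>{i. J @ [i] \<in> tstar T}. \<nu> (J @ [i]))" for J
  proof -
    let ?C = "{i. J @ [i] \<in> tstar T}"
    \<comment> \<open>Additivity of the level sums holds from level \<open>length J + 1\<close> on;
      the finitely many exceptions vanish in the mean.\<close>
    define u where "u m = S m J + (- 1) * (\<Sum>i\<in>?C. S m (J @ [i]))" for m
    have "cesaro u \<longlonglongrightarrow> 0"
      by (rule cesaro_finite_support[of "Suc (length J)"]) (simp add: u_def S_children)
    then have "(\<lambda>n. cesaro u (\<phi> n)) \<longlonglongrightarrow> 0" by (rule sub)
    moreover have "(\<lambda>n. cesaro u (\<phi> n)) \<longlonglongrightarrow> \<nu> J + (- 1) * (\<Sum>i\<in>?C. \<nu> (J @ [i]))"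
      unfolding u_def cesaro_add cesaro_cmult cesaro_sum by (intro tendsto_intros lim)
    ultimately show ?thesis using LIMSEQ_unique by fastforce
  qed
  have scale: "c powr s * \<nu> L \<le> \<nu> (I @ L) \<and> \<nu> (I @ L) \<le> c' powr s * \<nu> L"
    if IL: "I @ L \<in> tstar T" "L \<noteq> []" "0 < c"
      and c: "\<And>w. w \<in> tstar T \<Longrightarrow> prefix L w \<Longrightarrow> c * r w \<le> r (I @ w) \<and> r (I @ w) \<le> c' * r w" for I L c c'
  proof -
    have L: "L \<in> tstar T" using IL(1) tstar_append_D by blast
    have c': "0 < c'" using c[OF L] IL(3) r_pos[OF L] by (smt (verit) mult_nonpos_nonneg prefix_order.refl zero_less_mult_iff)
    have 1: "c powr s * S m L \<le> S (m + length I) (I @ L)" for m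
      unfolding S_shift[OF IL(1,2)] unfolding S_def sum_distrib_left
    proof (rule sum_mono)
      fix w assume w: "w \<in> Lev m L"
      then have "0 < r w" using r_pos by (auto simp: Lev_def)
      then have "c powr s * r w powr s = (c * r w) powr s" using IL(3) by (simp add: powr_mult)
      also have "\<dots> \<le> r (I @ w) powr s"
        using c[of w] w IL(3) \<open>0 < r w\<close> s_nonneg by (intro powr_mono2) (auto simp: Lev_def)
      finally show "c powr s * r w powr s \<le> r (I @ w) powr s" .
    qed
    have 2: "S (m + length I) (I @ L) \<le> c' powr s * S m L" for m
      unfolding S_shift[OF IL(1,2)] unfolding S_def sum_distrib_left
    proof (rule sum_mono)
      fix w assume w: "w \<in> Lev m L"
      then have "0 < r w" using r_pos by (auto simp: Lev_def)
      have "0 \<le> r (I @ w)" using c[of w] w IL(3) \<open>0 < r w\<close>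
        by (smt (verit) Lev_def mem_Collect_eq mult_pos_pos)
      then have "r (I @ w) powr s \<le> (c' * r w) powr s"
        using c[of w] w s_nonneg by (intro powr_mono2) (auto simp: Lev_def)
      also have "\<dots> = c' powr s * r w powr s" using c' \<open>0 < r w\<close> by (simp add: powr_mult)
      finally show "r (I @ w) powr s \<le> c' powr s * r w powr s" .
    qed
    have "(\<lambda>n. (cesaro (\<lambda>m. S (m + length I) (I @ L)) (\<phi> n) - cesaro (\<lambda>m. S m (I @ L)) (\<phi> n)) +
        cesaro (\<lambda>m. S m (I @ L)) (\<phi> n)) \<longlonglongrightarrow> 0 + \<nu> (I @ L)"
      by (intro tendsto_add lim sub[OF cesaro_shift[OF S_nonneg b(2)]])
    then have sh: "(\<lambda>n. cesaro (\<lambda>m. S (m + length I) (I @ L)) (\<phi> n)) \<longlonglongrightarrow> \<nu> (I @ L)" by simp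
    have "c powr s * \<nu> L \<le> \<nu> (I @ L)"
      by (rule LIMSEQ_le[OF tendsto_mult_left[OF lim] sh])
        (auto simp: cesaro_cmult[symmetric] intro!: cesaro_mono 1)
    moreover have "\<nu> (I @ L) \<le> c' powr s * \<nu> L"
      by (rule LIMSEQ_le[OF sh tendsto_mult_left[OF lim]])
        (auto simp: cesaro_cmult[symmetric] intro!: cesaro_mono 2)
    ultimately show ?thesis by blast
  qed
  have "conformal \<nu>"
    unfolding conformal_def using up low add scale by blast
  then show ?thesis by blast
qed

text \<open>The Moran cut: the words below \<open>J\<close> at which the radius first drops to
  \<open>\<delta>\<close> or less. By (T5) all its radii lie between
  \<open>\<rho> * \<delta>\<close> and \<open>\<delta>\<close>, so its cylinders are of comparable
  size.\<close>

definition cut :: "real \<Rightarrow> nat list \<Rightarrow> nat list set" where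
  "cut \<delta> J = {w \<in> tstar T. prefix J w \<and> w \<noteq> J \<and> r w \<le> \<delta> \<and> \<delta> < r (butlast w)}"

lemma cut_unique:
  assumes v: "v \<in> cut \<delta> J" "w \<in> cut \<delta> J" "prefix v w" shows "v = w"
proof (rule ccontr)
  assume "v \<noteq> w"
  then have "prefix v (butlast w)"
    using v(3) by (metis append_butlast_last_id append_self_conv2 prefix_snoc prefix_bot.extremum_uniqueI)
  moreover have "butlast w \<in> tstar T"
    using v(2) tstar_prefix[OF _ prefixeq_butlast] by (auto simp: cut_def)
  ultimately have "r (butlast w) \<le> r v" by (rule r_mono_prefix[rotated])
  then show False using v by (auto simp: cut_def)
qed

lemma cut_prefix_ex:
  assumes w: "w \<in> tstar T" "prefix J w" "r w \<le> \<delta>" "\<delta> < r J"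
  shows "\<exists>v \<in> cut \<delta> J. prefix v w"
proof -
  obtain Y where Y: "w = J @ Y" using w(2) by (auto elim: prefixE)
  have "\<exists>v \<in> cut \<delta> J. prefix v (J @ Y)" using w(1,3) unfolding Y
  proof (induction Y rule: rev_induct)
    case Nil
    then show ?case using w(4) by simp
  next
    case (snoc y Y)
    show ?case
    proof (cases "r (J @ Y) \<le> \<delta>")
      case True
      have "J @ Y \<in> tstar T" using snoc.prems(1) tstar_append_D[of "J @ Y" "[y]"] by simp
      then obtain v where "v \<in> cut \<delta> J" "prefix v (J @ Y)" using snoc.IH True by blast
      then show ?thesis by (metis append_assoc prefix_prefix)
    next
      case False
      then have "J @ Y @ [y] \<in> cut \<delta> J"
        using snoc.prems by (auto simp: cut_def butlast_append)
      then show ?thesis by blast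
    qed
  qed
  then show ?thesis using Y by simp
qed

lemma cut_props:
  assumes "w \<in> cut \<delta> J"
  shows "w \<in> tstar T" "prefix J w" "r w \<le> \<delta>" "\<rho> * \<delta> \<le> r w"
proof -
  show w: "w \<in> tstar T" "prefix J w" "r w \<le> \<delta>" using assms by (auto simp: cut_def)
  have "w \<noteq> []" using assms by (auto simp: cut_def)
  then have "\<rho> * r (butlast w) \<le> r w"
    using T5[of "butlast w" "last w"] w by simp
  moreover have "\<rho> * \<delta> \<le> \<rho> * r (butlast w)"
    using assms rho_pos by (intro mult_left_mono) (auto simp: cut_def)
  ultimately show "\<rho> * \<delta> \<le> r w" by linarith
qed

lemma cut_length:
  assumes "0 < \<delta>" shows "\<exists>n. \<forall>w \<in> cut \<delta> J. length w \<le> n"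
proof -
  obtain n0 where n0: "\<forall>I\<in>tstar T. n0 \<le> length I \<longrightarrow> r I < \<delta>" using r_small[OF assms] by blast
  have "length w \<le> n0" if w: "w \<in> cut \<delta> J" for w
  proof (rule ccontr)
    assume "\<not> length w \<le> n0"
    moreover have "butlast w \<in> tstar T"
      using w tstar_prefix[OF _ prefixeq_butlast] by (auto simp: cut_def)
    ultimately have "r (butlast w) < \<delta>" using n0 by simp
    then show False using w by (simp add: cut_def)
  qed
  then show ?thesis by blast
qed

lemma finite_cut: "0 < \<delta> \<Longrightarrow> finite (cut \<delta> J)"
  using cut_length[of \<delta> J] finite_subset[OF _ finite_tstar_length_le, of "cut \<delta> J"] cut_props(1)
  by blast

lemma cut_incomparable: "v \<in> cut \<delta> J \<Longrightarrow> w \<in> cut \<delta> J \<Longrightarrow> v \<noteq> w \<Longrightarrow> incomparable v w"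
  unfolding incomparable_def using cut_unique by blast

end

locale conformal_tree = radius_tree +
  fixes \<nu> :: "nat list \<Rightarrow> real"
  assumes conf: "conformal \<nu>"
begin

lemma nu_lower: "J \<in> tstar T \<Longrightarrow> r J powr s / E \<le> \<nu> J"
  and nu_upper: "J \<in> tstar T \<Longrightarrow> \<nu> J \<le> E * r J powr s"
  and nu_children: "J \<in> tstar T \<Longrightarrow> \<nu> J = (\<Sum>i\<in>{i. J @ [i] \<in> tstar T}. \<nu> (J @ [i]))"
  and nu_scale: "I @ L \<in> tstar T \<Longrightarrow> L \<noteq> [] \<Longrightarrow> 0 < c \<Longrightarrow>
        (\<And>w. w\<in>tstar T \<Longrightarrow> prefix L w \<Longrightarrow> c * r w \<le> r (I @ w) \<and> r (I @ w) \<le> c' * r w) \<Longrightarrow>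
      c powr s * \<nu> L \<le> \<nu> (I @ L) \<and> \<nu> (I @ L) \<le> c' powr s * \<nu> L"
  using conf unfolding conformal_def by blast+

lemma nu_pos: "J \<in> tstar T \<Longrightarrow> 0 < \<nu> J"
  using nu_lower[of J] r_pos[of J] E_pos
  by (smt (verit) divide_pos_pos powr_gt_zero)

lemma nu_Lev: "J \<in> tstar T \<Longrightarrow> \<nu> J = (\<Sum>w\<in>Lev (length J + n) J. \<nu> w)"
proof (induction n arbitrary: J)
  case 0
  then have "Lev (length J) J = {J}"
    by (auto simp: Lev_def prefix_def)
  then show ?case by simp
next
  case (Suc n)
  have "\<nu> J = (\<Sum>i\<in>{i. J @ [i] \<in> tstar T}. \<nu> (J @ [i]))" by (rule nu_children) fact
  also have "\<dots> = (\<Sum>i\<in>{i. J @ [i] \<in> tstar T}. \<Sum>w\<in>Lev (length J + Suc n) (J @ [i]). \<nu> w)"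
    by (rule sum.cong) (use Suc.IH in auto)
  also have "\<dots> = (\<Sum>w\<in>Lev (length J + Suc n) J. \<nu> w)"
    by (rule sum_Lev_children[symmetric]) simp
  finally show ?case .
qed

text \<open>Additivity of \<open>\<nu>\<close> is known from level to level, so both sides are
  refined to a level that is deeper than the whole cut and at which every radius is below
  \<open>\<delta>\<close>.\<close>

lemma nu_cut:
  assumes J: "J \<in> tstar T" and \<delta>: "0 < \<delta>" "\<delta> < r J"
  shows "(\<Sum>w\<in>cut \<delta> J. \<nu> w) = \<nu> J"
proof -
  obtain n1 where n1: "\<forall>w \<in> cut \<delta> J. length w \<le> n1" using cut_length[OF \<delta>(1)] by blast
  obtain n2 where n2: "\<forall>I\<in>tstar T. n2 \<le> length I \<longrightarrow> r I < \<delta>" using r_small[OF \<delta>(1)] by blast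
  define n where "n = length J + n1 + n2"
  have "\<nu> J = (\<Sum>w\<in>Lev n J. \<nu> w)" using nu_Lev[OF J, of "n1 + n2"] by (simp add: n_def add.assoc)
  also have "Lev n J = (\<Union>v\<in>cut \<delta> J. Lev n v)"
  proof (intro equalityI subsetI)
    fix w assume w: "w \<in> Lev n J"
    then have "r w \<le> \<delta>" using n2 by (auto simp: Lev_def n_def less_imp_le)
    then obtain v where "v \<in> cut \<delta> J" "prefix v w"
      using cut_prefix_ex[of w J \<delta>] w \<delta> by (auto simp: Lev_def)
    then show "w \<in> (\<Union>v\<in>cut \<delta> J. Lev n v)" using w by (auto simp: Lev_def)
  next
    fix w assume "w \<in> (\<Union>v\<in>cut \<delta> J. Lev n v)"
    then show "w \<in> Lev n J"
      using cut_props(2) by (auto simp: Lev_def intro: prefix_order.trans)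
  qed
  also have "(\<Sum>w\<in>\<dots>. \<nu> w) = (\<Sum>v\<in>cut \<delta> J. \<Sum>w\<in>Lev n v. \<nu> w)"
  proof (rule sum.UNION_disjoint)
    show "\<forall>v\<in>cut \<delta> J. \<forall>w\<in>cut \<delta> J. v \<noteq> w \<longrightarrow> Lev n v \<inter> Lev n w = {}"
      using cut_unique prefix_same_cases by (fastforce simp: Lev_def)
  qed (use finite_cut \<delta> in auto)
  also have "\<dots> = (\<Sum>v\<in>cut \<delta> J. \<nu> v)"
  proof (rule sum.cong)
    fix v assume v: "v \<in> cut \<delta> J"
    then have "length v \<le> n1" using n1 by blast
    then have "n = length v + (n - length v)" by (simp add: n_def)
    then show "(\<Sum>w\<in>Lev n v. \<nu> w) = \<nu> v" using nu_Lev[of v "n - length v"] cut_props(1)[OF v] by simp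
  qed simp
  finally show ?thesis by simp
qed

end

subsection \<open>Trees in a metric space\<close>

lemma open_agree: "open {\<omega> :: nat \<Rightarrow> nat. agree n \<omega> \<tau>}"
proof -
  have "open ((\<lambda>\<omega> :: nat \<Rightarrow> nat. \<omega> k) -` {\<tau> k})" for k
    by (intro open_vimage open_discrete continuous_on_product_coordinates)
  then have "open (\<Inter>k<n. (\<lambda>\<omega> :: nat \<Rightarrow> nat. \<omega> k) -` {\<tau> k})"
    by (intro open_INT) auto
  moreover have "{\<omega> :: nat \<Rightarrow> nat. agree n \<omega> \<tau>} = (\<Inter>k<n. (\<lambda>\<omega>. \<omega> k) -` {\<tau> k})"
    by (auto simp: agree_def)
  ultimately show ?thesis by simp
qed

lemma closed_agree:
  fixes U :: "(nat \<Rightarrow> nat) set"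
  assumes "\<And>\<tau>. \<tau> \<notin> U \<Longrightarrow> \<exists>n. \<forall>\<omega>. agree n \<omega> \<tau> \<longrightarrow> \<omega> \<notin> U"
  shows "closed U"
  unfolding closed_def
proof (subst open_subopen, intro ballI)
  fix \<tau> assume "\<tau> \<in> - U"
  then obtain n where "\<forall>\<omega>. agree n \<omega> \<tau> \<longrightarrow> \<omega> \<notin> U" using assms by blast
  then show "\<exists>V. open V \<and> \<tau> \<in> V \<and> V \<subseteq> - U"
    using open_agree by (intro exI[of _ "{\<omega>. agree n \<omega> \<tau>}"]) (auto simp: agree_def)
qed

lemma sum_UN_le:
  fixes f :: "'b \<Rightarrow> real"
  assumes "finite I" "\<And>i. i \<in> I \<Longrightarrow> finite (A i)" "\<And>i j. i \<in> I \<Longrightarrow> j \<in> A i \<Longrightarrow> 0 \<le> f j"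
  shows "sum f (\<Union>i\<in>I. A i) \<le> (\<Sum>i\<in>I. sum f (A i))"
  using assms
proof (induction I)
  case (insert i I)
  have "0 \<le> sum f (A i \<inter> (\<Union>i\<in>I. A i))" by (intro sum_nonneg) (use insert.prems in auto)
  then have "sum f (A i \<union> (\<Union>i\<in>I. A i)) \<le> sum f (A i) + sum f (\<Union>i\<in>I. A i)"
    using insert sum_Un[of "A i" "\<Union>i\<in>I. A i" f] by simp
  then show ?case using insert by fastforce
qed simp

locale metric_tree = conformal_tree +
  fixes x :: "nat list \<Rightarrow> 'a::complete_space" and C D :: real
  assumes C_pos: "0 < C" and D_pos: "0 < D"
    and T1: "\<And>I J. I \<in> tstar T \<Longrightarrow> J \<in> tstar T \<Longrightarrow> incomparable I J \<Longrightarrow> C * (r I + r J) \<le> dist (x I) (x J)"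
    and T2: "\<And>I J J'. I @ J \<in> tstar T \<Longrightarrow> I @ J' \<in> tstar T \<Longrightarrow> dist (x (I @ J)) (x (I @ J')) \<le> D * r I"
    and M2: "\<And>I. I \<in> tstar T \<Longrightarrow> x I \<in> gen_set T x"
begin

abbreviation K :: "nat list \<Rightarrow> 'a set" where "K \<equiv> cyl_set T x"

lemma gen_set_eq: "gen_set T x = K []"
  by (auto simp: gen_set_def cyl_set_def)

lemma dist_x_pre:
  assumes "\<omega> \<in> T" "n \<le> m" "n \<le> m'"
  shows "dist (x (pre \<omega> m)) (x (pre \<omega> m')) \<le> D * r (pre \<omega> n)"
proof -
  obtain J J' where J: "pre \<omega> m = pre \<omega> n @ J" "pre \<omega> m' = pre \<omega> n @ J'"
    using prefix_pre assms by (metis prefixE)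
  then show ?thesis
    using T2[of "pre \<omega> n" J J'] pre_in_tstar[OF assms(1), of m] pre_in_tstar[OF assms(1), of m'] by simp
qed

lemma Dr_small:
  assumes "0 < e" shows "\<exists>n0. \<forall>I\<in>tstar T. n0 \<le> length I \<longrightarrow> D * r I < e"
proof -
  obtain n0 where "\<forall>I\<in>tstar T. n0 \<le> length I \<longrightarrow> r I < e / D"
    using r_small[of "e / D"] assms D_pos by auto
  then show ?thesis using D_pos by (intro exI[of _ n0]) (auto simp: field_simps)
qed

lemma xlim_tendsto:
  assumes \<omega>: "\<omega> \<in> T" shows "(\<lambda>n. x (pre \<omega> n)) \<longlonglongrightarrow> xlim x \<omega>"
proof -
  have "Cauchy (\<lambda>n. x (pre \<omega> n))"
  proof (rule metric_CauchyI)
    fix e :: real assume "0 < e"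
    then obtain n0 where n0: "\<forall>I\<in>tstar T. n0 \<le> length I \<longrightarrow> D * r I < e" using Dr_small by blast
    have "dist (x (pre \<omega> m)) (x (pre \<omega> n)) < e" if "m \<ge> n0" "n \<ge> n0" for m n
    proof -
      have "dist (x (pre \<omega> m)) (x (pre \<omega> n)) \<le> D * r (pre \<omega> n0)"
        by (rule dist_x_pre[OF \<omega>]) (use that in auto)
      also have "\<dots> < e" using n0 pre_in_tstar[OF \<omega>, of n0] by simp
      finally show ?thesis .
    qed
    then show "\<exists>M. \<forall>m\<ge>M. \<forall>n\<ge>M. dist (x (pre \<omega> m)) (x (pre \<omega> n)) < e" by blast
  qed
  then show ?thesis
    unfolding xlim_def using Cauchy_convergent_iff convergent_LIMSEQ_iff by blast
qed

lemma dist_xlim: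
  assumes "\<omega> \<in> T" "\<tau> \<in> T" "pre \<omega> n = pre \<tau> n"
  shows "dist (xlim x \<omega>) (xlim x \<tau>) \<le> D * r (pre \<omega> n)"
proof (rule LIMSEQ_le_const2[OF tendsto_dist[OF xlim_tendsto xlim_tendsto]])
  have "dist (x (pre \<omega> m)) (x (pre \<tau> m)) \<le> D * r (pre \<omega> n)" if nm: "n \<le> m" for m
  proof -
    obtain J J' where J: "pre \<omega> m = pre \<omega> n @ J" "pre \<tau> m = pre \<omega> n @ J'"
      using prefix_pre[OF nm, of \<omega>] prefix_pre[OF nm, of \<tau>] assms(3) by (metis prefixE)
    then show ?thesis
      using T2[of "pre \<omega> n" J J'] pre_in_tstar[of \<omega> m] pre_in_tstar[of \<tau> m] assms by simp
  qed
  then show "\<exists>N. \<forall>m\<ge>N. dist (x (pre \<omega> m)) (x (pre \<tau> m)) \<le> D * r (pre \<omega> n)" by blast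
qed (use assms in auto)

lemma K_I: "\<omega> \<in> T \<Longrightarrow> pre \<omega> (length I) = I \<Longrightarrow> xlim x \<omega> \<in> K I"
  by (auto simp: cyl_set_def)

lemma K_E:
  assumes "y \<in> K I" obtains \<omega> where "\<omega> \<in> T" "pre \<omega> (length I) = I" "y = xlim x \<omega>"
  using assms by (auto simp: cyl_set_def)

lemma diam_K: "y \<in> K I \<Longrightarrow> z \<in> K I \<Longrightarrow> dist y z \<le> D * r I"
  by (elim K_E) (metis dist_xlim)

lemma K_mono: "prefix I J \<Longrightarrow> K J \<subseteq> K I"
proof
  fix y assume "prefix I J" "y \<in> K J"
  then obtain \<omega> where \<omega>: "\<omega> \<in> T" "pre \<omega> (length J) = J" "y = xlim x \<omega>" by (elim K_E)
  then have "pre \<omega> (length I) = I"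
    using \<open>prefix I J\<close> take_pre[of "length I" "length J" \<omega>] prefix_length_le
    by (fastforce elim!: prefixE)
  then show "y \<in> K I" using \<omega> K_I by blast
qed

lemma K_cover_Lev: "length I \<le> n \<Longrightarrow> K I \<subseteq> (\<Union>w\<in>Lev n I. K w)"
proof
  fix y assume *: "length I \<le> n" "y \<in> K I"
  then obtain \<omega> where \<omega>: "\<omega> \<in> T" "pre \<omega> (length I) = I" "y = xlim x \<omega>" by (elim K_E)
  have "prefix I (pre \<omega> n)" using prefix_pre[OF *(1), of \<omega>] \<omega>(2) by simp
  then have "pre \<omega> n \<in> Lev n I" using pre_in_tstar[OF \<omega>(1)] by (simp add: Lev_def)
  moreover have "y \<in> K (pre \<omega> n)" using \<omega> K_I[of \<omega> "pre \<omega> n"] by simp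
  ultimately show "y \<in> (\<Union>w\<in>Lev n I. K w)" by blast
qed

lemma K_cover_cut:
  assumes \<delta>: "0 < \<delta>" "\<delta> < r I" shows "K I \<subseteq> (\<Union>w\<in>cut \<delta> I. K w)"
proof
  fix y assume "y \<in> K I"
  obtain n0 where n0: "\<forall>I\<in>tstar T. n0 \<le> length I \<longrightarrow> r I < \<delta>" using r_small[OF \<delta>(1)] by blast
  obtain w where w: "w \<in> Lev (length I + n0) I" "y \<in> K w"
    using K_cover_Lev[of I "length I + n0"] \<open>y \<in> K I\<close> by auto
  then have "r w < \<delta>" using n0 by (auto simp: Lev_def)
  then obtain v where "v \<in> cut \<delta> I" "prefix v w"
    using cut_prefix_ex[of w I \<delta>] w(1) \<delta> by (auto simp: Lev_def)
  then show "y \<in> (\<Union>w\<in>cut \<delta> I. K w)" using K_mono w(2) by blast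
qed

text \<open>The addresses form a closed subset of a compact product, and (T2) with vanishing radii
  makes the coding map continuous there.\<close>

lemma compact_K: "compact (K I)"
proof -
  define U where "U = {\<omega> \<in> T. pre \<omega> (length I) = I}"
  have "compactin (product_topology (\<lambda>_. euclidean) UNIV) (PiE UNIV (\<lambda>_::nat. {..<Nl}))"
    by (simp add: compactin_PiE finite_imp_compact)
  then have "compact (PiE UNIV (\<lambda>_::nat. {..<Nl}))"
    by (simp add: euclidean_product_topology)
  moreover have "closed U"
  proof (rule closed_agree)
    fix \<tau> assume "\<tau> \<notin> U"
    then consider "pre \<tau> (length I) \<noteq> I" | n where "\<not> (\<tau> n < Nl \<and> A (\<tau> n) (\<tau> (Suc n)))"
      by (auto simp: U_def T_eq sft_def)
    then show "\<exists>n. \<forall>\<omega>. agree n \<omega> \<tau> \<longrightarrow> \<omega> \<notin> U"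
    proof cases
      case 1
      then show ?thesis by (intro exI[of _ "length I"]) (auto simp: U_def pre_agree)
    next
      case 2
      then show ?thesis
        by (intro exI[of _ "Suc (Suc n)"]) (auto simp: U_def T_eq sft_def agree_def, (metis lessI less_SucI)+)
    qed
  qed
  moreover have "U \<subseteq> PiE UNIV (\<lambda>_::nat. {..<Nl})"
    by (auto simp: U_def T_letter)
  ultimately have "compact U" using compact_Int_closed by (metis inf.absorb_iff2)
  moreover have "continuous_on U (xlim x)"
    unfolding continuous_on_def
  proof (intro ballI tendstoI)
    fix \<omega> and e :: real assume \<omega>: "\<omega> \<in> U" and "0 < e"
    then obtain n0 where n0: "\<forall>I\<in>tstar T. n0 \<le> length I \<longrightarrow> D * r I < e" using Dr_small by blast
    have "dist (xlim x \<tau>) (xlim x \<omega>) < e" if "\<tau> \<in> U" "agree n0 \<tau> \<omega>" for \<tau>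
    proof -
      have "dist (xlim x \<tau>) (xlim x \<omega>) \<le> D * r (pre \<tau> n0)"
        using that \<omega> by (intro dist_xlim) (auto simp: U_def pre_agree)
      also have "\<dots> < e" using n0 that pre_in_tstar[of \<tau> n0] by (auto simp: U_def)
      finally show ?thesis .
    qed
    then show "\<forall>\<^sub>F \<tau> in at \<omega> within U. dist (xlim x \<tau>) (xlim x \<omega>) < e"
      unfolding eventually_at_topological
      by (intro exI[of _ "{\<tau>. agree n0 \<tau> \<omega>}"] conjI open_agree) (auto simp: agree_def)
  qed
  moreover have "K I = xlim x ` U" by (auto simp: cyl_set_def U_def)
  ultimately show ?thesis by (simp add: compact_continuous_image)
qed

lemma node_separated:
  assumes I: "I \<in> tstar T" and \<omega>: "\<omega> \<in> T" "pre \<omega> (length I) \<noteq> I"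
  shows "C * r I \<le> dist (x I) (xlim x \<omega>)"
proof (rule LIMSEQ_le_const[OF tendsto_dist[OF tendsto_const xlim_tendsto[OF \<omega>(1)]]])
  have "C * r I \<le> dist (x I) (x (pre \<omega> n))" if n: "length I \<le> n" for n
  proof -
    have "incomparable I (pre \<omega> n)"
    proof -
      have "\<not> prefix I (pre \<omega> n)"
        using \<omega>(2) take_pre[OF n] by (metis append_eq_conv_conj prefixE)
      moreover have "\<not> prefix (pre \<omega> n) I"
        using calculation n prefix_length_le[of "pre \<omega> n" I] by (auto simp: prefix_def)
      ultimately show ?thesis by (simp add: incomparable_def)
    qed
    then have "C * (r I + r (pre \<omega> n)) \<le> dist (x I) (x (pre \<omega> n))"
      using T1 I pre_in_tstar[OF \<omega>(1)] by blast
    moreover have "C * r I \<le> C * (r I + r (pre \<omega> n))"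
      using C_pos r_pos[OF pre_in_tstar[OF \<omega>(1)], of n] by simp
    ultimately show ?thesis by linarith
  qed
  then show "\<exists>N. \<forall>n\<ge>N. C * r I \<le> dist (x I) (x (pre \<omega> n))" by blast
qed

text \<open>(M2) gives some address of the node; if it left the cylinder,
  \<open>node_separated\<close> would put the node at a positive distance from itself.\<close>

lemma node_in_K: assumes I: "I \<in> tstar T" shows "x I \<in> K I"
proof -
  obtain \<omega> where \<omega>: "\<omega> \<in> T" "x I = xlim x \<omega>" using M2[OF I] by (auto simp: gen_set_def)
  have "0 < C * r I" using C_pos r_pos[OF I] by simp
  then have "pre \<omega> (length I) = I" using node_separated[OF I \<omega>(1)] \<omega>(2) by fastforce
  then show ?thesis using \<omega> K_I by metis
qed

text \<open>Expressed by addresses rather than by \<open>K [] - K I\<close>: for positive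
  \<open>d\<close> a point with a second address outside \<open>I\<close> is excluded too.\<close>

definition far :: "nat list \<Rightarrow> real \<Rightarrow> 'a \<Rightarrow> bool" where
  "far I d y \<longleftrightarrow> (\<forall>\<omega>\<in>T. pre \<omega> (length I) \<noteq> I \<longrightarrow> d \<le> dist y (xlim x \<omega>))"

text \<open>The node \<open>x I\<close> lies in the cylinder \<open>K I\<close> and is far from the rest of the
  generated set, hence so is a subcylinder containing it (a strong open set condition).\<close>

lemma inner_subcylinder:
  "\<exists>m. \<forall>I\<in>tstar T. \<exists>J\<in>Lev (length I + m) I. \<forall>y\<in>K J. far I (C / 2 * r I) y"
proof -
  obtain m where "R ^ m < C / 2 / D" using real_arch_pow_inv[of "C / 2 / D" R] R C_pos D_pos by auto
  then have m: "D * R ^ m \<le> C / 2" using D_pos by (simp add: field_simps)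
  have "\<exists>J\<in>Lev (length I + m) I. \<forall>y\<in>K J. far I (C / 2 * r I) y" if I: "I \<in> tstar T" for I
  proof -
    obtain \<omega> where \<omega>: "\<omega> \<in> T" "pre \<omega> (length I) = I" "x I = xlim x \<omega>"
      using node_in_K[OF I] by (elim K_E)
    define J where "J = pre \<omega> (length I + m)"
    have "prefix I J" using prefix_pre[of "length I" "length I + m" \<omega>] \<omega>(2) by (simp add: J_def)
    then have J: "J \<in> Lev (length I + m) I" using pre_in_tstar[OF \<omega>(1)] by (simp add: Lev_def J_def)
    have xJ: "x I \<in> K J" using \<omega> K_I[of \<omega> J] by (simp add: J_def)
    obtain J' where J': "J = I @ J'" "length J' = m" using J by (auto simp: Lev_def elim: prefixE)
    have "D * r J \<le> D * (R ^ m * r I)"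
      using r_upper[of I J'] J J' D_pos by (intro mult_left_mono) (auto simp: Lev_def)
    also have "\<dots> \<le> C / 2 * r I" using m r_pos[OF I] by (metis mult.assoc mult_right_mono less_imp_le)
    finally have rJ: "D * r J \<le> C / 2 * r I" .
    have "far I (C / 2 * r I) y" if "y \<in> K J" for y
      unfolding far_def
    proof (intro ballI impI)
      fix \<tau> assume "\<tau> \<in> T" "pre \<tau> (length I) \<noteq> I"
      then have "C * r I \<le> dist (x I) (xlim x \<tau>)" using node_separated I by blast
      moreover have "dist (x I) y \<le> C / 2 * r I" using diam_K[OF xJ that] rJ by linarith
      moreover have "dist (x I) (xlim x \<tau>) \<le> dist (x I) y + dist y (xlim x \<tau>)" by (rule dist_triangle)
      ultimately show "C / 2 * r I \<le> dist y (xlim x \<tau>)" by simp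
    qed
    then show ?thesis using J by blast
  qed
  then show ?thesis by blast
qed

lemma far_prefix:
  assumes "far J d y" "prefix I J" "d' \<le> d" shows "far I d' y"
  unfolding far_def
proof (intro ballI impI)
  fix \<omega> assume \<omega>: "\<omega> \<in> T" "pre \<omega> (length I) \<noteq> I"
  then have "pre \<omega> (length J) \<noteq> J"
    using assms(2) take_pre[of "length I" "length J" \<omega>] prefix_length_le[OF assms(2)]
    by (metis append_eq_conv_conj prefixE)
  then show "d' \<le> dist y (xlim x \<omega>)" using assms \<omega>(1) by (auto simp: far_def)
qed

text \<open>\<open>p\<close> limits the depth of the discarded subcylinders in \<open>B\<close>,
  \<open>q\<close> their share of the mass of \<open>I\<close>.\<close>

definition inner_decomp :: "real \<Rightarrow> real \<Rightarrow> nat list \<Rightarrow> 'a set \<Rightarrow> nat list set \<Rightarrow> bool" where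
  "inner_decomp p q I H B \<longleftrightarrow> compact H \<and> H \<subseteq> K I \<and> finite B \<and>
     (\<forall>J\<in>B. J \<in> tstar T \<and> prefix I J \<and> p * r I \<le> r J) \<and> (\<Sum>J\<in>B. \<nu> J) \<le> q * \<nu> I \<and>
     K I \<subseteq> H \<union> (\<Union>J\<in>B. K J) \<and> (\<forall>y\<in>H. far I (C / 2 * (p * r I)) y)"

text \<open>In each discarded cylinder \<open>J\<close> the subcylinder \<open>g J\<close> given by
  \<open>inner_subcylinder\<close> is good and carries at least the share \<open>c\<close> of the
  mass. Moving it to \<open>H\<close> multiplies the discarded mass by at most \<open>1 - c\<close>
  in each round, while the discarded words become \<open>m\<close> letters longer.\<close>

lemma inner_part:
  "\<exists>m q. 0 \<le> q \<and> q < 1 \<and> (\<forall>k. \<forall>I\<in>tstar T. \<exists>H B. inner_decomp (\<rho> ^ (m * k)) (q ^ k) I H B)"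
proof -
  obtain m where m: "\<And>I. I \<in> tstar T \<Longrightarrow> \<exists>J\<in>Lev (length I + m) I. \<forall>y\<in>K J. far I (C / 2 * r I) y"
    using inner_subcylinder by blast
  then obtain g where g: "\<And>I. I \<in> tstar T \<Longrightarrow> g I \<in> Lev (length I + m) I"
    "\<And>I y. I \<in> tstar T \<Longrightarrow> y \<in> K (g I) \<Longrightarrow> far I (C / 2 * r I) y"
    by metis
  \<comment> \<open>The lower bound for \<open>\<nu>\<close> at a word \<open>m\<close> letters
    below \<open>I\<close>, with (T5) for its radius, divided by the upper bound at
    \<open>I\<close>; \<open>min 1\<close> keeps \<open>1 - c\<close> nonnegative.\<close>
  define c where "c = min 1 ((\<rho> ^ m) powr s / (E * E))"
  have c: "0 < c" "c \<le> 1" using rho_pos E_pos by (auto simp: c_def)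
  have low: "\<rho> ^ m * r I \<le> r J" if "I \<in> tstar T" "J \<in> Lev (length I + m) I" for I J
    using r_lower[of I "drop (length I) J"] that by (auto simp: Lev_def prefix_def)
  have nu_g: "c * \<nu> I \<le> \<nu> (g I)" if I: "I \<in> tstar T" for I
  proof -
    have "c * \<nu> I \<le> (\<rho> ^ m) powr s / (E * E) * (E * r I powr s)"
      using nu_upper[OF I] nu_pos[OF I] by (intro mult_mono) (auto simp: c_def)
    also have "\<dots> = (\<rho> ^ m * r I) powr s / E"
      using rho_pos r_pos[OF I] E_pos by (simp add: powr_mult)
    also have "\<dots> \<le> r (g I) powr s / E"
      using low[OF I g(1)[OF I]] s_nonneg rho_pos r_pos[OF I] E_pos
      by (intro divide_right_mono powr_mono2) auto
    also have "\<dots> \<le> \<nu> (g I)" using nu_lower[of "g I"] g(1)[OF I] by (simp add: Lev_def)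
    finally show ?thesis .
  qed
  have "\<exists>H B. inner_decomp (\<rho> ^ (m * k)) ((1 - c) ^ k) I H B"
    if I: "I \<in> tstar T" for k I
  proof (induction k)
    case 0
    have "inner_decomp (\<rho> ^ (m * 0)) ((1 - c) ^ 0) I {} {I}"
      unfolding inner_decomp_def using I by auto
    then show ?case by blast
  next
    case (Suc k)
    then obtain H B where H: "compact H" "H \<subseteq> K I" "finite B"
      "\<And>J. J \<in> B \<Longrightarrow> J \<in> tstar T \<and> prefix I J \<and> \<rho> ^ (m * k) * r I \<le> r J"
      "(\<Sum>J\<in>B. \<nu> J) \<le> (1 - c) ^ k * \<nu> I" "K I \<subseteq> H \<union> (\<Union>J\<in>B. K J)"
      "\<And>y. y \<in> H \<Longrightarrow> far I (C / 2 * (\<rho> ^ (m * k) * r I)) y" by (auto simp: inner_decomp_def)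
    define H' where "H' = H \<union> (\<Union>J\<in>B. K (g J))"
    define B' where "B' = (\<Union>J\<in>B. Lev (length J + m) J - {g J})"
    have pow: "\<rho> ^ (m * Suc k) = \<rho> ^ m * \<rho> ^ (m * k)" by (simp add: power_add)
    have rho1: "\<rho> ^ m \<le> 1" using rho_pos rho_le_R R by (intro power_le_one) auto
    have le: "\<rho> ^ (m * Suc k) * r I \<le> \<rho> ^ (m * k) * r I"
      unfolding pow using rho1 rho_pos r_pos[OF I] by (simp add: mult_le_cancel_right mult_left_le_one_le)
    have "compact H'" unfolding H'_def using H(1,3) by (intro compact_Un compact_UN compact_K) auto
    moreover have "K (g J) \<subseteq> K I" if "J \<in> B" for J
      using g(1)[of J] H(4)[OF that] by (intro K_mono) (auto simp: Lev_def intro: prefix_order.trans)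
    then have "H' \<subseteq> K I" using H(2) by (auto simp: H'_def)
    moreover have "finite B'" using H(3) by (simp add: B'_def)
    moreover have "J' \<in> tstar T \<and> prefix I J' \<and> \<rho> ^ (m * Suc k) * r I \<le> r J'" if "J' \<in> B'" for J'
    proof -
      obtain J where J: "J \<in> B" "J' \<in> Lev (length J + m) J" using \<open>J' \<in> B'\<close> by (auto simp: B'_def)
      have "\<rho> ^ m * (\<rho> ^ (m * k) * r I) \<le> \<rho> ^ m * r J"
        using H(4)[OF J(1)] rho_pos by (intro mult_left_mono) auto
      also have "\<dots> \<le> r J'" using low[of J J'] J H(4) by blast
      finally show ?thesis
        using J H(4)[OF J(1)] unfolding pow by (auto simp: Lev_def mult.assoc intro: prefix_order.trans)
    qed
    moreover have "(\<Sum>J\<in>B'. \<nu> J) \<le> (1 - c) ^ Suc k * \<nu> I"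
    proof -
      have "(\<Sum>J\<in>B'. \<nu> J) \<le> (\<Sum>J\<in>B. \<Sum>J'\<in>Lev (length J + m) J - {g J}. \<nu> J')"
        unfolding B'_def
      proof (rule sum_UN_le)
        fix J J' assume "J' \<in> Lev (length J + m) J - {g J}"
        then show "0 \<le> \<nu> J'" using nu_pos[of J'] by (auto simp: Lev_def)
      qed (use H(3) in auto)
      also have "\<dots> \<le> (\<Sum>J\<in>B. (1 - c) * \<nu> J)"
      proof (rule sum_mono)
        fix J assume "J \<in> B"
        then have J: "J \<in> tstar T" using H(4) by blast
        have "(\<Sum>J'\<in>Lev (length J + m) J - {g J}. \<nu> J') = \<nu> J - \<nu> (g J)"
          using nu_Lev[OF J, of m] g(1)[OF J] by (simp add: sum_diff1)
        then show "(\<Sum>J'\<in>Lev (length J + m) J - {g J}. \<nu> J') \<le> (1 - c) * \<nu> J"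
          using nu_g[OF J] by (simp add: algebra_simps)
      qed
      also have "\<dots> = (1 - c) * (\<Sum>J\<in>B. \<nu> J)" by (simp add: sum_distrib_left)
      also have "\<dots> \<le> (1 - c) * ((1 - c) ^ k * \<nu> I)" using H(5) c by (intro mult_left_mono) auto
      finally show ?thesis by simp
    qed
    moreover have "K I \<subseteq> H' \<union> (\<Union>J\<in>B'. K J)"
    proof
      fix y assume "y \<in> K I"
      then consider "y \<in> H" | J where "J \<in> B" "y \<in> K J" using H(6) by blast
      then show "y \<in> H' \<union> (\<Union>J\<in>B'. K J)"
      proof cases
        case 2
        then obtain J' where "J' \<in> Lev (length J + m) J" "y \<in> K J'"
          using K_cover_Lev[of J "length J + m"] by auto
        then show ?thesis using 2 by (auto simp: H'_def B'_def)
      qed (simp add: H'_def)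
    qed
    moreover have "far I (C / 2 * (\<rho> ^ (m * Suc k) * r I)) y" if yH: "y \<in> H'" for y
    proof -
      have *: "C / 2 * (\<rho> ^ (m * Suc k) * r I) \<le> C / 2 * (\<rho> ^ (m * k) * r I)"
        using le C_pos by (intro mult_left_mono) auto
      consider "y \<in> H" | J where "J \<in> B" "y \<in> K (g J)" using yH by (auto simp: H'_def)
      then show ?thesis
      proof cases
        case 1
        then show ?thesis using far_prefix[OF H(7) prefix_order.refl *] by blast
      next
        case 2
        have "C / 2 * (\<rho> ^ (m * k) * r I) \<le> C / 2 * r J"
          using H(4)[OF 2(1)] C_pos by (intro mult_left_mono) auto
        then show ?thesis using far_prefix[OF g(2)[of J y], of I] 2 H(4)[OF 2(1)] * by auto
      qed
    qed
    ultimately have "inner_decomp (\<rho> ^ (m * Suc k)) ((1 - c) ^ Suc k) I H' B'"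
      unfolding inner_decomp_def by (intro conjI ballI) (assumption | blast)+
    then show ?case by blast
  qed
  then show ?thesis using c by (intro exI[of _ m] exI[of _ "1 - c"]) auto
qed

end

subsection \<open>Counting functions on the tree\<close>

locale counted_tree = metric_tree +
  fixes N :: "real \<Rightarrow> 'a::complete_space set \<Rightarrow> real" and G :: real
  assumes counting: "counting_function N G"
begin

lemmas counting_conds = counting[unfolded counting_function_def]

lemma N_nonneg: "compact X \<Longrightarrow> 0 < eps \<Longrightarrow> 0 \<le> N eps X"
  using conjunct1[OF counting_conds] by blast

lemma N_antimono: "compact X \<Longrightarrow> 0 < \<delta> \<Longrightarrow> \<delta> \<le> eps \<Longrightarrow> N eps X \<le> N \<delta> X"
  using conjunct1[OF conjunct2[OF counting_conds]] by blast

lemma N_mono: "compact H \<Longrightarrow> compact X \<Longrightarrow> H \<subseteq> X \<Longrightarrow> 0 < eps \<Longrightarrow> N eps H \<le> N eps X"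
  using conjunct1[OF conjunct2[OF conjunct2[OF counting_conds]]] by blast

lemma N_C3: "(\<And>i. i < (n::nat) \<Longrightarrow> compact (Ks i)) \<Longrightarrow> 0 < eps \<Longrightarrow> N eps (\<Union>i<n. Ks i) \<le> (\<Sum>i<n. N eps (Ks i))"
  using conjunct1[OF conjunct2[OF conjunct2[OF conjunct2[OF counting_conds]]]] by blast

lemma N_C4: "\<exists>a>0. \<forall>eps X Q. compact X \<and> compact Q \<and> 0 < eps \<and> setdist X Q > a * eps \<longrightarrow>
    N eps (X \<union> Q) = N eps X + N eps Q"
  using conjunct1[OF conjunct2[OF conjunct2[OF conjunct2[OF conjunct2[OF counting_conds]]]]] .

lemma G_nonneg: "0 \<le> G"
  using conjunct1[OF conjunct2[OF conjunct2[OF conjunct2[OF conjunct2[OF conjunct2[OF counting_conds]]]]]] .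

lemma N_C5:
  assumes "0 < \<tau>" "0 < L" "compact X" "L-lipschitz_on (nbhd X (G * \<tau>)) g" "0 < eps" "eps \<le> \<tau>"
  shows "N (L * eps) (g ` X) \<le> N eps X"
  using conjunct1[OF conjunct2[OF conjunct2[OF conjunct2[OF conjunct2[OF conjunct2[OF conjunct2[OF counting_conds]]]]]]]
    assms by blast

lemma N_C6: "\<exists>B>0. \<forall>eps X. compact X \<and> 0 < eps \<longrightarrow>
    sep_number (B * eps) X / B \<le> N eps X \<and> N eps X \<le> B * sep_number (eps / B) X"
  using conjunct2[OF conjunct2[OF conjunct2[OF conjunct2[OF conjunct2[OF conjunct2[OF conjunct2[OF counting_conds]]]]]]] .

lemma N_UN:
  assumes "finite Z" "\<And>i. i \<in> Z \<Longrightarrow> compact (Ks i)" "0 < eps"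
  shows "N eps (\<Union>i\<in>Z. Ks i) \<le> (\<Sum>i\<in>Z. N eps (Ks i))"
proof -
  obtain h where h: "bij_betw h {..<card Z} Z"
    using ex_bij_betw_nat_finite[OF assms(1)] by (auto simp: atLeast0LessThan)
  have "N eps (\<Union>i<card Z. Ks (h i)) \<le> (\<Sum>i<card Z. N eps (Ks (h i)))"
    by (rule N_C3) (use h assms in \<open>auto simp: bij_betw_def\<close>)
  moreover have "(\<Union>i<card Z. Ks (h i)) = (\<Union>i\<in>Z. Ks i)"
    using image_image[of Ks h "{..<card Z}"] bij_betw_imp_surj_on[OF h] by simp
  moreover have "(\<Sum>i<card Z. N eps (Ks (h i))) = (\<Sum>i\<in>Z. N eps (Ks i))"
    by (rule sum.reindex_bij_betw[OF h])
  ultimately show ?thesis by simp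
qed

lemma N_empty: "0 < eps \<Longrightarrow> N eps {} = 0"
  using N_UN[of "{}" "\<lambda>_. {}" eps] N_nonneg[of "{}" eps] by simp

lemma N_Un: "compact X \<Longrightarrow> compact Y \<Longrightarrow> 0 < eps \<Longrightarrow> N eps (X \<union> Y) \<le> N eps X + N eps Y"
  using N_UN[of "{True, False}" "\<lambda>b. if b then X else Y" eps] by (auto simp: Un_commute)

section \<open>Comparison of counts with the conformal measure\<close>

definition separated :: "real \<Rightarrow> 'a set \<Rightarrow> bool" where
  "separated \<delta> F \<longleftrightarrow> (\<forall>y\<in>F. \<forall>z\<in>F. y \<noteq> z \<longrightarrow> \<delta> < dist y z)"

text \<open>The cylinders of the cut have diameter at most \<open>D * \<delta> \<le> d\<close>, so
  each contains at most one point of \<open>F\<close>.\<close>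

lemma card_separated:
  assumes \<delta>: "0 < \<delta>" "\<delta> < r I" "D * \<delta> \<le> d" and F: "F \<subseteq> K I" "separated d F"
  shows "card F \<le> card (cut \<delta> I)"
proof -
  have "\<forall>y\<in>F. \<exists>w\<in>cut \<delta> I. y \<in> K w" using F(1) K_cover_cut[OF \<delta>(1,2)] by blast
  then obtain w where w: "\<And>y. y \<in> F \<Longrightarrow> w y \<in> cut \<delta> I \<and> y \<in> K (w y)" by metis
  have "inj_on w F"
  proof (rule inj_onI, rule ccontr)
    fix y z assume yz: "y \<in> F" "z \<in> F" "w y = w z" "y \<noteq> z"
    have "dist y z \<le> D * r (w y)" by (rule diam_K) (use w yz in metis)+
    also have "\<dots> \<le> D * \<delta>" using cut_props(3) w[OF yz(1)] D_pos by (intro mult_left_mono) auto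
    finally show False using F(2) \<delta>(3) yz by (fastforce simp: separated_def)
  qed
  then show ?thesis using w finite_cut[OF \<delta>(1)] by (intro card_inj_on_le) auto
qed

lemma sep_number_le:
  assumes \<delta>: "0 < \<delta>" "\<delta> < r I" "D * \<delta> \<le> d"
  shows "sep_number d (K I) \<le> card (cut \<delta> I)"
  unfolding sep_number_def
proof (rule cSup_least)
  show "{real (card F) |F. finite F \<and> F \<subseteq> K I \<and> (\<forall>x\<in>F. \<forall>y\<in>F. x \<noteq> y \<longrightarrow> d < dist x y)} \<noteq> {}"
    by auto
qed (use card_separated[OF \<delta>] in \<open>auto simp: separated_def\<close>)

lemma sep_number_ge:
  assumes I: "I \<in> tstar T" and d: "0 < d" and F: "finite F" "F \<subseteq> K I" "separated d F"
  shows "card F \<le> sep_number d (K I)"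
  unfolding sep_number_def
proof (rule cSup_upper)
  \<comment> \<open>\<open>Sup\<close> is meaningful only for a bounded set; a sufficiently fine cut
    provides the bound.\<close>
  define \<delta> where "\<delta> = min (d / D) (r I / 2)"
  have \<delta>: "0 < \<delta>" "\<delta> < r I" "D * \<delta> \<le> d"
    using d D_pos r_pos[OF I] by (auto simp: \<delta>_def min_def field_simps)
  show "bdd_above {real (card F) |F. finite F \<and> F \<subseteq> K I \<and> (\<forall>x\<in>F. \<forall>y\<in>F. x \<noteq> y \<longrightarrow> d < dist x y)}"
    by (rule bdd_aboveI[of _ "real (card (cut \<delta> I))"]) (use card_separated[OF \<delta>] in \<open>auto simp: separated_def\<close>)
qed (use F in \<open>auto simp: separated_def\<close>)

text \<open>Radii on the cut are at least \<open>\<rho> * \<delta>\<close>, so every cell has at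
  least the mass \<open>(\<rho> * \<delta>) powr s / E\<close>, while the masses add up to
  \<open>\<nu> I\<close>.\<close>

lemma card_cut_upper:
  assumes I: "I \<in> tstar T" and \<delta>: "0 < \<delta>" "\<delta> < r I"
  shows "card (cut \<delta> I) \<le> E * (\<rho> * \<delta>) powr (- s) * \<nu> I"
proof -
  have pos: "0 < (\<rho> * \<delta>) powr s / E" using rho_pos \<delta> E_pos by simp
  have "card (cut \<delta> I) * ((\<rho> * \<delta>) powr s / E) = (\<Sum>w\<in>cut \<delta> I. (\<rho> * \<delta>) powr s / E)" by simp
  also have "\<dots> \<le> (\<Sum>w\<in>cut \<delta> I. \<nu> w)"
  proof (rule sum_mono)
    fix w assume w: "w \<in> cut \<delta> I"
    have "(\<rho> * \<delta>) powr s / E \<le> r w powr s / E"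
      using cut_props[OF w] rho_pos \<delta> E_pos s_nonneg by (intro divide_right_mono powr_mono2) auto
    then show "(\<rho> * \<delta>) powr s / E \<le> \<nu> w" using nu_lower[OF cut_props(1)[OF w]] by simp
  qed
  also have "\<dots> = \<nu> I" by (rule nu_cut[OF I \<delta>])
  finally have "card (cut \<delta> I) \<le> \<nu> I / ((\<rho> * \<delta>) powr s / E)" by (subst pos_le_divide_eq[OF pos])
  also have "\<dots> = E * (\<rho> * \<delta>) powr (- s) * \<nu> I" by (simp add: powr_minus field_simps)
  finally show ?thesis .
qed

lemma card_cut_lower:
  assumes I: "I \<in> tstar T" and \<delta>: "0 < \<delta>" "\<delta> < r I"
  shows "\<delta> powr (- s) * \<nu> I / E \<le> card (cut \<delta> I)"
proof -
  have "\<nu> I = (\<Sum>w\<in>cut \<delta> I. \<nu> w)" by (rule nu_cut[OF I \<delta>, symmetric])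
  also have "\<dots> \<le> (\<Sum>w\<in>cut \<delta> I. E * \<delta> powr s)"
  proof (rule sum_mono)
    fix w assume w: "w \<in> cut \<delta> I"
    have "E * r w powr s \<le> E * \<delta> powr s"
      using cut_props[OF w] r_pos[of w] E_pos s_nonneg by (intro mult_left_mono powr_mono2) auto
    then show "\<nu> w \<le> E * \<delta> powr s" using nu_upper[OF cut_props(1)[OF w]] by simp
  qed
  finally have "\<nu> I \<le> card (cut \<delta> I) * (E * \<delta> powr s)" by simp
  then show ?thesis using E_pos \<delta> by (simp add: powr_minus field_simps)
qed

lemma N_upper: "\<exists>c>0. \<forall>I\<in>tstar T. \<forall>eps. 0 < eps \<and> eps \<le> r I \<longrightarrow> N eps (K I) \<le> c * eps powr (- s) * \<nu> I"
proof -
  obtain B where B: "0 < B" "\<And>eps X. compact X \<Longrightarrow> 0 < eps \<Longrightarrow> N eps X \<le> B * sep_number (eps / B) X"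
    using N_C6 by blast
  \<comment> \<open>Cells of radius at most \<open>eps * k\<close> have diameter at most
    \<open>eps / B\<close>, the separation in (C6); the bound \<open>1 / 2\<close> keeps
    \<open>eps * k\<close> below \<open>r I\<close>.\<close>
  define k where "k = min (1 / (B * D)) (1 / 2)"
  have k: "0 < k" "k < 1" "D * k \<le> 1 / B"
    using B D_pos by (auto simp: k_def min_def field_simps)
  have "N eps (K I) \<le> (B * E * (\<rho> * k) powr (- s)) * eps powr (- s) * \<nu> I"
    if I: "I \<in> tstar T" and eps: "0 < eps" "eps \<le> r I" for I eps
  proof -
    have "eps * k < eps" using k eps by simp
    then have \<delta>: "0 < eps * k" "eps * k < r I" "D * (eps * k) \<le> eps / B"
      using eps mult_pos_pos[OF eps(1) k(1)] mult_left_mono[OF k(3), of eps] by (linarith, linarith, simp add: mult.left_commute)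
    have "N eps (K I) \<le> B * sep_number (eps / B) (K I)" using B eps compact_K by blast
    also have "\<dots> \<le> B * (E * (\<rho> * (eps * k)) powr (- s) * \<nu> I)"
      using sep_number_le[OF \<delta>] card_cut_upper[OF I \<delta>(1,2)] B(1) by (intro mult_left_mono) auto
    also have "(\<rho> * (eps * k)) powr (- s) = (\<rho> * k) powr (- s) * eps powr (- s)"
      using rho_pos k eps by (simp add: powr_mult algebra_simps)
    finally show ?thesis by (simp add: algebra_simps)
  qed
  moreover have "0 < B * E * (\<rho> * k) powr (- s)" using B E_pos rho_pos k by simp
  ultimately show ?thesis by blast
qed

text \<open>The nodes of a cut at radius \<delta> lie in \<open>K I\<close> and are at least
  \<open>2 * C * \<rho> * \<delta>\<close> apart by (T1), so they are separated points for
  (C6).\<close>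

lemma N_lower:
  "\<exists>c>0. \<exists>q>0. \<forall>I\<in>tstar T. \<forall>eps. 0 < eps \<and> eps \<le> q * r I \<longrightarrow> c * eps powr (- s) * \<nu> I \<le> N eps (K I)"
proof -
  obtain B where B: "0 < B" "\<And>eps X. compact X \<Longrightarrow> 0 < eps \<Longrightarrow> sep_number (B * eps) X / B \<le> N eps X"
    using N_C6 by blast
  \<comment> \<open>Makes \<open>C * \<rho> * (k * eps)\<close> equal to \<open>B * eps\<close>, so
    that the nodes are at least \<open>2 * B * eps\<close> apart.\<close>
  define k where "k = B / (C * \<rho>)"
  have k: "0 < k" using B C_pos rho_pos by (simp add: k_def)
  have "k powr (- s) / (E * B) * eps powr (- s) * \<nu> I \<le> N eps (K I)"
    if I: "I \<in> tstar T" and eps: "0 < eps" "eps \<le> 1 / (2 * k) * r I" for I eps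
  proof -
    have "k * eps \<le> r I / 2" using mult_left_mono[OF eps(2), of k] k by simp
    then have \<delta>: "0 < k * eps" "k * eps < r I" using k eps r_pos[OF I] by auto
    let ?F = "x ` cut (k * eps) I"
    have sep: "B * eps < dist (x v) (x w)" if "v \<in> cut (k * eps) I" "w \<in> cut (k * eps) I" "v \<noteq> w" for v w
    proof -
      have "B * eps < C * (\<rho> * (k * eps) + \<rho> * (k * eps))"
        using B eps C_pos rho_pos by (simp add: k_def field_simps)
      also have "\<dots> \<le> C * (r v + r w)"
        using cut_props(4)[OF that(1)] cut_props(4)[OF that(2)] C_pos by (intro mult_left_mono add_mono) auto
      also have "\<dots> \<le> dist (x v) (x w)"
        by (rule T1[OF _ _ cut_incomparable[OF that]]) (use that cut_props in auto)
      finally show ?thesis .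
    qed
    have "0 < B * eps" using B eps by simp
    then have inj: "inj_on x (cut (k * eps) I)"
      using sep by (intro inj_onI) (metis dist_self less_asym)
    have "k powr (- s) / (E * B) * eps powr (- s) * \<nu> I = (k * eps) powr (- s) * \<nu> I / E / B"
      using k eps by (simp add: powr_mult)
    also have "\<dots> \<le> card (cut (k * eps) I) / B"
      using card_cut_lower[OF I \<delta>] B by (intro divide_right_mono) auto
    also have "card (cut (k * eps) I) = card ?F" by (rule card_image[OF inj, symmetric])
    also have "real (card ?F) / B \<le> sep_number (B * eps) (K I) / B"
    proof (intro divide_right_mono sep_number_ge[OF I])
      show "?F \<subseteq> K I" using node_in_K cut_props K_mono by blast
      show "separated (B * eps) ?F" using sep by (auto simp: separated_def)
    qed (use B eps finite_cut \<delta> in auto)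
    also have "\<dots> \<le> N eps (K I)" using B eps compact_K by blast
    finally show ?thesis .
  qed
  moreover have "0 < k powr (- s) / (E * B)" "0 < 1 / (2 * k)" using B E_pos k by auto
  ultimately show ?thesis by blast
qed

section \<open>Almost additivity of counts\<close>

lemma N_disjoint_sum:
  assumes a: "0 < a" "\<And>eps X Q. compact X \<Longrightarrow> compact Q \<Longrightarrow> 0 < eps \<Longrightarrow> setdist X Q > a * eps \<Longrightarrow>
        N eps (X \<union> Q) = N eps X + N eps Q"
    and Z: "finite Z" "Z \<subseteq> tstar T" "\<And>I J. I \<in> Z \<Longrightarrow> J \<in> Z \<Longrightarrow> I \<noteq> J \<Longrightarrow> incomparable I J"
    and H: "\<And>I. I \<in> Z \<Longrightarrow> compact (H I) \<and> H I \<subseteq> K I" "\<And>I y. I \<in> Z \<Longrightarrow> y \<in> H I \<Longrightarrow> far I d y"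
    and eps: "0 < eps" "a * eps < d"
  shows "N eps (\<Union>I\<in>Z. H I) = (\<Sum>I\<in>Z. N eps (H I))"
  using Z H
proof (induction Z)
  case (insert I Z)
  let ?U = "\<Union>J\<in>Z. H J"
  have IH: "N eps ?U = (\<Sum>J\<in>Z. N eps (H J))"
  proof (rule insert.IH)
    show "\<And>J y. J \<in> Z \<Longrightarrow> y \<in> H J \<Longrightarrow> far J d y" using insert.prems(4) by blast
  qed (use insert.prems in auto)
  have comp: "compact (H I)" "compact ?U" using insert by auto
  have "N eps (H I \<union> ?U) = N eps (H I) + N eps ?U"
  \<comment> \<open>\<open>setdist\<close> is 0 if one of the sets is empty, so the separation
    required in (C4) can be shown only for nonempty sets.\<close>
  proof (cases "H I = {} \<or> ?U = {}")
    case True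
    then show ?thesis using N_empty[OF eps(1)] by auto
  next
    case False
    have "d \<le> setdist (H I) ?U"
    proof (rule le_setdistI)
      fix y z assume y: "y \<in> H I" and "z \<in> ?U"
      then obtain J where J: "J \<in> Z" "z \<in> H J" by blast
      then obtain \<omega> where \<omega>: "\<omega> \<in> T" "pre \<omega> (length J) = J" "z = xlim x \<omega>"
        using insert.prems(3)[of J] K_E by blast
      have "incomparable I J" using insert.prems(2)[of I J] insert.hyps J by auto
      then have "pre \<omega> (length I) \<noteq> I"
        using \<omega>(2) prefix_pre[of "length I" "length J" \<omega>] prefix_pre[of "length J" "length I" \<omega>]
        unfolding incomparable_def by (metis nat_le_linear)
      then show "d \<le> dist y z" using insert.prems(4)[OF _ y] \<omega> by (auto simp: far_def)
    qed (use False in auto)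
    then show ?thesis using a(2)[OF comp eps(1)] eps(2) by simp
  qed
  then show ?case using insert.hyps IH by simp
qed (use N_empty[OF eps(1)] in simp)

text \<open>The part of a cylinder which is not at a positive distance from the other cylinders has
  small measure, so it can be dropped before (C4) is applied.\<close>

lemma N_superadditive:
  assumes \<eta>: "0 < \<eta>"
  shows "\<exists>q>0. \<forall>Z eps. finite Z \<and> Z \<subseteq> tstar T \<and> (\<forall>I\<in>Z. \<forall>J\<in>Z. I \<noteq> J \<longrightarrow> incomparable I J) \<and>
     0 < eps \<and> (\<forall>I\<in>Z. eps \<le> q * r I) \<longrightarrow> (1 - \<eta>) * (\<Sum>I\<in>Z. N eps (K I)) \<le> N eps (K [])"
proof -
  obtain a where "0 < a \<and> (\<forall>eps X Q. compact X \<and> compact Q \<and> 0 < eps \<and> setdist X Q > a * eps \<longrightarrow>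
        N eps (X \<union> Q) = N eps X + N eps Q)" using N_C4 ..
  then have a: "0 < a" "\<And>eps X Q. compact X \<Longrightarrow> compact Q \<Longrightarrow> 0 < eps \<Longrightarrow> setdist X Q > a * eps \<Longrightarrow>
        N eps (X \<union> Q) = N eps X + N eps Q" by simp_all
  obtain c1 where c1: "0 < c1" "\<And>I eps. I \<in> tstar T \<Longrightarrow> 0 < eps \<Longrightarrow> eps \<le> r I \<Longrightarrow>
      N eps (K I) \<le> c1 * eps powr (- s) * \<nu> I" using N_upper by blast
  obtain c2 q2 where c2: "0 < c2" "0 < q2" "\<And>I eps. I \<in> tstar T \<Longrightarrow> 0 < eps \<Longrightarrow> eps \<le> q2 * r I \<Longrightarrow>
      c2 * eps powr (- s) * \<nu> I \<le> N eps (K I)" using N_lower by blast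
  obtain m l where l: "0 \<le> l" "l < 1"
    and inner: "\<And>k I. I \<in> tstar T \<Longrightarrow> \<exists>H B. inner_decomp (\<rho> ^ (m * k)) (l ^ k) I H B"
    using inner_part by blast
  \<comment> \<open>By the bounds \<open>c1\<close> and \<open>c2\<close> the discarded cylinders
    then account for at most the fraction \<open>\<eta>\<close> of
    \<open>N eps (K I)\<close>.\<close>
  obtain k where k: "l ^ k < \<eta> * c2 / c1"
    using real_arch_pow_inv[of "\<eta> * c2 / c1" l] l \<eta> c1 c2 by auto
  define p where "p = \<rho> ^ (m * k)"
  have p: "0 < p" using rho_pos by (simp add: p_def)
  \<comment> \<open>The three bounds in turn put \<open>eps\<close> below the radii of the discarded
    cylinders, make it small enough for the lower count of \<open>K I\<close>, and small against the
    distance between the good parts.\<close>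
  define q where "q = min p (min q2 (C * p / (4 * a)))"
  have q: "0 < q" "q \<le> p" "q \<le> q2" "q \<le> C * p / (4 * a)"
    using p c2 C_pos a by (auto simp: q_def)
  have result: "(1 - \<eta>) * (\<Sum>I\<in>Z. N eps (K I)) \<le> N eps (K [])"
    if Z: "finite Z" "Z \<subseteq> tstar T" "\<And>I J. I \<in> Z \<Longrightarrow> J \<in> Z \<Longrightarrow> I \<noteq> J \<Longrightarrow> incomparable I J"
      and eps: "0 < eps" "\<And>I. I \<in> Z \<Longrightarrow> eps \<le> q * r I" for Z eps
  proof (cases "Z = {}")
    case True
    then show ?thesis using N_nonneg compact_K eps by simp
  next
    case False
    have "\<forall>I\<in>Z. \<exists>H B. inner_decomp p (l ^ k) I H B"
      unfolding p_def using inner Z by blast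
    then obtain H B where HB: "\<And>I. I \<in> Z \<Longrightarrow> inner_decomp p (l ^ k) I (H I) (B I)"
      by metis
    have HB: "compact (H I)" "H I \<subseteq> K I" "finite (B I)"
      "\<And>J. J \<in> B I \<Longrightarrow> J \<in> tstar T \<and> p * r I \<le> r J" "(\<Sum>J\<in>B I. \<nu> J) \<le> l ^ k * \<nu> I"
      "K I \<subseteq> H I \<union> (\<Union>J\<in>B I. K J)" "\<And>y. y \<in> H I \<Longrightarrow> far I (C / 2 * (p * r I)) y"
      if "I \<in> Z" for I
      using HB[OF that] by (auto simp: inner_decomp_def)
    have main: "(1 - \<eta>) * N eps (K I) \<le> N eps (H I)" if I: "I \<in> Z" for I
    proof -
      have It: "I \<in> tstar T" using I Z by blast
      have cU: "compact (\<Union>J\<in>B I. K J)" using HB(3)[OF I] compact_K by blast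
      have "N eps (K I) \<le> N eps (H I \<union> (\<Union>J\<in>B I. K J))"
        using HB(1,6)[OF I] cU compact_K eps by (intro N_mono) auto
      also have "\<dots> \<le> N eps (H I) + N eps (\<Union>J\<in>B I. K J)"
        using HB(1)[OF I] cU eps by (intro N_Un) auto
      also have "N eps (\<Union>J\<in>B I. K J) \<le> (\<Sum>J\<in>B I. N eps (K J))"
        using HB(3)[OF I] compact_K eps by (intro N_UN) auto
      also have "\<dots> \<le> (\<Sum>J\<in>B I. c1 * eps powr (- s) * \<nu> J)"
      proof (rule sum_mono)
        fix J assume J: "J \<in> B I"
        have "eps \<le> q * r I" using eps I by blast
        also have "\<dots> \<le> p * r I" using q r_pos[OF It] by simp
        also have "\<dots> \<le> r J" using HB(4)[OF I J] by blast
        finally show "N eps (K J) \<le> c1 * eps powr (- s) * \<nu> J" using c1(2) HB(4)[OF I J] eps by blast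
      qed
      also have "\<dots> = c1 * eps powr (- s) * (\<Sum>J\<in>B I. \<nu> J)" by (simp add: sum_distrib_left)
      also have "\<dots> \<le> c1 * eps powr (- s) * ((\<eta> * c2 / c1) * \<nu> I)"
      proof (rule mult_left_mono)
        have "l ^ k * \<nu> I \<le> \<eta> * c2 / c1 * \<nu> I" using k nu_pos[OF It] by (intro mult_right_mono) auto
        then show "(\<Sum>J\<in>B I. \<nu> J) \<le> \<eta> * c2 / c1 * \<nu> I" using HB(5)[OF I] by simp
      qed (use c1 in simp)
      also have "\<dots> = \<eta> * (c2 * eps powr (- s) * \<nu> I)" using c1 by (simp add: field_simps)
      also have "\<dots> \<le> \<eta> * N eps (K I)"
      proof (intro mult_left_mono c2(3)[OF It])
        have "eps \<le> q * r I" using eps I by blast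
        also have "\<dots> \<le> q2 * r I" using q r_pos[OF It] by simp
        finally show "eps \<le> q2 * r I" .
      qed (use eps \<eta> in auto)
      finally show ?thesis by (simp add: algebra_simps)
    qed
    \<comment> \<open>Twice the distance \<open>a * eps\<close>, since (C4) asks for a strict
      inequality.\<close>
    define d where "d = 2 * a * eps"
    have far: "far I d y" if "I \<in> Z" "y \<in> H I" for I y
    proof (rule far_prefix[OF HB(7)[OF that] prefix_order.refl])
      have "d \<le> 2 * a * (q * r I)" using eps(2)[OF that(1)] a by (simp add: d_def)
      also have "\<dots> \<le> 2 * a * ((C * p / (4 * a)) * r I)"
        using q a r_pos[of I] Z that by (intro mult_left_mono mult_right_mono) auto
      also have "\<dots> = C / 2 * (p * r I)" using a by (simp add: field_simps)
      finally show "d \<le> C / 2 * (p * r I)" .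
    qed
    have "(1 - \<eta>) * (\<Sum>I\<in>Z. N eps (K I)) \<le> (\<Sum>I\<in>Z. N eps (H I))"
      unfolding sum_distrib_left by (rule sum_mono) (rule main)
    also have "\<dots> = N eps (\<Union>I\<in>Z. H I)"
      by (rule N_disjoint_sum[OF a Z, symmetric, where d = d])
        (use HB far eps a in \<open>auto simp: d_def\<close>)
    also have "\<dots> \<le> N eps (K [])"
    proof (rule N_mono)
      show "(\<Union>I\<in>Z. H I) \<subseteq> K []" using HB(2) K_mono[of "[]"] by fastforce
    qed (use HB Z eps compact_K in auto)
    finally show ?thesis .
  qed
  show ?thesis
  proof (intro exI[of _ q] conjI allI impI q(1))
    fix Z eps
    assume "finite Z \<and> Z \<subseteq> tstar T \<and> (\<forall>I\<in>Z. \<forall>J\<in>Z. I \<noteq> J \<longrightarrow> incomparable I J) \<and>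
     0 < eps \<and> (\<forall>I\<in>Z. eps \<le> q * r I)"
    then show "(1 - \<eta>) * (\<Sum>I\<in>Z. N eps (K I)) \<le> N eps (K [])"
      by (intro result) simp_all
  qed
qed

end

subsection \<open>Asymptotic self-similarity\<close>

lemma bi_lipschitz_inj: "bi_lipschitz g \<Longrightarrow> inj g"
  unfolding bi_lipschitz_def by (intro injI) (metis dist_eq_0_iff mult_zero_right zero_le_dist order_antisym)

lemma phiw_append: "phiw \<phi> (I @ J) = phiw \<phi> I \<circ> phiw \<phi> J"
  by (induction I) auto

text \<open>Two distinct points make the set of ratios nonempty, and the bi-Lipschitz bounds confine
  it to \<open>[1 / L, L]\<close>; this makes \<open>Sup\<close> and \<open>Inf\<close> the genuine
  optimal constants.\<close>

lemma lip_ratios_bounds: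
  assumes g: "bi_lipschitz g" and X: "y0 \<in> X" "z0 \<in> X" "y0 \<noteq> z0"
  shows "0 < Sup (lip_ratios g X)" "0 < Inf (lip_ratios g X)"
    and "\<And>y z. y \<in> X \<Longrightarrow> z \<in> X \<Longrightarrow> dist (g y) (g z) \<le> Sup (lip_ratios g X) * dist y z"
    and "\<And>y z. y \<in> X \<Longrightarrow> z \<in> X \<Longrightarrow> Inf (lip_ratios g X) * dist y z \<le> dist (g y) (g z)"
proof -
  obtain L where L: "0 < L" "\<And>y z. dist y z \<le> L * dist (g y) (g z)" "\<And>y z. dist (g y) (g z) \<le> L * dist y z"
    using g unfolding bi_lipschitz_def by blast
  have ne: "dist (g y0) (g z0) / dist y0 z0 \<in> lip_ratios g X"
    using X by (auto simp: lip_ratios_def)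
  have bd: "1 / L \<le> q \<and> q \<le> L" if qm: "q \<in> lip_ratios g X" for q
  proof -
    obtain y z where "q = dist (g y) (g z) / dist y z" "y \<noteq> z" using qm by (auto simp: lip_ratios_def)
    moreover have "1 / L \<le> dist (g y) (g z) / dist y z" "dist (g y) (g z) / dist y z \<le> L"
      using L(1) L(2,3)[of y z] \<open>y \<noteq> z\<close> by (simp_all add: pos_divide_le_eq pos_le_divide_eq mult.commute)
    ultimately show ?thesis by simp
  qed
  have bdd: "bdd_above (lip_ratios g X)" "bdd_below (lip_ratios g X)"
    using bd by (meson bdd_above.I, meson bdd_below.I)
  have "0 < 1 / L" using L by simp
  show "0 < Sup (lip_ratios g X)"
    using cSup_upper[OF ne bdd(1)] bd[OF ne] \<open>0 < 1 / L\<close> by linarith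
  have "1 / L \<le> Inf (lip_ratios g X)" using ne bd by (intro cInf_greatest) auto
  then show "0 < Inf (lip_ratios g X)" using \<open>0 < 1 / L\<close> by linarith
  fix y z assume yz: "y \<in> X" "z \<in> X"
  show "dist (g y) (g z) \<le> Sup (lip_ratios g X) * dist y z"
  proof (cases "y = z")
    case False
    then have "dist (g y) (g z) / dist y z \<le> Sup (lip_ratios g X)"
      using yz by (intro cSup_upper bdd) (auto simp: lip_ratios_def)
    then show ?thesis using False by (simp add: pos_divide_le_eq)
  qed simp
  show "Inf (lip_ratios g X) * dist y z \<le> dist (g y) (g z)"
  proof (cases "y = z")
    case False
    then have "Inf (lip_ratios g X) \<le> dist (g y) (g z) / dist y z"
      using yz by (intro cInf_lower bdd) (auto simp: lip_ratios_def)
    then show ?thesis using False by (simp add: pos_le_divide_eq)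
  qed simp
qed

lemma kap_word_Cons: "kap_word k (i # I) J = k i (I @ J) * kap_word k I J"
  by (simp add: kap_word_def prod.lessThan_Suc_shift del: prod.lessThan_Suc)

section \<open>Almost similarities between cylinders\<close>

locale conformal_ifs = counted_tree +
  fixes W \<xi> :: real and \<phi> :: "nat \<Rightarrow> 'a::complete_space \<Rightarrow> 'a" and f1t :: "(nat \<Rightarrow> nat) \<Rightarrow> real"
  assumes phi_bilip: "\<And>i. i < Nl \<Longrightarrow> bi_lipschitz (\<phi> i)" and W_pos: "0 < W"
    and phi_K: "\<And>I J. I \<in> tstar T \<Longrightarrow> J \<in> tstar T \<Longrightarrow> I @ J \<in> tstar T \<Longrightarrow> phiw \<phi> I ` K J = K (I @ J)"
    and phi_nbhd: "\<And>I. I\<in>tstar T \<Longrightarrow> nbhd (K I) (r I * W * G * \<xi>) \<subseteq> phiw \<phi> I ` nbhd (gen_set T x) (G * \<xi>)"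
    and xi_pos: "0 < \<xi>"
    and M5: "\<And>e. 0 < e \<Longrightarrow> \<exists>m. \<forall>I J. I @ J \<in> tstar T \<and> m \<le> length J \<longrightarrow>
          \<bar>kap_word (kap_plus \<phi> r (gen_set T x) (G * \<xi>)) I J - 1\<bar> < e \<and>
          \<bar>kap_word (kap_minus \<phi> r (gen_set T x) (G * \<xi>)) I J - 1\<bar> < e"
    and f1t_holder: "holder_on (T \<union> emb Nl ` tstar T) f1t"
    and f1t_word: "\<And>I. I\<in>tstar T \<Longrightarrow> f1t (emb Nl I) = fpot r (kap_plus \<phi> r (gen_set T x) (G * \<xi>)) I"
begin

abbreviation kp :: "nat \<Rightarrow> nat list \<Rightarrow> real" where
  "kp \<equiv> kap_plus \<phi> r (gen_set T x) (G * \<xi>)"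

abbreviation km :: "nat \<Rightarrow> nat list \<Rightarrow> real" where
  "km \<equiv> kap_minus \<phi> r (gen_set T x) (G * \<xi>)"

definition X :: "nat list \<Rightarrow> 'a set" where
  "X J = phiw \<phi> J ` nbhd (gen_set T x) (G * \<xi>)"

lemma inj_phiw: "I \<in> tstar T \<Longrightarrow> inj (phiw \<phi> I)"
proof (induction I)
  case (Cons i I)
  then have "inj (\<phi> i)" "inj (phiw \<phi> I)"
    using tstar_letters[OF Cons.prems] tstar_append_D[of "[i]" I] bi_lipschitz_inj[OF phi_bilip] by auto
  then show ?case unfolding phiw.simps by (rule inj_compose)
qed auto

lemma X_append: "X (I @ J) = phiw \<phi> I ` X J"
  by (simp add: X_def phiw_append image_comp)

lemma two_points: "\<exists>y0 z0. y0 \<in> nbhd (gen_set T x) (G * \<xi>) \<and> z0 \<in> nbhd (gen_set T x) (G * \<xi>) \<and> y0 \<noteq> z0"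
proof -
  have 01: "[0] \<in> tstar T" "[1] \<in> tstar T" using letter_in_tstar Nl2 by auto
  have "incomparable [0] [Suc 0]" by (simp add: incomparable_def)
  then have "C * (r [0] + r [1]) \<le> dist (x [0]) (x [1])" using T1[OF 01] by simp
  moreover have "0 < C * (r [0] + r [1])" using C_pos r_pos[OF 01(1)] r_pos[OF 01(2)] by simp
  ultimately have "x [0] \<noteq> x [1]" by auto
  moreover have "y \<in> nbhd (gen_set T x) (G * \<xi>)" if "y \<in> gen_set T x" for y
    using that G_nonneg xi_pos by (auto simp: nbhd_def)
  ultimately show ?thesis using M2[OF 01(1)] M2[OF 01(2)] by blast
qed

lemma kappa_letter:
  assumes iJ: "i # J \<in> tstar T"
  shows "0 < kp i J" "0 < km i J"
    and "\<And>y z. y \<in> X J \<Longrightarrow> z \<in> X J \<Longrightarrow> dist (\<phi> i y) (\<phi> i z) \<le> kp i J * (r (i # J) / r J) * dist y z"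
    and "\<And>y z. y \<in> X J \<Longrightarrow> z \<in> X J \<Longrightarrow> km i J * (r (i # J) / r J) * dist y z \<le> dist (\<phi> i y) (\<phi> i z)"
proof -
  have J: "J \<in> tstar T" using tstar_append_D[of "[i]" J] iJ by simp
  have i: "bi_lipschitz (\<phi> i)" using tstar_letters[OF iJ] phi_bilip by simp
  obtain y0 z0 where "y0 \<in> X J" "z0 \<in> X J" "y0 \<noteq> z0"
    using two_points inj_phiw[OF J] unfolding X_def by (metis imageI injD)
  note * = lip_ratios_bounds[OF i this]
  have r: "0 < r J" "0 < r (i # J)" using r_pos J iJ by auto
  show "0 < kp i J" "0 < km i J" using *(1,2) r by (simp_all add: kap_plus_def kap_minus_def X_def)
  have "kp i J * (r (i # J) / r J) = Sup (lip_ratios (\<phi> i) (X J))"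
    "km i J * (r (i # J) / r J) = Inf (lip_ratios (\<phi> i) (X J))"
    using r by (simp_all add: kap_plus_def kap_minus_def X_def)
  then show "\<And>y z. y \<in> X J \<Longrightarrow> z \<in> X J \<Longrightarrow> dist (\<phi> i y) (\<phi> i z) \<le> kp i J * (r (i # J) / r J) * dist y z"
    "\<And>y z. y \<in> X J \<Longrightarrow> z \<in> X J \<Longrightarrow> km i J * (r (i # J) / r J) * dist y z \<le> dist (\<phi> i y) (\<phi> i z)"
    using *(3,4) by simp_all
qed

text \<open>\<open>phiw \<phi> I\<close> maps \<open>X J\<close> onto \<open>X (I @ J)\<close>, the
  domain of the estimate for the next letter, so the estimates can be chained; the quotients of
  radii telescope.\<close>

lemma kappa_word:
  assumes "I @ J \<in> tstar T"
  shows "0 < kap_word kp I J \<and> 0 < kap_word km I J \<and>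
    (\<forall>y\<in>X J. \<forall>z\<in>X J. dist (phiw \<phi> I y) (phiw \<phi> I z) \<le> kap_word kp I J * (r (I @ J) / r J) * dist y z \<and>
      kap_word km I J * (r (I @ J) / r J) * dist y z \<le> dist (phiw \<phi> I y) (phiw \<phi> I z))"
  using assms
proof (induction I)
  case Nil
  then show ?case using r_pos[of J] by (simp add: kap_word_def)
next
  case (Cons i I)
  have IJ: "I @ J \<in> tstar T" using tstar_append_D[of "[i]" "I @ J"] Cons.prems by simp
  note IH = Cons.IH[OF IJ]
  have iIJ: "i # (I @ J) \<in> tstar T" using Cons.prems by simp
  note k = kappa_letter[OF iIJ]
  have pos: "0 < r (i # I @ J)" "0 < r (I @ J)" "0 < r J"
    using r_pos iIJ IJ tstar_append_D[OF IJ] by auto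
  have "dist (phiw \<phi> (i # I) y) (phiw \<phi> (i # I) z) \<le> kap_word kp (i # I) J * (r ((i # I) @ J) / r J) * dist y z \<and>
      kap_word km (i # I) J * (r ((i # I) @ J) / r J) * dist y z \<le> dist (phiw \<phi> (i # I) y) (phiw \<phi> (i # I) z)"
    if yz: "y \<in> X J" "z \<in> X J" for y z
  proof
    have X: "phiw \<phi> I y \<in> X (I @ J)" "phiw \<phi> I z \<in> X (I @ J)" using yz by (auto simp: X_append)
    have "dist (phiw \<phi> (i # I) y) (phiw \<phi> (i # I) z) \<le>
        kp i (I @ J) * (r (i # I @ J) / r (I @ J)) * dist (phiw \<phi> I y) (phiw \<phi> I z)"
      using k(3)[OF X] by simp
    also have "\<dots> \<le> kp i (I @ J) * (r (i # I @ J) / r (I @ J)) * (kap_word kp I J * (r (I @ J) / r J) * dist y z)"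
      using IH yz k(1) pos by (intro mult_left_mono) auto
    also have "\<dots> = kap_word kp (i # I) J * (r ((i # I) @ J) / r J) * dist y z"
      using pos by (simp add: kap_word_Cons)
    finally show "dist (phiw \<phi> (i # I) y) (phiw \<phi> (i # I) z) \<le> \<dots>" .
    have "kap_word km (i # I) J * (r ((i # I) @ J) / r J) * dist y z =
        km i (I @ J) * (r (i # I @ J) / r (I @ J)) * (kap_word km I J * (r (I @ J) / r J) * dist y z)"
      using pos by (simp add: kap_word_Cons)
    also have "\<dots> \<le> km i (I @ J) * (r (i # I @ J) / r (I @ J)) * dist (phiw \<phi> I y) (phiw \<phi> I z)"
      using IH yz k(2) pos by (intro mult_left_mono) auto
    also have "\<dots> \<le> dist (phiw \<phi> (i # I) y) (phiw \<phi> (i # I) z)" using k(4)[OF X] by simp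
    finally show "kap_word km (i # I) J * (r ((i # I) @ J) / r J) * dist y z \<le>
        dist (phiw \<phi> (i # I) y) (phiw \<phi> (i # I) z)" .
  qed
  then show ?case using IH k(1,2) by (simp add: kap_word_Cons)
qed

lemma nbhd_X: "I \<in> tstar T \<Longrightarrow> nbhd (K I) (G * (r I * W * \<xi>)) \<subseteq> X I"
  using phi_nbhd[of I] by (simp add: X_def mult.commute mult.left_commute)

text \<open>(C5) with \<tau> equal to \<open>r J * W * \<xi>\<close>: by (M4) the neighbourhood of
  \<open>K J\<close> required there lies inside \<open>X J\<close>, where the \<kappa> control the
  map.\<close>

lemma N_push:
  assumes IJ: "I @ J \<in> tstar T" and eps: "0 < eps" "eps \<le> r J * W * \<xi>"
  shows "N (kap_word kp I J * (r (I @ J) / r J) * eps) (K (I @ J)) \<le> N eps (K J)"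
proof -
  have t: "I \<in> tstar T" "J \<in> tstar T" using tstar_append_D[OF IJ] by auto
  note k = kappa_word[OF IJ]
  have pos: "0 < kap_word kp I J * (r (I @ J) / r J)" using k r_pos t IJ by simp
  have "N (kap_word kp I J * (r (I @ J) / r J) * eps) (phiw \<phi> I ` K J) \<le> N eps (K J)"
  proof (rule N_C5[OF _ pos compact_K _ eps])
    show "0 < r J * W * \<xi>" using eps by linarith
    show "(kap_word kp I J * (r (I @ J) / r J))-lipschitz_on (nbhd (K J) (G * (r J * W * \<xi>))) (phiw \<phi> I)"
      using k nbhd_X[OF t(2)] pos by (intro lipschitz_onI) (auto simp: subset_iff)
  qed
  then show ?thesis using phi_K[OF t IJ] by simp
qed

text \<open>The same for the inverse map, which is Lipschitz on the image of \<open>X J\<close>. By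
  (M4) this image contains the neighbourhood of \<open>K (I @ J)\<close> in (C5) when \<tau> is
  measured with \<open>r (I @ J)\<close>.\<close>

lemma N_pull:
  assumes IJ: "I @ J \<in> tstar T" and eps: "0 < eps" "eps \<le> r (I @ J) * W * \<xi>"
  shows "N (eps / (kap_word km I J * (r (I @ J) / r J))) (K J) \<le> N eps (K (I @ J))"
proof -
  have t: "I \<in> tstar T" "J \<in> tstar T" using tstar_append_D[OF IJ] by auto
  note k = kappa_word[OF IJ]
  define c where "c = kap_word km I J * (r (I @ J) / r J)"
  have c: "0 < c" using k r_pos t IJ by (simp add: c_def)
  have inj: "inj (phiw \<phi> I)" by (rule inj_phiw[OF t(1)])
  have "N (1 / c * eps) (inv (phiw \<phi> I) ` K (I @ J)) \<le> N eps (K (I @ J))"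
  proof (rule N_C5[OF _ _ compact_K _ eps])
    show "0 < r (I @ J) * W * \<xi>" using eps by linarith
    show "(1 / c)-lipschitz_on (nbhd (K (I @ J)) (G * (r (I @ J) * W * \<xi>))) (inv (phiw \<phi> I))"
    proof (rule lipschitz_onI)
      fix y z assume "y \<in> nbhd (K (I @ J)) (G * (r (I @ J) * W * \<xi>))" "z \<in> nbhd (K (I @ J)) (G * (r (I @ J) * W * \<xi>))"
      then have "y \<in> phiw \<phi> I ` X J" "z \<in> phiw \<phi> I ` X J" using nbhd_X[OF IJ] by (auto simp: X_append)
      then obtain u v where uv: "u \<in> X J" "v \<in> X J" "y = phiw \<phi> I u" "z = phiw \<phi> I v" by blast
      have "c * dist u v \<le> dist y z" using k uv unfolding c_def by blast
      then show "dist (inv (phiw \<phi> I) y) (inv (phiw \<phi> I) z) \<le> 1 / c * dist y z"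
        using c by (simp add: uv inv_f_f[OF inj] field_simps)
    qed (use c in simp)
  qed (use c in simp)
  moreover have "inv (phiw \<phi> I) ` K (I @ J) = K J"
    using phi_K[OF t IJ] inj by (metis image_inv_f_f)
  moreover have "1 / c * eps = eps / c" by simp
  ultimately have "N (eps / c) (K J) \<le> N eps (K (I @ J))" by simp
  then show ?thesis unfolding c_def .
qed

lemma ln_near_1: "0 < (e::real) \<Longrightarrow> \<exists>d>0. \<forall>k. \<bar>k - 1\<bar> < d \<longrightarrow> \<bar>ln k\<bar> \<le> e"
proof -
  assume "0 < e"
  moreover have "isCont ln (1::real)" by (intro isCont_ln) simp
  ultimately obtain d where "0 < d" "\<forall>k. dist k 1 < d \<longrightarrow> dist (ln k) (ln (1::real)) < e"
    unfolding continuous_at_eps_delta by blast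
  then show ?thesis by (intro exI[of _ d]) (auto simp: dist_real_def less_imp_le)
qed

lemma ln_kappa_small:
  assumes e: "0 < e"
  shows "\<exists>m. \<forall>I J. I @ J \<in> tstar T \<and> m \<le> length J \<longrightarrow>
    \<bar>ln (kap_word kp I J)\<bar> \<le> e \<and> \<bar>ln (kap_word km I J)\<bar> \<le> e"
proof -
  obtain d where d: "0 < d" "\<And>k. \<bar>k - 1\<bar> < d \<Longrightarrow> \<bar>ln k\<bar> \<le> e" using ln_near_1[OF e] by blast
  obtain m where "\<forall>I J. I @ J \<in> tstar T \<and> m \<le> length J \<longrightarrow>
      \<bar>kap_word kp I J - 1\<bar> < d \<and> \<bar>kap_word km I J - 1\<bar> < d" using M5[OF d(1)] ..
  then show ?thesis using d(2) by (intro exI[of _ m]) blast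
qed

section \<open>Counts, radii and Birkhoff sums in logarithmic time\<close>

definition cnt :: "nat list \<Rightarrow> real \<Rightarrow> real" where
  "cnt J t = N (exp (- t)) (K J)"

lemma cnt_mono: "t \<le> u \<Longrightarrow> cnt J t \<le> cnt J u"
  unfolding cnt_def by (rule N_antimono[OF compact_K]) auto

lemma cnt_nonneg: "0 \<le> cnt J t"
  unfolding cnt_def by (rule N_nonneg[OF compact_K]) auto

text \<open>Factors \<kappa> near 1 become time shifts of at most \<open>e\<close>, which
  monotonicity of \<open>cnt\<close> absorbs. The margin \<open>exp (- e)\<close> in the condition
  on \<open>t\<close> keeps the rescaled size within the range of (C5) even if \<kappa> is below
  1.\<close>

lemma cnt_scale:
  assumes e: "0 < e"
  shows "\<exists>m. \<forall>I J t. I @ J \<in> tstar T \<and> m \<le> length J \<and> exp (- t) \<le> r (I @ J) * W * \<xi> * exp (- e) \<longrightarrow>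
    cnt (I @ J) t \<le> cnt J (t + ln (r (I @ J) / r J) + e) \<and>
    cnt J (t + ln (r (I @ J) / r J) - e) \<le> cnt (I @ J) t"
proof -
  obtain m where m: "\<And>I J. I @ J \<in> tstar T \<Longrightarrow> m \<le> length J \<Longrightarrow>
    \<bar>ln (kap_word kp I J)\<bar> \<le> e \<and> \<bar>ln (kap_word km I J)\<bar> \<le> e" using ln_kappa_small[OF e] by blast
  have "cnt (I @ J) t \<le> cnt J (t + ln (r (I @ J) / r J) + e) \<and>
    cnt J (t + ln (r (I @ J) / r J) - e) \<le> cnt (I @ J) t"
    if IJ: "I @ J \<in> tstar T" "m \<le> length J" and t: "exp (- t) \<le> r (I @ J) * W * \<xi> * exp (- e)" for I J t
  proof -
    have pos: "0 < r (I @ J)" "0 < r J" using r_pos IJ(1) tstar_append_D[OF IJ(1)] by auto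
    define c where "c = r (I @ J) / r J"
    have c: "0 < c" using pos by (simp add: c_def)
    define p where "p = kap_word kp I J"
    define q where "q = kap_word km I J"
    have pq: "0 < p" "0 < q" using kappa_word[OF IJ(1)] by (auto simp: p_def q_def)
    have ln: "\<bar>ln p\<bar> \<le> e" "\<bar>ln q\<bar> \<le> e" using m[OF IJ] by (auto simp: p_def q_def)
    have div: "exp (- t) / (k * c) = exp (- (t + ln c + ln k))" if "0 < k" for k
      using that c by (simp add: exp_diff exp_add exp_minus field_simps)
    have Wx: "0 < r (I @ J) * W * \<xi>" using pos W_pos xi_pos by simp
    have le: "exp (- t) / (p * c) \<le> r J * W * \<xi>"
    proof -
      have "exp (- e) \<le> p" using ln(1) pq(1) by (metis abs_le_D2 exp_ln exp_le_cancel_iff minus_le_iff)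
      then have "r (I @ J) * W * \<xi> * exp (- e) \<le> r (I @ J) * W * \<xi> * p"
        using Wx by (intro mult_left_mono) auto
      then have "exp (- t) \<le> r J * W * \<xi> * (p * c)" using t pos by (simp add: c_def field_simps)
      then show ?thesis using pq c by (simp add: pos_divide_le_eq)
    qed
    have "0 < exp (- t) / (p * c)" using pq c by simp
    from N_push[OF IJ(1) this le]
    have "N (p * c * (exp (- t) / (p * c))) (K (I @ J)) \<le> N (exp (- t) / (p * c)) (K J)"
      unfolding p_def c_def .
    then have "cnt (I @ J) t \<le> cnt J (t + ln c + ln p)"
      using pq c unfolding cnt_def div[OF pq(1), symmetric] by simp
    also have "\<dots> \<le> cnt J (t + ln c + e)" by (rule cnt_mono) (use ln in auto)
    finally have 1: "cnt (I @ J) t \<le> cnt J (t + ln c + e)" .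
    have le': "exp (- t) \<le> r (I @ J) * W * \<xi>"
      using t mult_left_mono[of "exp (- e)" 1 "r (I @ J) * W * \<xi>"] Wx e by simp
    have "N (exp (- t) / (q * c)) (K J) \<le> N (exp (- t)) (K (I @ J))"
      using N_pull[OF IJ(1) exp_gt_zero le'] unfolding q_def c_def .
    then have "cnt J (t + ln c + ln q) \<le> cnt (I @ J) t"
      unfolding cnt_def div[OF pq(2), symmetric] by simp
    moreover have "cnt J (t + ln c - e) \<le> cnt J (t + ln c + ln q)" by (rule cnt_mono) (use ln in auto)
    ultimately show ?thesis using 1 by (simp add: c_def)
  qed
  then show ?thesis by (intro exI[of _ m]) blast
qed

lemma holder_constants:
  "\<exists>M a. sft_potential Nl A T f1t M a \<and> (\<forall>I \<omega>. I \<frown> \<omega> \<in> T \<longrightarrow> \<bar>f1t (emb Nl I) - f1t (I \<frown> \<omega>)\<bar> \<le> M * a ^ length I)"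
proof -
  obtain a M where a: "0 < a" "a < 1" and M: "\<And>n \<omega> \<tau>. \<omega> \<in> T \<union> emb Nl ` tstar T \<Longrightarrow> \<tau> \<in> T \<union> emb Nl ` tstar T \<Longrightarrow>
      (\<forall>k<n. \<omega> k = \<tau> k) \<Longrightarrow> \<bar>f1t \<omega> - f1t \<tau>\<bar> \<le> M * a ^ n"
    using f1t_holder unfolding holder_on_def by blast
  have "sft_potential Nl A T f1t M a"
    by unfold_locales (use a M in \<open>auto simp: agree_def\<close>)
  moreover have "\<bar>f1t (emb Nl I) - f1t (I \<frown> \<omega>)\<bar> \<le> M * a ^ length I" if "I \<frown> \<omega> \<in> T" for I \<omega>
    by (rule M) (use that tstar_iff in \<open>auto simp: emb_def wcat_def\<close>)
  ultimately show ?thesis by blast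
qed

text \<open>At finite words \<open>f1t\<close> is the logarithm of a quotient of radii corrected by
  \<kappa>, and along \<open>I\<close> these logarithms telescope. Replacing each finite word by an
  infinite extension costs a Hoelder error; the errors are dominated by a geometric series starting
  at \<open>M * a ^ length J\<close>, and for long \<open>J\<close> the product of the \<kappa> is
  near 1.\<close>

lemma ln_ratio_bsum:
  assumes e: "0 < e"
  shows "\<exists>m. \<forall>I J \<omega>. I \<frown> J \<frown> \<omega> \<in> T \<and> m \<le> length J \<longrightarrow>
    \<bar>ln (r J / r (I @ J)) - bsum f1t I (J \<frown> \<omega>)\<bar> \<le> e"
proof -
  obtain M a where pot: "sft_potential Nl A T f1t M a"
    and emb: "\<And>I \<omega>. I \<frown> \<omega> \<in> T \<Longrightarrow> \<bar>f1t (emb Nl I) - f1t (I \<frown> \<omega>)\<bar> \<le> M * a ^ length I"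
    using holder_constants by blast
  interpret sft_potential Nl A T f1t M a by (rule pot)
  have sum: "\<bar>ln (r J / (r (I @ J) * kap_word kp I J)) - bsum f1t I (J \<frown> \<omega>)\<bar>
      \<le> M * a ^ length J * ((1 - a ^ length I) / (1 - a))"
    if "I \<frown> J \<frown> \<omega> \<in> T" for I J \<omega>
    using that
  proof (induction I)
    case Nil
    then have "J \<in> tstar T" using tstar_iff by auto
    then show ?case using r_pos by (simp add: kap_word_def)
  next
    case (Cons i I)
    have IJ\<omega>: "I \<frown> J \<frown> \<omega> \<in> T" using Cons.prems by (simp add: wcat_Cons_in_T)
    have iIJ: "i # I @ J \<in> tstar T" using Cons.prems unfolding tstar_iff by (intro exI[of _ \<omega>]) simp
    then have IJ: "I @ J \<in> tstar T" using tstar_append_D[of "[i]" "I @ J"] by simp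
    then have J: "J \<in> tstar T" using tstar_append_D by blast
    have pos: "0 < r J" "0 < r (I @ J)" "0 < r (i # I @ J)" "0 < kp i (I @ J)" "0 < kap_word kp I J"
      using r_pos J IJ iIJ kappa_letter(1)[OF iIJ] kappa_word[OF IJ] by auto
    have "f1t (emb Nl (i # I @ J)) = ln (r (I @ J) / (r (i # I @ J) * kp i (I @ J)))"
      using f1t_word[OF iIJ] by (simp add: fpot_def)
    moreover have "\<bar>f1t (emb Nl (i # I @ J)) - f1t ((i # I) \<frown> J \<frown> \<omega>)\<bar> \<le> M * a ^ length (i # I @ J)"
      using emb[of "i # I @ J" \<omega>] Cons.prems by simp
    moreover have "M * a ^ length (i # I @ J) \<le> M * a ^ (length I + length J)"
      using a M_nonneg by (intro mult_left_mono power_decreasing) auto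
    ultimately have 1: "\<bar>ln (r (I @ J) / (r (i # I @ J) * kp i (I @ J))) - f1t ((i # I) \<frown> J \<frown> \<omega>)\<bar>
        \<le> M * a ^ (length I + length J)" by linarith
    have "ln (r J / (r ((i # I) @ J) * kap_word kp (i # I) J)) =
        ln (r (I @ J) / (r (i # I @ J) * kp i (I @ J))) + ln (r J / (r (I @ J) * kap_word kp I J))"
      using pos by (simp add: kap_word_Cons ln_div ln_mult)
    then have "\<bar>ln (r J / (r ((i # I) @ J) * kap_word kp (i # I) J)) - bsum f1t (i # I) (J \<frown> \<omega>)\<bar>
        \<le> M * a ^ (length I + length J) + M * a ^ length J * ((1 - a ^ length I) / (1 - a))"
      using 1 Cons.IH[OF IJ\<omega>] by simp
    also have "\<dots> = M * a ^ length J * (a ^ length I * (1 - a) / (1 - a) + (1 - a ^ length I) / (1 - a))"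
    proof -
      have "a ^ length I * (1 - a) / (1 - a) = a ^ length I" using a by simp
      then show ?thesis by (simp only: power_add) (simp add: distrib_left)
    qed
    also have "a ^ length I * (1 - a) / (1 - a) + (1 - a ^ length I) / (1 - a) = (1 - a ^ length (i # I)) / (1 - a)"
      by (subst add_divide_distrib[symmetric]) (simp add: algebra_simps)
    finally show ?case .
  qed
  obtain m1 where m1: "\<And>I J. I @ J \<in> tstar T \<Longrightarrow> m1 \<le> length J \<Longrightarrow> \<bar>ln (kap_word kp I J)\<bar> \<le> e / 2"
    using ln_kappa_small[of "e / 2"] e by auto
  obtain m2 where m2: "Cd * a ^ m2 \<le> e / 2" using distortion_small[of "e / 2"] e by auto
  have "\<bar>ln (r J / r (I @ J)) - bsum f1t I (J \<frown> \<omega>)\<bar> \<le> e"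
    if T: "I \<frown> J \<frown> \<omega> \<in> T" and J: "max m1 m2 \<le> length J" for I J \<omega>
  proof -
    have IJ: "I @ J \<in> tstar T" using T unfolding tstar_iff by (intro exI[of _ \<omega>]) simp
    then have pos: "0 < r J" "0 < r (I @ J)" "0 < kap_word kp I J"
      using r_pos tstar_append_D[OF IJ] kappa_word[OF IJ] by auto
    have "M * a ^ length J * ((1 - a ^ length I) / (1 - a)) \<le> M * a ^ length J * (1 / (1 - a))"
      using a M_nonneg by (intro mult_left_mono divide_right_mono) auto
    also have "\<dots> = Cd * a ^ length J" by (simp add: Cd_def)
    also have "\<dots> \<le> e / 2" using distortion_mono[of m2 "length J"] J m2 by linarith
    finally have "\<bar>ln (r J / (r (I @ J) * kap_word kp I J)) - bsum f1t I (J \<frown> \<omega>)\<bar> \<le> e / 2"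
      using sum[OF T] by linarith
    moreover have "ln (r J / (r (I @ J) * kap_word kp I J)) = ln (r J / r (I @ J)) - ln (kap_word kp I J)"
      using pos by (simp add: ln_div ln_mult)
    moreover have "\<bar>ln (kap_word kp I J)\<bar> \<le> e / 2" using m1[OF IJ] J by simp
    ultimately show ?thesis by linarith
  qed
  then show ?thesis by blast
qed

text \<open>For an extension \<open>w\<close> of \<open>L\<close> the logarithms of
  \<open>r w / r (I @ w)\<close> and \<open>r L / r (I @ L)\<close> are both compared with the
  Birkhoff sum at one common point, so they differ by at most \<open>e\<close>. The scaling property
  \<open>nu_scale\<close> turns this into a statement on masses.\<close>

lemma nu_ratio:
  assumes e: "0 < e"
  shows "\<exists>m. \<forall>I L. I @ L \<in> tstar T \<and> m \<le> length L \<longrightarrow>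
    (r (I @ L) / r L * exp (- e)) powr s * \<nu> L \<le> \<nu> (I @ L) \<and>
    \<nu> (I @ L) \<le> (r (I @ L) / r L * exp e) powr s * \<nu> L"
proof -
  obtain m where m: "\<And>I J \<omega>. I \<frown> J \<frown> \<omega> \<in> T \<Longrightarrow> m \<le> length J \<Longrightarrow>
    \<bar>ln (r J / r (I @ J)) - bsum f1t I (J \<frown> \<omega>)\<bar> \<le> e / 2"
    using ln_ratio_bsum[of "e / 2"] e by auto
  have "(r (I @ L) / r L * exp (- e)) powr s * \<nu> L \<le> \<nu> (I @ L) \<and>
    \<nu> (I @ L) \<le> (r (I @ L) / r L * exp e) powr s * \<nu> L"
    if IL: "I @ L \<in> tstar T" "Suc m \<le> length L" for I L
  proof (rule nu_scale[OF IL(1)])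
    have L: "L \<in> tstar T" using IL tstar_append_D by blast
    show "L \<noteq> []" using IL by auto
    show "0 < r (I @ L) / r L * exp (- e)" using r_pos IL L by simp
    fix w assume w: "w \<in> tstar T" "prefix L w"
    then obtain Y where Y: "w = L @ Y" by (auto elim: prefixE)
    have "I @ w \<in> tstar T" using tstar_glue[OF IL(1) \<open>L \<noteq> []\<close>] w by (simp add: Y)
    then obtain \<omega> where "(I @ w) \<frown> \<omega> \<in> T" using tstar_iff by blast
    then have \<omega>: "I \<frown> L \<frown> Y \<frown> \<omega> \<in> T" by (simp add: Y)
    have "\<bar>ln (r L / r (I @ L)) - bsum f1t I (L \<frown> Y \<frown> \<omega>)\<bar> \<le> e / 2"
      by (rule m[OF \<omega>]) (use IL in simp)
    moreover have "\<bar>ln (r w / r (I @ w)) - bsum f1t I (L \<frown> Y \<frown> \<omega>)\<bar> \<le> e / 2"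
      using m[of I w \<omega>] \<omega> IL by (simp add: Y)
    ultimately have *: "\<bar>ln (r w / r (I @ w)) - ln (r L / r (I @ L))\<bar> \<le> e" by linarith
    have pos: "0 < r w" "0 < r (I @ w)" "0 < r L" "0 < r (I @ L)"
      using r_pos w L IL \<open>I @ w \<in> tstar T\<close> by auto
    have "ln (r (I @ L) / r L * exp (- e) * r w) \<le> ln (r (I @ w))"
      "ln (r (I @ w)) \<le> ln (r (I @ L) / r L * exp e * r w)"
      using * pos by (auto simp add: ln_div ln_mult)
    then show "r (I @ L) / r L * exp (- e) * r w \<le> r (I @ w) \<and> r (I @ w) \<le> r (I @ L) / r L * exp e * r w"
      using pos by simp
  qed
  then show ?thesis by blast
qed

text \<open>By (M3) the radii decay at least like \<open>R ^ length I\<close>. The first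
  \<open>m\<close> letters \<open>J\<close> of the tail are included because radii and Birkhoff sums
  are compared in front of a long word; this costs the constant
  \<open>m * ln \<rho>\<close>.\<close>

lemma bsum_growth:
  "\<exists>c>0. \<exists>d. \<forall>I \<omega>. I \<frown> \<omega> \<in> T \<longrightarrow> c * real (length I) - d \<le> bsum f1t I \<omega>"
proof -
  obtain m where m: "\<And>I J \<omega>. I \<frown> J \<frown> \<omega> \<in> T \<Longrightarrow> m \<le> length J \<Longrightarrow>
    \<bar>ln (r J / r (I @ J)) - bsum f1t I (J \<frown> \<omega>)\<bar> \<le> 1"
    using ln_ratio_bsum[of 1] by auto
  have "- ln R * real (length I) - (1 - m * ln \<rho>) \<le> bsum f1t I \<omega>" if T: "I \<frown> \<omega> \<in> T" for I \<omega>
  proof -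
    define J where "J = pre \<omega> m"
    have lenJ: "length J = m" by (simp add: J_def)
    obtain \<tau> where \<tau>: "\<omega> = J \<frown> \<tau>" using wcat_pre unfolding J_def by metis
    have IJ: "I @ J \<in> tstar T" using T unfolding tstar_iff \<tau> by (intro exI[of _ \<tau>]) simp
    then have J: "J \<in> tstar T" using tstar_append_D by blast
    have pos: "0 < r []" "0 < r J" "0 < r (I @ J)" using r_pos Nil_in_tstar J IJ by auto
    have "\<rho> ^ m * r [] \<le> r J" using r_lower[of "[]" J] J by (simp add: J_def)
    then have 1: "m * ln \<rho> + ln (r []) \<le> ln (r J)"
      using rho_pos pos ln_le_cancel_iff[of "\<rho> ^ m * r []" "r J"] by (simp add: ln_mult ln_realpow)
    have "r (I @ J) \<le> R ^ length (I @ J) * r []" using r_upper[of "[]" "I @ J"] IJ by simp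
    also have "\<dots> \<le> R ^ length I * r []"
      using R pos by (intro mult_right_mono power_decreasing) auto
    finally have 2: "ln (r (I @ J)) \<le> length I * ln R + ln (r [])"
      using R pos ln_le_cancel_iff[of "r (I @ J)" "R ^ length I * r []"] by (simp add: ln_mult ln_realpow)
    have "\<bar>ln (r J / r (I @ J)) - bsum f1t I \<omega>\<bar> \<le> 1"
      using m[of I J \<tau>] T unfolding \<tau> by (simp add: lenJ)
    moreover have "ln (r J / r (I @ J)) = ln (r J) - ln (r (I @ J))" using pos by (simp add: ln_div)
    ultimately show ?thesis using 1 2 by (simp add: algebra_simps)
  qed
  moreover have "0 < - ln R" using R by simp
  ultimately show ?thesis by blast
qed

lemma ratio_dense:
  assumes nonlattice: "\<not> lattice_fun T f1t" and e: "0 < e" and Q: "Q \<in> tstar T" and \<omega>: "\<omega> \<in> T"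
  shows "\<exists>T0. \<forall>t\<ge>T0. \<exists>I. Q \<frown> I \<frown> \<omega> \<in> T \<and> \<bar>bsum f1t (Q @ I) \<omega> - t\<bar> \<le> e"
proof -
  obtain M a where pot: "sft_potential Nl A T f1t M a" using holder_constants by blast
  interpret sft_potential Nl A T f1t M a by (rule pot)
  obtain c d where "0 < c" "\<And>I \<omega>. I \<frown> \<omega> \<in> T \<Longrightarrow> c * real (length I) - d \<le> bsum f1t I \<omega>"
    using bsum_growth by blast
  then show ?thesis
    using bsum_asymptotically_dense[OF _ _ _ e Q \<omega>] lattice_if_increments nonlattice by blast
qed

end

subsection \<open>The renewal argument\<close>

lemma finite_uniform_bound:
  fixes P :: "'b \<Rightarrow> 'c::linorder \<Rightarrow> bool"
  assumes "finite F" "\<And>z. z \<in> F \<Longrightarrow> \<exists>n. P z n" "\<And>z n m. P z n \<Longrightarrow> n \<le> m \<Longrightarrow> P z m"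
  shows "\<exists>n. \<forall>z\<in>F. P z n"
  using assms(1,2)
proof (induction F)
  case (insert z F)
  obtain n where n: "\<forall>z\<in>F. P z n" using insert by blast
  obtain m where m: "P z m" using insert.prems by blast
  have "\<forall>z'\<in>insert z F. P z' (max m n)"
    using n m assms(3) by (metis insert_iff max.cobounded1 max.cobounded2)
  then show ?case by blast
qed simp

locale renewal_tree = conformal_ifs +
  assumes nonlattice: "\<not> lattice_fun T f1t"
begin

definition v :: "nat list \<Rightarrow> real \<Rightarrow> real" where
  "v J t = exp (- s * t) * cnt J t / \<nu> J"

lemma cnt_eq: "J \<in> tstar T \<Longrightarrow> cnt J t = exp (s * t) * \<nu> J * v J t"
  using nu_pos[of J] by (simp add: v_def exp_minus)

lemma v_nonneg: "J \<in> tstar T \<Longrightarrow> 0 \<le> v J t"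
  using nu_pos[of J] cnt_nonneg[of J t] by (simp add: v_def)

text \<open>Counts grow with time, so \<open>v\<close> can lose at most the factor from its
  normalisation. Timing errors thus turn into small multiplicative errors.\<close>

lemma v_mono:
  assumes J: "J \<in> tstar T" and t: "t \<le> u" shows "exp (- s * (u - t)) * v J t \<le> v J u"
proof -
  have "exp (- s * (u - t)) * exp (- s * t) = exp (- s * u)"
    unfolding exp_add[symmetric] by (simp add: algebra_simps)
  then have "exp (- s * (u - t)) * v J t = exp (- s * u) * cnt J t / \<nu> J"
    by (simp add: v_def mult.assoc[symmetric])
  also have "\<dots> \<le> exp (- s * u) * cnt J u / \<nu> J"
    using cnt_mono[OF t] nu_pos[OF J] by (intro divide_right_mono mult_left_mono) auto
  finally show ?thesis by (simp add: v_def)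
qed

lemma v_upper: "\<exists>c. \<forall>J\<in>tstar T. \<forall>\<^sub>F t in at_top. v J t \<le> c"
proof -
  obtain c where c: "\<And>I eps. I \<in> tstar T \<Longrightarrow> 0 < eps \<Longrightarrow> eps \<le> r I \<Longrightarrow> N eps (K I) \<le> c * eps powr (- s) * \<nu> I"
    using N_upper by blast
  have "\<forall>\<^sub>F t in at_top. v J t \<le> c" if J: "J \<in> tstar T" for J
    using eventually_ge_at_top[of "- ln (r J)"]
  proof eventually_elim
    case (elim t)
    then have "exp (- t) \<le> r J" using r_pos[OF J] by (metis exp_le_cancel_iff exp_ln minus_le_iff)
    then have "cnt J t \<le> c * exp (s * t) * \<nu> J"
      using c[OF J, of "exp (- t)"] by (simp add: cnt_def exp_powr_real mult.commute)
    then have "exp (s * t) * \<nu> J * v J t \<le> exp (s * t) * \<nu> J * c"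
      unfolding cnt_eq[OF J] by (simp add: algebra_simps)
    then show ?case using nu_pos[OF J] by simp
  qed
  then show ?thesis by blast
qed

lemma v_lower: "\<exists>c>0. \<forall>\<^sub>F t in at_top. c \<le> v [] t"
proof -
  obtain c q where c: "0 < c" "0 < q" "\<And>I eps. I \<in> tstar T \<Longrightarrow> 0 < eps \<Longrightarrow> eps \<le> q * r I \<Longrightarrow>
      c * eps powr (- s) * \<nu> I \<le> N eps (K I)" using N_lower by blast
  have "\<forall>\<^sub>F t in at_top. c \<le> v [] t"
    using eventually_ge_at_top[of "- ln (q * r [])"]
  proof eventually_elim
    case (elim t)
    have "0 < q * r []" using r_pos[OF Nil_in_tstar] c by simp
    then have "exp (- t) \<le> q * r []" using elim by (metis exp_le_cancel_iff exp_ln minus_le_iff)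
    then have "c * exp (s * t) * \<nu> [] \<le> cnt [] t"
      using c(3)[OF Nil_in_tstar, of "exp (- t)"] by (simp add: cnt_def exp_powr_real mult.commute)
    then have "exp (s * t) * \<nu> [] * c \<le> exp (s * t) * \<nu> [] * v [] t"
      unfolding cnt_eq[OF Nil_in_tstar] by (simp add: algebra_simps)
    then show ?case using nu_pos[OF Nil_in_tstar] by simp
  qed
  then show ?thesis using c(1) by blast
qed

lemma v_average:
  assumes J: "J \<in> tstar T" and n: "length J \<le> n"
  shows "\<nu> J * v J t \<le> (\<Sum>w\<in>Lev n J. \<nu> w * v w t)"
proof -
  have "cnt J t \<le> N (exp (- t)) (\<Union>w\<in>Lev n J. K w)"
    unfolding cnt_def using K_cover_Lev[OF n] by (intro N_mono compact_K compact_UN) auto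
  also have "\<dots> \<le> (\<Sum>w\<in>Lev n J. cnt w t)"
    unfolding cnt_def by (intro N_UN compact_K) auto
  also have "\<dots> = (\<Sum>w\<in>Lev n J. exp (s * t) * (\<nu> w * v w t))"
    by (rule sum.cong) (auto simp: Lev_def cnt_eq)
  also have "\<dots> = exp (s * t) * (\<Sum>w\<in>Lev n J. \<nu> w * v w t)" by (simp add: sum_distrib_left)
  finally have "exp (s * t) * (\<nu> J * v J t) \<le> exp (s * t) * (\<Sum>w\<in>Lev n J. \<nu> w * v w t)"
    by (simp add: cnt_eq[OF J] mult.assoc)
  then show ?thesis by simp
qed

text \<open>Half of the exponent \<open>2 * s * e\<close> comes from the time shift in
  \<open>cnt_scale\<close>, the other half from the mass quotient in
  \<open>nu_ratio\<close>.\<close>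

lemma v_scale:
  assumes e: "0 < e"
  shows "\<exists>m. \<forall>I L t. I @ L \<in> tstar T \<and> m \<le> length L \<and> exp (- t) \<le> r (I @ L) * W * \<xi> * exp (- e) \<longrightarrow>
    exp (- 2 * s * e) * v (I @ L) t \<le> v L (t + ln (r (I @ L) / r L) + e) \<and>
    exp (- 2 * s * e) * v L (t + ln (r (I @ L) / r L) - e) \<le> v (I @ L) t"
proof -
  obtain m1 where m1: "\<And>I J t. I @ J \<in> tstar T \<Longrightarrow> m1 \<le> length J \<Longrightarrow> exp (- t) \<le> r (I @ J) * W * \<xi> * exp (- e) \<Longrightarrow>
    cnt (I @ J) t \<le> cnt J (t + ln (r (I @ J) / r J) + e) \<and>
    cnt J (t + ln (r (I @ J) / r J) - e) \<le> cnt (I @ J) t" using cnt_scale[OF e] by blast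
  obtain m2 where m2: "\<And>I L. I @ L \<in> tstar T \<Longrightarrow> m2 \<le> length L \<Longrightarrow>
    (r (I @ L) / r L * exp (- e)) powr s * \<nu> L \<le> \<nu> (I @ L) \<and>
    \<nu> (I @ L) \<le> (r (I @ L) / r L * exp e) powr s * \<nu> L" using nu_ratio[OF e] by blast
  have "exp (- 2 * s * e) * v (I @ L) t \<le> v L (t + ln (r (I @ L) / r L) + e) \<and>
    exp (- 2 * s * e) * v L (t + ln (r (I @ L) / r L) - e) \<le> v (I @ L) t"
    if IL: "I @ L \<in> tstar T" "max m1 m2 \<le> length L" and t: "exp (- t) \<le> r (I @ L) * W * \<xi> * exp (- e)" for I L t
  proof -
    have L: "L \<in> tstar T" using IL tstar_append_D by blast
    have pos: "0 < r (I @ L) / r L" using r_pos L IL by simp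
    define l where "l = ln (r (I @ L) / r L)"
    have ratio: "r (I @ L) / r L = exp l" using pos by (simp add: l_def)
    have nu: "exp (s * (l - e)) * \<nu> L \<le> \<nu> (I @ L)" "\<nu> (I @ L) \<le> exp (s * (l + e)) * \<nu> L"
      using m2[OF IL(1)] IL(2) unfolding ratio exp_add[symmetric]
      by (simp_all add: exp_powr_real mult.commute)
    have cnt: "cnt (I @ L) t \<le> cnt L (t + l + e)" "cnt L (t + l - e) \<le> cnt (I @ L) t"
      using m1[OF IL(1) _ t] IL(2) by (auto simp: l_def)
    have "exp (s * t) * (exp (s * (l - e)) * \<nu> L) * v (I @ L) t \<le> exp (s * t) * \<nu> (I @ L) * v (I @ L) t"
      using nu v_nonneg[OF IL(1)] by (intro mult_right_mono mult_left_mono) auto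
    also have "\<dots> \<le> exp (s * (t + l + e)) * \<nu> L * v L (t + l + e)"
      using cnt(1) by (simp add: cnt_eq[OF IL(1)] cnt_eq[OF L])
    finally have "\<nu> L * ((exp (s * t) * exp (s * (l - e))) * v (I @ L) t) \<le> \<nu> L * (exp (s * (t + l + e)) * v L (t + l + e))"
      by (simp add: mult_ac)
    then have "(exp (s * t) * exp (s * (l - e))) * v (I @ L) t \<le> exp (s * (t + l + e)) * v L (t + l + e)"
      using nu_pos[OF L] by simp
    moreover have "(exp (s * t) * exp (s * (l - e))) = exp (s * (t + l + e)) * exp (- 2 * s * e)"
      unfolding exp_add[symmetric] by (simp add: algebra_simps)
    ultimately have 1: "exp (- 2 * s * e) * v (I @ L) t \<le> v L (t + l + e)" by (simp add: mult.assoc)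
    have "exp (s * (t + l - e)) * \<nu> L * v L (t + l - e) \<le> exp (s * t) * \<nu> (I @ L) * v (I @ L) t"
      using cnt(2) by (simp add: cnt_eq[OF IL(1)] cnt_eq[OF L])
    also have "\<dots> \<le> exp (s * t) * (exp (s * (l + e)) * \<nu> L) * v (I @ L) t"
      using nu v_nonneg[OF IL(1)] by (intro mult_right_mono mult_left_mono) auto
    finally have "\<nu> L * (exp (s * (t + l - e)) * v L (t + l - e)) \<le> \<nu> L * ((exp (s * t) * exp (s * (l + e))) * v (I @ L) t)"
      by (simp add: mult_ac)
    then have "exp (s * (t + l - e)) * v L (t + l - e) \<le> (exp (s * t) * exp (s * (l + e))) * v (I @ L) t"
      using nu_pos[OF L] by simp
    moreover have "exp (s * (t + l - e)) = (exp (s * t) * exp (s * (l + e))) * exp (- 2 * s * e)"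
      unfolding exp_add[symmetric] by (simp add: algebra_simps)
    ultimately have "exp (- 2 * s * e) * v L (t + l - e) \<le> v (I @ L) t" by (simp add: mult.assoc)
    with 1 show ?thesis by (simp add: l_def)
  qed
  then show ?thesis by (intro exI[of _ "max m1 m2"]) blast
qed

text \<open>The supremum of \<open>limsup v J\<close> over all words, with the upper limit expressed
  by values reached at arbitrarily late times.\<close>

definition vsup :: real where
  "vsup = Sup {c. \<exists>J\<in>tstar T. \<exists>\<^sub>F t in at_top. c \<le> v J t}"

lemma bdd_vsup: "bdd_above {c. \<exists>J\<in>tstar T. \<exists>\<^sub>F t in at_top. c \<le> v J t}"
proof -
  obtain c where c: "\<forall>J\<in>tstar T. \<forall>\<^sub>F t in at_top. v J t \<le> c" using v_upper by blast
  have "b \<le> c" if freq: "\<exists>\<^sub>F t in at_top. b \<le> v J t" and J: "J \<in> tstar T" for b J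
  proof -
    have "\<exists>\<^sub>F t in at_top. b \<le> v J t \<and> v J t \<le> c"
      by (rule frequently_eventually_frequently[OF freq]) (use c J in blast)
    then show ?thesis using frequently_ex by fastforce
  qed
  then show ?thesis by (intro bdd_aboveI[of _ c]) blast
qed

lemma vsup_ge: "J \<in> tstar T \<Longrightarrow> \<exists>\<^sub>F t in at_top. c \<le> v J t \<Longrightarrow> c \<le> vsup"
  unfolding vsup_def by (rule cSup_upper[OF _ bdd_vsup]) blast

lemma vsup_pos: "0 < vsup"
proof -
  obtain c where c: "0 < c" "\<forall>\<^sub>F t in at_top. c \<le> v [] t" using v_lower by blast
  then have "\<exists>\<^sub>F t in at_top. c \<le> v [] t" by (intro eventually_frequently) auto
  then show ?thesis using vsup_ge[OF Nil_in_tstar] c by fastforce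
qed

lemma eventually_le_vsup: "J \<in> tstar T \<Longrightarrow> 0 < \<eta> \<Longrightarrow> \<forall>\<^sub>F t in at_top. v J t \<le> vsup + \<eta>"
proof (rule ccontr)
  assume J: "J \<in> tstar T" "0 < \<eta>" "\<not> (\<forall>\<^sub>F t in at_top. v J t \<le> vsup + \<eta>)"
  have "\<exists>\<^sub>F t in at_top. vsup + \<eta> \<le> v J t"
    by (rule frequently_mono[OF _ J(3)[unfolded not_eventually]]) auto
  then show False using vsup_ge[OF J(1)] J(2) by fastforce
qed

lemma frequently_near_vsup: "0 < \<eta> \<Longrightarrow> \<exists>J\<in>tstar T. \<exists>\<^sub>F t in at_top. vsup - \<eta> \<le> v J t"
proof -
  assume \<eta>: "0 < \<eta>"
  let ?S = "{c. \<exists>J\<in>tstar T. \<exists>\<^sub>F t in at_top. c \<le> v J t}"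
  have "\<exists>\<^sub>F t in at_top. 0 \<le> v [] t" using v_nonneg[OF Nil_in_tstar] by simp
  then have ne: "?S \<noteq> {}" using Nil_in_tstar by blast
  have "vsup - \<eta> < Sup ?S" using \<eta> by (simp add: vsup_def)
  then obtain c where c: "c \<in> ?S" "vsup - \<eta> < c" using less_cSupE[OF _ ne] by blast
  then obtain J where J: "J \<in> tstar T" "\<exists>\<^sub>F t in at_top. c \<le> v J t" by blast
  have "\<exists>\<^sub>F t in at_top. vsup - \<eta> \<le> v J t"
    by (rule frequently_mono[OF _ J(2)]) (use c(2) in auto)
  then show ?thesis using J(1) by blast
qed

lemma nu_ext_lower:
  assumes w: "w \<in> tstar T" "prefix J w" "length w \<le> length J + n"
  shows "(\<rho> ^ n) powr s / (E * E) * \<nu> J \<le> \<nu> w"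
proof -
  obtain Y where Y: "w = J @ Y" "length Y \<le> n" using w by (auto elim: prefixE)
  have J: "J \<in> tstar T" using w tstar_prefix by blast
  have "\<rho> ^ n * r J \<le> \<rho> ^ length Y * r J"
    using Y rho_pos rho_le_R R r_pos[OF J] by (intro mult_right_mono power_decreasing) auto
  also have "\<dots> \<le> r w" using r_lower[of J Y] w Y by simp
  finally have r: "\<rho> ^ n * r J \<le> r w" .
  have "(\<rho> ^ n) powr s / (E * E) * \<nu> J \<le> (\<rho> ^ n) powr s / (E * E) * (E * r J powr s)"
    using nu_upper[OF J] by (intro mult_left_mono) auto
  also have "\<dots> = (\<rho> ^ n * r J) powr s / E" using rho_pos r_pos[OF J] E_pos by (simp add: powr_mult)
  also have "\<dots> \<le> r w powr s / E"
    using r s_nonneg rho_pos r_pos[OF J] E_pos by (intro divide_right_mono powr_mono2) auto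
  also have "\<dots> \<le> \<nu> w" by (rule nu_lower[OF w(1)])
  finally show ?thesis .
qed

lemma finite_extensions: "finite {w \<in> tstar T. prefix J w \<and> length w \<le> n}"
  by (rule finite_subset[OF _ finite_tstar_length_le[of n]]) auto

text \<open>Maximum principle: a weighted mean which nearly attains the supremum forces all its terms to
  do so.\<close>

lemma spread:
  assumes \<eta>: "0 < \<eta>"
  shows "\<exists>J\<in>tstar T. \<exists>\<^sub>F t in at_top. \<forall>w\<in>tstar T. prefix J w \<and> length w \<le> length J + n \<longrightarrow> vsup - \<eta> \<le> v w t"
proof -
  define c where "c = (\<rho> ^ n) powr s / (E * E)"
  have c: "0 < c" using rho_pos E_pos by (simp add: c_def)
  \<comment> \<open>A deficit \<open>h\<close> at \<open>J\<close> and an excess of at most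
    \<open>h\<close> in the other terms leave a total of \<open>2 * h * \<nu> J\<close>, which is at
    most \<open>\<eta> * \<nu> w\<close> because \<open>w\<close> has at least the share
    \<open>c\<close> of the mass.\<close>
  define h where "h = c * \<eta> / 2"
  have h: "0 < h" using c \<eta> by (simp add: h_def)
  obtain J where J: "J \<in> tstar T" "\<exists>\<^sub>F t in at_top. vsup - h \<le> v J t"
    using frequently_near_vsup[OF h] by blast
  have "\<forall>\<^sub>F t in at_top. \<forall>w\<in>{w \<in> tstar T. prefix J w \<and> length w \<le> length J + n}. v w t \<le> vsup + h"
    by (intro eventually_ball_finite finite_extensions) (use eventually_le_vsup[OF _ h] in auto)
  from frequently_eventually_frequently[OF J(2) this]
  have "\<exists>\<^sub>F t in at_top. \<forall>w\<in>tstar T. prefix J w \<and> length w \<le> length J + n \<longrightarrow> vsup - \<eta> \<le> v w t"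
  proof (rule frequently_mono[rotated], intro allI impI ballI, elim conjE)
    fix t w
    assume t: "vsup - h \<le> v J t" "\<forall>w\<in>{w \<in> tstar T. prefix J w \<and> length w \<le> length J + n}. v w t \<le> vsup + h"
      and w: "w \<in> tstar T" "prefix J w" "length w \<le> length J + n"
    have lw: "length J \<le> length w" using prefix_length_le[OF w(2)] .
    have wL: "w \<in> Lev (length w) J" using w by (simp add: Lev_def)
    have "\<nu> J * (vsup - h) \<le> \<nu> J * v J t" using t(1) nu_pos[OF J(1)] by (intro mult_left_mono) auto
    also have "\<dots> \<le> (\<Sum>u\<in>Lev (length w) J. \<nu> u * v u t)" by (rule v_average[OF J(1) lw])
    also have "\<dots> = \<nu> w * v w t + (\<Sum>u\<in>Lev (length w) J - {w}. \<nu> u * v u t)"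
      using wL by (simp add: sum.remove)
    also have "(\<Sum>u\<in>Lev (length w) J - {w}. \<nu> u * v u t) \<le> (\<Sum>u\<in>Lev (length w) J - {w}. \<nu> u * (vsup + h))"
      by (intro sum_mono mult_left_mono) (use t(2) w nu_pos in \<open>auto simp: Lev_def less_imp_le\<close>)
    also have "\<dots> = (\<nu> J - \<nu> w) * (vsup + h)"
      using nu_Lev[OF J(1), of "length w - length J"] lw wL
      by (simp add: sum_distrib_right[symmetric] sum_diff1)
    finally have "\<nu> w * (vsup + h) - 2 * h * \<nu> J \<le> \<nu> w * v w t" by (simp add: algebra_simps)
    moreover have "2 * h * \<nu> J \<le> \<eta> * \<nu> w"
    proof -
      have "2 * h * \<nu> J = \<eta> * (c * \<nu> J)" by (simp add: h_def)
      also have "\<dots> \<le> \<eta> * \<nu> w"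
        using nu_ext_lower[OF w] \<eta> by (intro mult_left_mono) (auto simp: c_def)
      finally show ?thesis .
    qed
    ultimately have "\<nu> w * (vsup + h - \<eta>) \<le> \<nu> w * v w t" by (simp add: algebra_simps)
    then show "vsup - \<eta> \<le> v w t" using nu_pos[OF w(1)] h by simp
  qed
  then show ?thesis using J(1) by blast
qed

end

section \<open>Propagation of near maxima\<close>

context renewal_tree
begin

text \<open>Shifting the time of a near maximum by the lengths of all paths leading to \<open>L\<close>
  gives, by density of these lengths, near maxima at \<open>L\<close> throughout a window of prescribed length.\<close>

lemma window:
  assumes e: "0 < e"
  shows "\<exists>k0. \<forall>k\<ge>k0. \<forall>w \<eta> \<tau>0. 0 < \<eta> \<and> \<eta> < vsup \<longrightarrow> (\<exists>\<tau>\<ge>\<tau>0. \<forall>L\<in>tstar T. length L = k \<longrightarrow>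
    (\<forall>t. \<tau> \<le> t \<and> t \<le> \<tau> + w \<longrightarrow> exp (- 10 * s * e) * (vsup - \<eta>) \<le> v L t))"
proof -
  obtain m1 where m1: "\<And>I L t. I @ L \<in> tstar T \<Longrightarrow> m1 \<le> length L \<Longrightarrow> exp (- t) \<le> r (I @ L) * W * \<xi> * exp (- e) \<Longrightarrow>
    exp (- 2 * s * e) * v (I @ L) t \<le> v L (t + ln (r (I @ L) / r L) + e)" using v_scale[OF e] by blast
  obtain m2 where m2: "\<And>I J \<omega>. I \<frown> J \<frown> \<omega> \<in> T \<Longrightarrow> m2 \<le> length J \<Longrightarrow>
    \<bar>ln (r J / r (I @ J)) - bsum f1t I (J \<frown> \<omega>)\<bar> \<le> e" using ln_ratio_bsum[OF e] by blast
  have "\<exists>\<tau>\<ge>\<tau>0. \<forall>L\<in>tstar T. length L = k \<longrightarrow>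
    (\<forall>t. \<tau> \<le> t \<and> t \<le> \<tau> + w \<longrightarrow> exp (- 10 * s * e) * (vsup - \<eta>) \<le> v L t)"
    if k: "Suc (max m1 m2) \<le> k" and \<eta>: "0 < \<eta>" "\<eta> < vsup" for k w \<eta> \<tau>0
  proof -
    define La where "La = {L \<in> tstar T. length L = k}"
    have finLa: "finite La" unfolding La_def by (rule finite_tstar_length)
    have "\<forall>L. \<exists>\<omega>. L \<in> tstar T \<longrightarrow> L \<frown> \<omega> \<in> T" using tstar_iff by blast
    then obtain o' where o': "\<And>L. L \<in> tstar T \<Longrightarrow> L \<frown> o' L \<in> T" by metis
    \<comment> \<open>\<open>spread\<close> supplies \<open>J\<close> only after the number of
      levels is fixed. The buffer \<open>Q b\<close> can follow any word ending in \<open>b\<close>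
      and makes the Birkhoff sum along that word almost independent of what comes next, so the paths
      from \<open>Q b\<close> to \<open>L\<close> can be chosen before \<open>J\<close>.\<close>
    have "\<exists>Q. [b] @ Q \<in> tstar T \<and> length Q = k" if bN: "b < Nl" for b
    proof -
      obtain u where "u \<in> Lev (Suc k) [b]"
        using tstar_extend[OF letter_in_tstar[OF bN], of "Suc k"] by auto
      then show ?thesis by (auto simp: Lev_def prefix_def)
    qed
    then obtain Q where Q: "\<And>b. b < Nl \<Longrightarrow> [b] @ Q b \<in> tstar T \<and> length (Q b) = k" by metis
    have Qt: "Q b \<in> tstar T" if "b < Nl" for b using Q[OF that] tstar_append_D by blast
    let ?F = "{..<Nl} \<times> La"
    have finF: "finite ?F" using finLa by simp
    obtain Tm where Tm: "\<forall>(b, L)\<in>?F. \<forall>t\<ge>Tm. \<exists>I. Q b \<frown> I \<frown> L \<frown> o' L \<in> T \<and> \<bar>bsum f1t (Q b @ I) (L \<frown> o' L) - t\<bar> \<le> e"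
    proof -
      have "\<exists>Tm. \<forall>z\<in>?F. \<forall>t\<ge>Tm. \<exists>I. Q (fst z) \<frown> I \<frown> snd z \<frown> o' (snd z) \<in> T \<and>
          \<bar>bsum f1t (Q (fst z) @ I) (snd z \<frown> o' (snd z)) - t\<bar> \<le> e"
      proof (rule finite_uniform_bound[OF finF])
        fix z assume "z \<in> ?F"
        then have "Q (fst z) \<in> tstar T" "snd z \<frown> o' (snd z) \<in> T" using Qt o' by (auto simp: La_def)
        from ratio_dense[OF nonlattice e this]
        show "\<exists>Tm. \<forall>t\<ge>Tm. \<exists>I. Q (fst z) \<frown> I \<frown> snd z \<frown> o' (snd z) \<in> T \<and>
          \<bar>bsum f1t (Q (fst z) @ I) (snd z \<frown> o' (snd z)) - t\<bar> \<le> e" .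
      qed (meson order_trans)
      then show thesis using that by (auto simp: case_prod_beta)
    qed
    \<comment> \<open>A grid of mesh \<open>e\<close> replaces the window by finitely many target
      values, which bounds the lengths of all paths.\<close>
    define n where "n = nat \<lceil>w / e\<rceil>"
    obtain len where len: "\<And>b L j. b < Nl \<Longrightarrow> L \<in> La \<Longrightarrow> j \<le> n \<Longrightarrow> \<exists>I. length I \<le> len \<and>
        Q b \<frown> I \<frown> L \<frown> o' L \<in> T \<and> \<bar>bsum f1t (Q b @ I) (L \<frown> o' L) - (Tm + real j * e)\<bar> \<le> e"
    proof -
      have "\<exists>len. \<forall>z\<in>?F \<times> {..n}. \<exists>I. length I \<le> len \<and>
        Q (fst (fst z)) \<frown> I \<frown> snd (fst z) \<frown> o' (snd (fst z)) \<in> T \<and>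
        \<bar>bsum f1t (Q (fst (fst z)) @ I) (snd (fst z) \<frown> o' (snd (fst z))) - (Tm + real (snd z) * e)\<bar> \<le> e"
      proof (rule finite_uniform_bound)
        fix z assume "z \<in> ?F \<times> {..n}"
        then obtain b L j where z: "z = ((b, L), j)" "(b, L) \<in> ?F" by auto
        have "Tm \<le> Tm + real j * e" using e by simp
        with Tm z(2) obtain I where "Q b \<frown> I \<frown> L \<frown> o' L \<in> T \<and> \<bar>bsum f1t (Q b @ I) (L \<frown> o' L) - (Tm + real j * e)\<bar> \<le> e"
          by blast
        then show "\<exists>len. \<exists>I. length I \<le> len \<and>
          Q (fst (fst z)) \<frown> I \<frown> snd (fst z) \<frown> o' (snd (fst z)) \<in> T \<and>
          \<bar>bsum f1t (Q (fst (fst z)) @ I) (snd (fst z) \<frown> o' (snd (fst z))) - (Tm + real (snd z) * e)\<bar> \<le> e"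
          by (auto simp: z)
      qed (use finF in \<open>auto intro: order_trans\<close>)
      then show thesis using that by fastforce
    qed
    have path: "\<exists>I. length I \<le> len \<and> Q b \<frown> I \<frown> L \<frown> o' L \<in> T \<and> \<bar>bsum f1t (Q b @ I) (L \<frown> o' L) - t\<bar> \<le> 2 * e"
      if bL: "b < Nl" "L \<in> La" and t: "Tm \<le> t" "t \<le> Tm + w" for b L t
    proof -
      define j where "j = nat \<lfloor>(t - Tm) / e\<rfloor>"
      have f0: "0 \<le> (t - Tm) / e" using t e by simp
      have "(t - Tm) / e \<le> w / e" using t e by (intro divide_right_mono) auto
      then have "j \<le> n" unfolding j_def n_def by (intro nat_mono) linarith
      then obtain I where I: "length I \<le> len" "Q b \<frown> I \<frown> L \<frown> o' L \<in> T"
        "\<bar>bsum f1t (Q b @ I) (L \<frown> o' L) - (Tm + real j * e)\<bar> \<le> e" using len[OF bL] by blast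
      have "real j \<le> (t - Tm) / e" "(t - Tm) / e \<le> real j + 1" using f0 unfolding j_def by linarith+
      then have "real j * e \<le> t - Tm" "t - Tm \<le> real j * e + e" using e by (simp_all add: field_simps)
      then have "\<bar>bsum f1t (Q b @ I) (L \<frown> o' L) - t\<bar> \<le> 2 * e" using I(3) by linarith
      then show ?thesis using I by blast
    qed
    \<comment> \<open>Letters of the buffer, the path and the tail.\<close>
    define nmax where "nmax = k + len + k"
    obtain J where J: "J \<in> tstar T" "\<exists>\<^sub>F t in at_top. \<forall>u\<in>tstar T. prefix J u \<and> length u \<le> length J + nmax \<longrightarrow> vsup - \<eta> \<le> v u t"
      using spread[OF \<eta>(1), of nmax] by blast
    obtain b where b: "b < Nl" "J @ Q b \<in> tstar T"
    proof (cases "J = []")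
      case True
      then show ?thesis using that[of 0] Qt[of 0] Nl2 by auto
    next
      case False
      then have Jb: "J = butlast J @ [last J]" by simp
      then have lt: "last J < Nl" using tstar_letters[OF J(1)] False last_in_set by blast
      have "butlast J @ [last J] @ Q (last J) \<in> tstar T"
        by (rule tstar_glue) (use J(1) Jb Q[OF lt] in auto)
      then have "J @ Q (last J) \<in> tstar T" using Jb by (metis append_assoc)
      then show ?thesis using that lt by blast
    qed
    define c0 where "c0 = ln (r (Q b) / r (J @ Q b))"
    define B where "B = \<rho> ^ nmax * r J * W * \<xi> * exp (- e)"
    have B: "0 < B" using rho_pos r_pos[OF J(1)] W_pos xi_pos by (simp add: B_def)
    have "\<forall>\<^sub>F t in at_top. - ln B \<le> t \<and> \<tau>0 + c0 - 5 * e + Tm + w \<le> t"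
      by (intro eventually_conj eventually_ge_at_top)
    from frequently_ex[OF frequently_eventually_frequently[OF J(2) this]]
    obtain t0 where t0: "\<And>u. u \<in> tstar T \<Longrightarrow> prefix J u \<Longrightarrow> length u \<le> length J + nmax \<Longrightarrow> vsup - \<eta> \<le> v u t0"
      "- ln B \<le> t0" "\<tau>0 + c0 - 5 * e + Tm + w \<le> t0" by blast
    have tB: "exp (- t0) \<le> B" using t0(2) B by (metis exp_le_cancel_iff exp_ln minus_le_iff)
    \<comment> \<open>As \<open>t\<close> runs through \<open>[\<tau>, \<tau> + w]\<close>, the
      required Birkhoff sum \<open>t0 - c0 + 5 * e - t\<close> runs through
      \<open>[Tm, Tm + w]\<close>. The errors add up to \<open>4 * e\<close>; the shift by
      \<open>5 * e\<close> places the time \<open>u\<close> reached at \<open>L\<close> between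
      \<open>t - 8 * e\<close> and \<open>t\<close>, on the side where \<open>v_mono\<close>
      applies. Together with the loss in \<open>v_scale\<close> this gives the factor 10.\<close>
    define \<tau> where "\<tau> = t0 - c0 + 5 * e - Tm - w"
    have "exp (- 10 * s * e) * (vsup - \<eta>) \<le> v L t"
      if L: "L \<in> tstar T" "length L = k" and t: "\<tau> \<le> t" "t \<le> \<tau> + w" for L t
    proof -
      define tt where "tt = t0 - c0 + 5 * e - t"
      have "Tm \<le> tt" "tt \<le> Tm + w" using t by (auto simp: tt_def \<tau>_def)
      then obtain I where I: "length I \<le> len" "Q b \<frown> I \<frown> L \<frown> o' L \<in> T"
        "\<bar>bsum f1t (Q b @ I) (L \<frown> o' L) - tt\<bar> \<le> 2 * e"
        using path[OF b(1), of L tt] L by (auto simp: La_def)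
      have lenQ: "length (Q b) = k" using Q b by blast
      then have "Q b \<noteq> []" using k by auto
      then have full: "J \<frown> Q b \<frown> I \<frown> L \<frown> o' L \<in> T" using wcat_glue[OF b(2)] I(2) by blast
      define H where "H = J @ Q b @ I"
      have HT: "H \<frown> L \<frown> o' L \<in> T" using full by (simp add: H_def)
      then have HL: "H @ L \<in> tstar T" unfolding tstar_iff by (intro exI[of _ "o' L"]) simp
      have "length (Q b @ I @ L) \<le> nmax" using I(1) L(2) lenQ by (simp add: nmax_def)
      then have "\<rho> ^ nmax * r J \<le> \<rho> ^ length (Q b @ I @ L) * r J"
        using rho_pos rho_le_R R r_pos[OF J(1)] by (intro mult_right_mono power_decreasing) auto
      also have "\<dots> \<le> r (H @ L)" using r_lower[of J "Q b @ I @ L"] HL by (simp add: H_def)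
      finally have "B \<le> r (H @ L) * W * \<xi> * exp (- e)"
        unfolding B_def using W_pos xi_pos by (intro mult_right_mono) auto
      then have le: "exp (- t0) \<le> r (H @ L) * W * \<xi> * exp (- e)" using tB by linarith
      define u where "u = t0 + ln (r (H @ L) / r L) + e"
      have "exp (- 2 * s * e) * v (H @ L) t0 \<le> v L u"
        unfolding u_def by (rule m1[OF HL _ le]) (use L k in auto)
      moreover have "vsup - \<eta> \<le> v (H @ L) t0"
        by (rule t0(1)[OF HL]) (use I(1) L(2) lenQ in \<open>auto simp: H_def nmax_def\<close>)
      then have "exp (- 2 * s * e) * (vsup - \<eta>) \<le> exp (- 2 * s * e) * v (H @ L) t0"
        by (intro mult_left_mono) auto
      ultimately have vu: "exp (- 2 * s * e) * (vsup - \<eta>) \<le> v L u" by linarith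
      have 1: "\<bar>ln (r L / r (H @ L)) - bsum f1t H (L \<frown> o' L)\<bar> \<le> e"
        by (rule m2[OF HT]) (use L k in auto)
      have 2: "\<bar>c0 - bsum f1t J (Q b \<frown> I \<frown> L \<frown> o' L)\<bar> \<le> e"
        unfolding c0_def by (rule m2[OF full]) (use lenQ k in auto)
      have 3: "bsum f1t H (L \<frown> o' L) = bsum f1t J (Q b \<frown> I \<frown> L \<frown> o' L) + bsum f1t (Q b @ I) (L \<frown> o' L)"
        unfolding H_def by (subst bsum_append) simp
      have "ln (r (H @ L) / r L) = - ln (r L / r (H @ L))"
        using r_pos[OF HL] r_pos[OF L(1)] by (simp add: ln_div)
      then have "\<bar>u - (t - 4 * e)\<bar> \<le> 4 * e"
        using 1 2 3 I(3) unfolding u_def tt_def by linarith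
      then have u: "t - 8 * e \<le> u" "u \<le> t" by linarith+
      have "exp (- 10 * s * e) * (vsup - \<eta>) = exp (- 8 * s * e) * (exp (- 2 * s * e) * (vsup - \<eta>))"
        by (simp add: mult.assoc[symmetric] exp_add[symmetric])
      also have "\<dots> \<le> exp (- 8 * s * e) * v L u" using vu by (intro mult_left_mono) auto
      also have "\<dots> \<le> exp (- s * (t - u)) * v L u"
      proof (rule mult_right_mono[OF _ v_nonneg[OF L(1)]])
        have "s * (t - u) \<le> s * (8 * e)" using u s_nonneg by (intro mult_left_mono) auto
        then show "exp (- 8 * s * e) \<le> exp (- s * (t - u))" by (simp add: algebra_simps)
      qed
      also have "\<dots> \<le> v L t" by (rule v_mono[OF L(1) u(2)])
      finally show ?thesis .
    qed
    moreover have "\<tau>0 \<le> \<tau>" using t0(3) by (simp add: \<tau>_def)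
    ultimately show ?thesis by blast
  qed
  then show ?thesis by (intro exI[of _ "Suc (max m1 m2)"]) blast
qed

text \<open>Values near the supremum on a long window persist: at any later time, cut the tree at the
  nodes whose remaining lifetime falls into the window.\<close>

lemma forward:
  assumes e: "0 < e" "e < 1" "e < vsup"
  shows "\<forall>\<^sub>F t in at_top. (1 - e) * (exp (- 12 * s * e) * (vsup - e)) \<le> v [] t"
proof -
  obtain m1 where m1: "\<And>I L t. I @ L \<in> tstar T \<Longrightarrow> m1 \<le> length L \<Longrightarrow> exp (- t) \<le> r (I @ L) * W * \<xi> * exp (- e) \<Longrightarrow>
    exp (- 2 * s * e) * v L (t + ln (r (I @ L) / r L) - e) \<le> v (I @ L) t" using v_scale[OF e(1)] by blast
  obtain k0 where win0: "\<forall>k\<ge>k0. \<forall>w \<eta> \<tau>0. 0 < \<eta> \<and> \<eta> < vsup \<longrightarrow> (\<exists>\<tau>\<ge>\<tau>0. \<forall>L\<in>tstar T. length L = k \<longrightarrow>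
    (\<forall>t. \<tau> \<le> t \<and> t \<le> \<tau> + w \<longrightarrow> exp (- 10 * s * e) * (vsup - \<eta>) \<le> v L t))" using window[OF e(1)] ..
  have k0: "\<exists>\<tau>\<ge>\<tau>0. \<forall>L\<in>tstar T. length L = k \<longrightarrow>
    (\<forall>t. \<tau> \<le> t \<and> t \<le> \<tau> + w \<longrightarrow> exp (- 10 * s * e) * (vsup - e) \<le> v L t)" if "k0 \<le> k" for k w \<tau>0
    using win0[rule_format, OF that, of e \<tau>0 w] e by simp
  define k where "k = max m1 k0"
  have k: "m1 \<le> k" "k0 \<le> k" by (auto simp: k_def)
  obtain b2 where b2: "\<forall>L\<in>{L \<in> tstar T. length L = k}. ln (r L) \<le> b2"
    using finite_uniform_bound[OF finite_tstar_length, of k "\<lambda>L b. ln (r L) \<le> b"] by (meson order_refl order_trans)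
  obtain b1' where b1': "\<forall>L\<in>{L \<in> tstar T. length L = k}. - ln (r L) \<le> b1'"
    using finite_uniform_bound[OF finite_tstar_length, of k "\<lambda>L b. - ln (r L) \<le> b"] by (meson order_refl order_trans)
  \<comment> \<open>The time reached at the tail \<open>L\<close> of a cut word \<open>J\<close>
    depends on \<open>ln (r L)\<close>, which varies by at most \<open>b2 + b1'\<close>, and on
    \<open>ln (r J)\<close>, which varies by at most \<open>- ln \<rho>\<close> on a cut.\<close>
  define w where "w = b2 + b1' - ln \<rho>"
  obtain q where q: "0 < q" "\<forall>Z eps. finite Z \<and> Z \<subseteq> tstar T \<and> (\<forall>I\<in>Z. \<forall>J\<in>Z. I \<noteq> J \<longrightarrow> incomparable I J) \<and>
     0 < eps \<and> (\<forall>I\<in>Z. eps \<le> q * r I) \<longrightarrow> (1 - e) * (\<Sum>I\<in>Z. N eps (K I)) \<le> N eps (K [])"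
    using N_superadditive[OF e(1)] by (elim exE conjE)
  \<comment> \<open>A scale of at most \<open>h * r J\<close> is admissible both for superadditivity
    and for \<open>v_scale\<close>.\<close>
  define h where "h = min q (W * \<xi> * exp (- e))"
  have h: "0 < h" "h \<le> q" "h \<le> W * \<xi> * exp (- e)" using q W_pos xi_pos by (auto simp: h_def)
  \<comment> \<open>Starting the window this late guarantees \<open>exp (- t) \<le> h * r J\<close>
    on the cut chosen below.\<close>
  obtain \<tau> where \<tau>: "- ln h - b2 - e \<le> \<tau>" and win: "\<And>L t. L \<in> tstar T \<Longrightarrow> length L = k \<Longrightarrow> \<tau> \<le> t \<Longrightarrow> t \<le> \<tau> + w \<Longrightarrow>
      exp (- 10 * s * e) * (vsup - e) \<le> v L t" using k0[OF k(2), of "- ln h - b2 - e" w] by blast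
  have r0: "0 < r []" by (rule r_pos[OF Nil_in_tstar])
  show ?thesis
    \<comment> \<open>This threshold makes the cut radius smaller than
      \<open>\<rho> ^ k * r []\<close>, so all words of the cut have at least \<open>k\<close>
      letters.\<close>
    using eventually_gt_at_top[of "\<tau> - ln \<rho> + b2 + e - ln (\<rho> ^ k * r [])"]
  proof eventually_elim
    case (elim t)
    \<comment> \<open>The logarithm of the cut radius, chosen so that
      \<open>t + ln (r J) - ln (r L) - e\<close> falls into the window for every \<open>J\<close> in
      the cut with tail \<open>L\<close>.\<close>
    define l where "l = \<tau> - t - ln \<rho> + b2 + e"
    define \<delta> where "\<delta> = exp l"
    have \<delta>: "0 < \<delta>" by (simp add: \<delta>_def)
    have pk: "0 < \<rho> ^ k * r []" using rho_pos r0 by simp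
    have "l < ln (\<rho> ^ k * r [])" using elim by (simp add: l_def)
    then have \<delta>k: "\<delta> < \<rho> ^ k * r []" unfolding \<delta>_def using pk by (metis exp_less_cancel_iff exp_ln)
    moreover have "\<rho> ^ k * r [] \<le> r []"
      using rho_pos rho_le_R R r0 power_le_one[of \<rho> k] by simp
    ultimately have \<delta>r: "\<delta> < r []" by linarith
    let ?Z = "cut \<delta> []"
    have rJ: "ln (r J) \<le> l" "ln \<rho> + l \<le> ln (r J)" if "J \<in> ?Z" for J
    proof -
      have "0 < r J" using cut_props(1)[OF that] r_pos by blast
      then show "ln (r J) \<le> l" using cut_props(3)[OF that] unfolding \<delta>_def by (metis exp_le_cancel_iff exp_ln)
      have "ln (\<rho> * \<delta>) \<le> ln (r J)" using cut_props(4)[OF that] rho_pos \<delta> by (intro ln_mono) auto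
      then show "ln \<rho> + l \<le> ln (r J)" using rho_pos \<delta> by (simp add: ln_mult \<delta>_def)
    qed
    have et: "exp (- t) \<le> h * r J" if "J \<in> ?Z" for J
    proof -
      have "0 < r J" using cut_props(1)[OF that] r_pos by blast
      moreover have "- t \<le> ln h + ln (r J)" using rJ(2)[OF that] \<tau> by (simp add: l_def)
      ultimately show ?thesis using h(1) by (metis exp_add exp_le_cancel_iff exp_ln)
    qed
    \<comment> \<open>The factor 12 collects 10 from the window and 2 from
      \<open>v_scale\<close>.\<close>
    define c where "c = exp (- 12 * s * e) * (vsup - e)"
    have c_split: "c = exp (- 2 * s * e) * (exp (- 10 * s * e) * (vsup - e))"
      unfolding c_def by (simp add: mult.assoc[symmetric] exp_add[symmetric])
    have vJ: "c \<le> v J t" if J: "J \<in> ?Z" for J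
    proof -
      have Jt: "J \<in> tstar T" using cut_props(1)[OF J] .
      have "k \<le> length J"
      proof (rule ccontr)
        assume "\<not> k \<le> length J"
        then have "\<rho> ^ k * r [] \<le> \<rho> ^ length J * r []"
          using rho_pos rho_le_R R r0 by (intro mult_right_mono power_decreasing) auto
        also have "\<dots> \<le> r J" using r_lower[of "[]" J] Jt by simp
        also have "\<dots> \<le> \<delta>" using cut_props(3)[OF J] .
        finally show False using \<delta>k by simp
      qed
      define I where "I = take (length J - k) J"
      define L where "L = drop (length J - k) J"
      have IL: "J = I @ L" "length L = k" using \<open>k \<le> length J\<close> by (auto simp: I_def L_def)
      have Lt: "L \<in> tstar T" using Jt IL tstar_append_D by blast
      have "h * r J \<le> W * \<xi> * exp (- e) * r J"
        using h(3) r_pos[OF Jt] by (intro mult_right_mono) auto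
      then have et': "exp (- t) \<le> r (I @ L) * W * \<xi> * exp (- e)"
        using et[OF J] unfolding IL(1)[symmetric] by (simp add: algebra_simps)
      define u where "u = t + ln (r (I @ L) / r L) - e"
      have ru: "u = t + ln (r J) - ln (r L) - e"
        using r_pos[OF Jt] r_pos[OF Lt] by (simp add: u_def IL(1)[symmetric] ln_div)
      have "ln (r L) \<le> b2" "- ln (r L) \<le> b1'" using b1' b2 Lt IL(2) by auto
      then have "\<tau> \<le> u" "u \<le> \<tau> + w" using rJ[OF J] unfolding ru l_def w_def by linarith+
      then have "exp (- 10 * s * e) * (vsup - e) \<le> v L u" by (rule win[OF Lt IL(2)])
      then have "exp (- 2 * s * e) * (exp (- 10 * s * e) * (vsup - e)) \<le> exp (- 2 * s * e) * v L u"
        by (intro mult_left_mono) auto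
      also have "\<dots> \<le> v (I @ L) t" unfolding u_def
        by (rule m1[OF _ _ et']) (use Jt IL k in auto)
      finally show ?thesis unfolding c_split IL(1)[symmetric] .
    qed
    have hq: "exp (- t) \<le> q * r J" if J: "J \<in> ?Z" for J
    proof -
      have "h * r J \<le> q * r J"
        using h(2) r_pos[OF cut_props(1)[OF J]] by (intro mult_right_mono) auto
      then show ?thesis using et[OF J] by linarith
    qed
    have "exp (s * t) * \<nu> [] * c = (\<Sum>J\<in>?Z. exp (s * t) * \<nu> J * c)"
      using nu_cut[OF Nil_in_tstar \<delta> \<delta>r] by (simp add: sum_distrib_left[symmetric] sum_distrib_right[symmetric])
    also have "\<dots> \<le> (\<Sum>J\<in>?Z. cnt J t)"
    proof (rule sum_mono)
      fix J assume J: "J \<in> ?Z"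
      show "exp (s * t) * \<nu> J * c \<le> cnt J t"
        unfolding cnt_eq[OF cut_props(1)[OF J]]
        using vJ[OF J] nu_pos[OF cut_props(1)[OF J]] by (intro mult_left_mono) auto
    qed
    finally have "(1 - e) * (exp (s * t) * \<nu> [] * c) \<le> (1 - e) * (\<Sum>J\<in>?Z. cnt J t)"
      using e by (intro mult_left_mono) auto
    also have "\<dots> \<le> cnt [] t"
      unfolding cnt_def
    proof (rule q(2)[rule_format], intro conjI ballI impI)
      show "finite ?Z" by (rule finite_cut[OF \<delta>])
      show "?Z \<subseteq> tstar T" using cut_props(1) by blast
    qed (use cut_incomparable hq in auto)
    finally have "exp (s * t) * \<nu> [] * ((1 - e) * c) \<le> exp (s * t) * \<nu> [] * v [] t"
      unfolding cnt_eq[OF Nil_in_tstar] by (simp add: mult_ac)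
    then show ?case using nu_pos[OF Nil_in_tstar] by (simp add: c_def)
  qed
qed

lemma v_tendsto: "(v [] \<longlongrightarrow> vsup) at_top"
proof (rule order_tendstoI)
  fix b assume b: "b < vsup"
  have "((\<lambda>e. (1 - e) * (exp (- 12 * s * e) * (vsup - e))) \<longlongrightarrow> (1 - 0) * (exp (- 12 * s * 0) * (vsup - 0))) (at_right 0)"
    by (intro tendsto_intros)
  then have "((\<lambda>e. (1 - e) * (exp (- 12 * s * e) * (vsup - e))) \<longlongrightarrow> vsup) (at_right 0)" by simp
  from order_tendstoD(1)[OF this b]
  have "\<forall>\<^sub>F e in at_right 0. b < (1 - e) * (exp (- 12 * s * e) * (vsup - e))" .
  moreover have "\<forall>\<^sub>F e in at_right 0. e \<in> {0<..<min 1 vsup}"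
    by (rule eventually_at_right_real) (use vsup_pos in simp)
  ultimately have "\<forall>\<^sub>F e in at_right 0. b < (1 - e) * (exp (- 12 * s * e) * (vsup - e)) \<and> e \<in> {0<..<min 1 vsup}"
    by (rule eventually_conj)
  then obtain e where e: "b < (1 - e) * (exp (- 12 * s * e) * (vsup - e))" "0 < e" "e < 1" "e < vsup"
    using eventually_happens'[OF trivial_limit_at_right_real] by fastforce
  show "\<forall>\<^sub>F t in at_top. b < v [] t"
    using forward[OF e(2-4)] by (rule eventually_mono) (use e(1) in simp)
next
  fix b assume "vsup < b"
  then have "\<forall>\<^sub>F t in at_top. v [] t \<le> vsup + (b - vsup) / 2"
    by (intro eventually_le_vsup Nil_in_tstar) simp
  then show "\<forall>\<^sub>F t in at_top. v [] t < b"
    by (rule eventually_mono) (use \<open>vsup < b\<close> in \<open>simp add: field_simps\<close>)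
qed

lemma counting_limit: "((\<lambda>\<epsilon>. \<epsilon> powr s * N \<epsilon> (gen_set T x)) \<longlongrightarrow> \<nu> [] * vsup) (at_right 0)"
proof (rule Lim_transform_eventually)
  have "filterlim (\<lambda>\<epsilon>::real. - ln \<epsilon>) at_top (at_right 0)"
    using ln_at_0 by (simp add: filterlim_uminus_at_bot)
  from filterlim_compose[OF v_tendsto this]
  show "((\<lambda>\<epsilon>. \<nu> [] * v [] (- ln \<epsilon>)) \<longlongrightarrow> \<nu> [] * vsup) (at_right 0)"
    by (rule tendsto_mult_left)
  show "\<forall>\<^sub>F \<epsilon> in at_right 0. \<nu> [] * v [] (- ln \<epsilon>) = \<epsilon> powr s * N \<epsilon> (gen_set T x)"
    using eventually_at_right_less[of 0]
  proof eventually_elim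
    case (elim \<epsilon>)
    then show ?case
      using nu_pos[OF Nil_in_tstar] by (simp add: v_def cnt_def gen_set_eq powr_def)
  qed
qed

end

theorem mainTheorem10:
  fixes N :: "real \<Rightarrow> 'a::complete_space set \<Rightarrow> real"
    and G :: real
    and Nl :: nat and A :: "nat \<Rightarrow> nat \<Rightarrow> bool" and T :: "(nat \<Rightarrow> nat) set"
    and x :: "nat list \<Rightarrow> 'a" and r :: "nat list \<Rightarrow> real" and s :: real
    and \<rho> C D E :: real
    and R W \<delta>0 \<xi> :: real and \<phi> :: "nat \<Rightarrow> 'a \<Rightarrow> 'a"
    and f1t f2t :: "(nat \<Rightarrow> nat) \<Rightarrow> real"
  assumes doubling: "doubling_space TYPE('a)"
    and counting: "counting_function N G"
    \<comment> \<open>(M1)\<close>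
    and Nl: "2 \<le> Nl"
    and M1: "irreducible_mat Nl A" "aperiodic_mat Nl A" "T = sft Nl A"
    \<comment> \<open>radii\<close>
    and r_pos: "\<forall>I\<in>tstar T. 0 < r I"
    and pos_consts: "0 < \<rho>" "0 < C" "0 < D" "0 < E"
    \<comment> \<open>(T1)\<close>
    and T1: "\<forall>I\<in>tstar T. \<forall>J\<in>tstar T. incomparable I J \<longrightarrow> C * (r I + r J) \<le> dist (x I) (x J)"
    \<comment> \<open>(T2)\<close>
    and T2: "\<forall>I\<in>tstar T. \<forall>J J'. I @ J \<in> tstar T \<and> I @ J' \<in> tstar T \<longrightarrow>
               dist (x (I @ J)) (x (I @ J')) \<le> D * r I"
    \<comment> \<open>(T'3)\<close>
    and T3: "\<forall>I\<in>tstar T. \<forall>n::nat. \<forall>\<I>.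
               \<I> \<subseteq> {J \<in> tstar T. n \<le> length J} \<and>
               (\<forall>\<omega>\<in>T. \<exists>!J. J \<in> \<I> \<and> pre \<omega> (length J) = J) \<and>
               (\<exists>J\<in>\<I>. prefix I J) \<longrightarrow>
               r I powr s / E \<le> (\<Sum>J\<in>{J\<in>\<I>. prefix I J}. r J powr s) \<and>
               (\<Sum>J\<in>{J\<in>\<I>. prefix I J}. r J powr s) \<le> E * r I powr s"
    \<comment> \<open>(T4)\<close>
    and T4: "\<forall>e>0. \<exists>m. \<forall>I\<in>tstar T. m \<le> length I \<longrightarrow> r I < e"
    \<comment> \<open>(T5)\<close>
    and T5: "\<forall>I j. I @ [j] \<in> tstar T \<longrightarrow> \<rho> * r I \<le> r (I @ [j])"
    \<comment> \<open>(M2)\<close>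
    and M2: "\<forall>I\<in>tstar T. x I \<in> gen_set T x"
    \<comment> \<open>(M3)\<close>
    and M3: "0 < R" "R < 1" "\<forall>I i. I @ [i] \<in> tstar T \<longrightarrow> r (I @ [i]) \<le> R * r I"
    \<comment> \<open>(M4)\<close>
    and M4: "\<forall>i<Nl. bi_lipschitz (\<phi> i)" "0 < W" "0 < \<delta>0"
      "\<forall>I J. I \<in> tstar T \<and> J \<in> tstar T \<and> I @ J \<in> tstar T \<longrightarrow>
          phiw \<phi> I ` cyl_set T x J = cyl_set T x (I @ J)"
      "\<forall>I\<in>tstar T. \<forall>\<delta>. 0 < \<delta> \<and> \<delta> \<le> \<delta>0 \<longrightarrow>
          nbhd (cyl_set T x I) (r I * W * G * \<delta>) \<subseteq> phiw \<phi> I ` nbhd (gen_set T x) (G * \<delta>)"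
    \<comment> \<open>(M5)\<close>
    and M5: "0 < \<xi>" "\<xi> < \<delta>0"
      "\<forall>e>0. \<exists>m. \<forall>I J. I @ J \<in> tstar T \<and> m \<le> length J \<longrightarrow>
          \<bar>kap_word (kap_plus \<phi> r (gen_set T x) (G * \<xi>)) I J - 1\<bar> < e \<and>
          \<bar>kap_word (kap_minus \<phi> r (gen_set T x) (G * \<xi>)) I J - 1\<bar> < e"
    \<comment> \<open>(M6)\<close>
    and M6: "\<forall>\<omega>\<in>T. (\<lambda>n. r (pre \<omega> (Suc n)) / r (pre (shift \<omega>) n)) \<longlonglongrightarrow> rho_lim r \<omega>
                 \<and> 0 < rho_lim r \<omega> \<and> rho_lim r \<omega> < 1"
      "word_continuous_on T (rho_lim r)"
      "holder_on (T \<union> emb Nl ` tstar T) f1t" "holder_on (T \<union> emb Nl ` tstar T) f2t"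
      "\<forall>I\<in>tstar T. f1t (emb Nl I) = fpot r (kap_plus \<phi> r (gen_set T x) (G * \<xi>)) I"
      "\<forall>I\<in>tstar T. f2t (emb Nl I) = fpot r (kap_minus \<phi> r (gen_set T x) (G * \<xi>)) I"
      "\<forall>\<omega>\<in>T. f1t \<omega> = ln (1 / rho_lim r \<omega>) \<and> f2t \<omega> = ln (1 / rho_lim r \<omega>)"
    \<comment> \<open>(M7)\<close>
    and M7: "\<not> lattice_fun T (\<lambda>\<omega>. ln (1 / rho_lim r \<omega>))"
  shows "\<exists>\<theta>>0. ((\<lambda>\<epsilon>. \<epsilon> powr s * N \<epsilon> (gen_set T x)) \<longlongrightarrow> \<theta>) (at_right 0)"
proof -
  interpret radius_tree Nl A T r s \<rho> E R
  proof
    fix I n \<I>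
    assume "I \<in> tstar T" "\<I> \<subseteq> {J \<in> tstar T. n \<le> length J}"
      "\<forall>\<omega>\<in>T. \<exists>!J. J \<in> \<I> \<and> pre \<omega> (length J) = J" "\<exists>J\<in>\<I>. prefix I J"
    then show "r I powr s / E \<le> (\<Sum>J\<in>{J\<in>\<I>. prefix I J}. r J powr s) \<and>
        (\<Sum>J\<in>{J\<in>\<I>. prefix I J}. r J powr s) \<le> E * r I powr s"
      using T3 by blast
  qed (use Nl M1 r_pos pos_consts T5 M3 in auto)
  obtain \<nu> where \<nu>: "conformal \<nu>" using conformal_exists by blast
  \<comment> \<open>(M7) concerns \<open>ln (1 / rho_lim r \<omega>)\<close>, with which
    \<open>f1t\<close> agrees on \<open>T\<close> by (M6).\<close>
  have lat: "\<not> lattice_fun T f1t"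
  proof
    assume "lattice_fun T f1t"
    then obtain g H where gH: "proper_closed_subgroup H" "\<forall>\<omega>\<in>T. g \<omega> \<in> H" "cohomologous T f1t g"
      unfolding lattice_fun_def by blast
    have "cohomologous T (\<lambda>\<omega>. ln (1 / rho_lim r \<omega>)) g"
      using gH(3) M6(7) unfolding cohomologous_def by simp
    then show False using M7 gH unfolding lattice_fun_def by blast
  qed
  interpret renewal_tree Nl A T r s \<rho> E R \<nu> x C D N G W \<xi> \<phi> f1t
  proof
    fix I assume "I \<in> tstar T"
    then show "nbhd (cyl_set T x I) (r I * W * G * \<xi>) \<subseteq> phiw \<phi> I ` nbhd (gen_set T x) (G * \<xi>)"
      using M4(5) M5(1,2) by simp
  next
    fix I J J' assume IJ: "I @ J \<in> tstar T" "I @ J' \<in> tstar T"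
    then have "I \<in> tstar T" using tstar_append_D by blast
    then show "dist (x (I @ J)) (x (I @ J')) \<le> D * r I" using T2 IJ by blast
  next
    fix e :: real assume "0 < e"
    then show "\<exists>m. \<forall>I J. I @ J \<in> tstar T \<and> m \<le> length J \<longrightarrow>
          \<bar>kap_word (kap_plus \<phi> r (gen_set T x) (G * \<xi>)) I J - 1\<bar> < e \<and>
          \<bar>kap_word (kap_minus \<phi> r (gen_set T x) (G * \<xi>)) I J - 1\<bar> < e"
      using M5(3) by simp
  qed (use \<nu> pos_consts T1 T2 M2 counting M4(1,2,4) M5(1) M6(3,5) lat in simp_all)
  show ?thesis
    using counting_limit nu_pos[OF Nil_in_tstar] vsup_pos by (intro exI[of _ "\<nu> [] * vsup"]) simp
qed

end
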